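(* Let $k$ be a commutative Noetherian ring, let $\leqslant$ be a homogeneous linear order on a set $S$, let $G$ be a group acting on $S$ via a group homomorphism $\rho: G \to \mathrm{Aut}(S, \leqslant)$, and let $\tilde{G} = \mathrm{Aut}(S,\leqslant)$. Suppose that the action of $G$ on $S$ is highly homogeneous. Then there is an equivalence of categories $$k[S]G\text{-}\mathrm{Mod}^{\mathrm{dis}} \simeq k[S]\tilde{G}\text{-}\mathrm{Mod}^{\mathrm{dis}}.$$ Moreover, every finitely generated discrete $k[S]G$-module is Noetherian. In particular, $k[S]$ as a $k[S]G$-module is Noetherian.
   Context: A linear order $\leqslant$ on $S$ is homogeneous if it is unbounded (no minimal and no maximal element) and for every two pairs $a<b$ and $c<d$ in $S$ the open intervals $(a,b)$ and $(c,d)$ are isomorphic as linearly ordered sets. $\mathrm{Aut}(S,\leqslant)$ is the group of order-preserving permutations of $S$. An action of $G$ on $S$ is highly homogeneous if for every $n\in\mathbb{N}$ the group $G$ acts transitively on the set $S^{\{n\}}$ of $n$-element subsets of $S$. $k[S] = k[x_s \mid s \in S]$ is the polynomial ring with indeterminates indexed by $S$. A group $G$ acting on $S$ acts on $k[S]$ by $k$-algebra automorphisms via $g \cdot x_s = x_{g\cdot s}$. The skew group ring $k[S]G$ consists of finite sums of elements $ag$ ($a \in k[S]$, $g \in G$), with multiplication $(ag)(bh) = a (g\cdot b)\, gh$. All modules are left modules. $G$ is given the topology in which the pointwise stabilizers $\mathrm{Stab}_G(T)$ of finite subsets $T \subseteq S$ form a base of open neighbourhoods of the identity; similarly for $\tilde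 G$ with its natural action on $S$. A $k[S]G$-module $V$ is discrete if for every $v \in V$ the stabilizer $\{g \in G \mid g\cdot v = v\}$ is open in $G$ (equivalently, contains $\mathrm{Stab}_G(T)$ for some finite $T \subseteq S$). $k[S]G\text{-}\mathrm{Mod}^{\mathrm{dis}}$ is the category of discrete $k[S]G$-modules and $k[S]G$-module homomorphisms. *)

theory Defs
  imports
    "HOL-Algebra.Algebra"
    "HOL-Analysis.Abstract_Topology"
    "HOL-Library.Ramsey"
begin

section \<open>Homogeneous linear orders and their automorphism groups\<close>

definition open_interval :: "'s rel \<Rightarrow> 's \<Rightarrow> 's \<Rightarrow> 's set" where
  "open_interval r a b = {x. (a, x) \<in> r - Id \<and> (x, b) \<in> r - Id}"

definition order_isos :: "'s rel \<Rightarrow> 's set \<Rightarrow> 's set \<Rightarrow> ('s \<Rightarrow> 's) set" where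
  "order_isos r A B =
     {f. bij_betw f A B \<and> (\<forall>x\<in>A. \<forall>y\<in>A. (x, y) \<in> r \<longleftrightarrow> (f x, f y) \<in> r)}"

definition homogeneous_linear_order :: "'s set \<Rightarrow> 's rel \<Rightarrow> bool" where
  "homogeneous_linear_order S r \<longleftrightarrow>
     linear_order_on S r \<and>
     (\<forall>x\<in>S. \<exists>y\<in>S. (y, x) \<in> r - Id) \<and>
     (\<forall>x\<in>S. \<exists>y\<in>S. (x, y) \<in> r - Id) \<and>
     (\<forall>a\<in>S. \<forall>b\<in>S. \<forall>c\<in>S. \<forall>d\<in>S. (a, b) \<in> r - Id \<longrightarrow> (c, d) \<in> r - Id \<longrightarrow>
        order_isos r (open_interval r a b) (open_interval r c d) \<noteq> {})"

definition order_aut_group :: "'s set \<Rightarrow> 's rel \<Rightarrow> ('s \<Rightarrow> 's) monoid" where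
  "order_aut_group S r = BijGroup S \<lparr>carrier := Bij S \<inter> order_isos r S S\<rparr>"

text \<open>
  An action of \<open>G\<close> on \<open>S\<close> is a homomorphism \<open>\<rho>\<close> from \<open>G\<close> into a group of permutations
  of \<open>S\<close>, as in the library locale \<open>group_action\<close>.
\<close>

definition highly_homogeneous ::
    "('g, 'c) monoid_scheme \<Rightarrow> 's set \<Rightarrow> ('g \<Rightarrow> 's \<Rightarrow> 's) \<Rightarrow> bool" where
  "highly_homogeneous G S \<rho> \<longleftrightarrow>
     (\<forall>n. \<forall>A\<in>nsets S n. \<forall>B\<in>nsets S n. \<exists>g\<in>carrier G. \<rho> g ` A = B)"

definition pointwise_stabilizer ::
    "('g, 'c) monoid_scheme \<Rightarrow> ('g \<Rightarrow> 's \<Rightarrow> 's) \<Rightarrow> 's set \<Rightarrow> 'g set" where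
  "pointwise_stabilizer G \<rho> T = {g \<in> carrier G. \<forall>t\<in>T. g \<in> stabilizer G \<rho> t}"

text \<open>
  The group topology on \<open>G\<close> for which the pointwise stabilizers of finite subsets of \<open>S\<close>
  form a base of neighbourhoods of the identity: by translation, \<open>U\<close> is open iff it
  contains, with each \<open>g\<close>, a left coset of such a stabilizer.
\<close>

definition action_topology ::
    "('g, 'c) monoid_scheme \<Rightarrow> 's set \<Rightarrow> ('g \<Rightarrow> 's \<Rightarrow> 's) \<Rightarrow> 'g topology" where
  "action_topology G S \<rho> = topology (\<lambda>U. U \<subseteq> carrier G \<and>
     (\<forall>g\<in>U. \<exists>T. finite T \<and> T \<subseteq> S \<and> g <#\<^bsub>G\<^esub> pointwise_stabilizer G \<rho> T \<subseteq> U))"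

lemma openin_action_topology:
  "openin (action_topology G S \<rho>) U \<longleftrightarrow> U \<subseteq> carrier G \<and>
     (\<forall>g\<in>U. \<exists>T. finite T \<and> T \<subseteq> S \<and> g <#\<^bsub>G\<^esub> pointwise_stabilizer G \<rho> T \<subseteq> U)"
proof -
  let ?P = "\<lambda>U. U \<subseteq> carrier G \<and>
     (\<forall>g\<in>U. \<exists>T. finite T \<and> T \<subseteq> S \<and> g <#\<^bsub>G\<^esub> pointwise_stabilizer G \<rho> T \<subseteq> U)"
  have anti: "g <#\<^bsub>G\<^esub> pointwise_stabilizer G \<rho> (T1 \<union> T2)
      \<subseteq> (g <#\<^bsub>G\<^esub> pointwise_stabilizer G \<rho> T1) \<inter> (g <#\<^bsub>G\<^esub> pointwise_stabilizer G \<rho> T2)" for g T1 T2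
    by (auto simp: pointwise_stabilizer_def l_coset_def)
  have "istopology ?P"
    unfolding istopology_def
  proof (intro conjI allI impI)
    fix U V assume "?P U" "?P V"
    show "\<forall>g\<in>U \<inter> V. \<exists>T. finite T \<and> T \<subseteq> S \<and>
            g <#\<^bsub>G\<^esub> pointwise_stabilizer G \<rho> T \<subseteq> U \<inter> V"
    proof
      fix g assume "g \<in> U \<inter> V"
      then obtain T1 T2 where
        "finite T1" "T1 \<subseteq> S" "g <#\<^bsub>G\<^esub> pointwise_stabilizer G \<rho> T1 \<subseteq> U"
        "finite T2" "T2 \<subseteq> S" "g <#\<^bsub>G\<^esub> pointwise_stabilizer G \<rho> T2 \<subseteq> V"
        using \<open>?P U\<close> \<open>?P V\<close> by blast
      then show "\<exists>T. finite T \<and> T \<subseteq> S \<and> g <#\<^bsub>G\<^esub> pointwise_stabilizer G \<rho> T \<subseteq> U \<inter> V"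
        using anti[of g T1 T2] by (intro exI[of _ "T1 \<union> T2"]) blast
    qed
  qed (auto, meson Union_upper subset_trans)
  then show ?thesis
    by (simp add: action_topology_def topology_inverse')
qed


section \<open>Polynomial rings and skew group rings\<close>

text \<open>
  \<open>k[S]\<close>, with the library's representation of indexed polynomials: a monomial is a
  multiset of indeterminates, a polynomial maps every monomial to its coefficient.
\<close>

definition poly_ring ::
    "('a, 'b) ring_scheme \<Rightarrow> 's set \<Rightarrow> ('s multiset \<Rightarrow> 'a) ring" where
  "poly_ring k S =
     \<lparr>carrier = ring.indexed_pset k S (carrier k),
      monoid.mult = (\<lambda>p q m. finsum k (\<lambda>(a, b). p a \<otimes>\<^bsub>k\<^esub> q b) {(a, b). a + b = m}),
      one = ring.indexed_const k \<one>\<^bsub>k\<^esub>,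
      ring.zero = ring.indexed_const k \<zero>\<^bsub>k\<^esub>,
      ring.add = ring.indexed_padd k\<rparr>"

text \<open>
  The \<open>k\<close>-algebra automorphism of \<open>k[S]\<close> with \<open>x\<^sub>s \<mapsto> x\<^bsub>\<sigma> s\<^esub>\<close> for a
  permutation \<open>\<sigma>\<close> of \<open>S\<close>: the coefficient of \<open>\<sigma> \<cdot> p\<close> at \<open>m\<close> is that of \<open>p\<close> at \<open>\<sigma>\<^sup>-\<^sup>1 m\<close>.
\<close>

definition poly_act ::
    "('a, 'b) ring_scheme \<Rightarrow> 's set \<Rightarrow> ('s \<Rightarrow> 's) \<Rightarrow> ('s multiset \<Rightarrow> 'a) \<Rightarrow> 's multiset \<Rightarrow> 'a" where
  "poly_act k S \<sigma> p =
     (\<lambda>m. if set_mset m \<subseteq> S then p (image_mset (inv_into S \<sigma>) m) else \<zero>\<^bsub>k\<^esub>)"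

definition skew_support :: "('r, 'b) ring_scheme \<Rightarrow> ('g \<Rightarrow> 'r) \<Rightarrow> 'g set" where
  "skew_support R f = {g. f g \<noteq> \<zero>\<^bsub>R\<^esub>}"

text \<open>
  \<open>k[S]G\<close>, the formal sum \<open>\<Sum>\<^sub>g a\<^sub>g g\<close> being the finitely supported function \<open>g \<mapsto> a\<^sub>g\<close>.
\<close>

definition skew_group_ring ::
    "('a, 'b) ring_scheme \<Rightarrow> 's set \<Rightarrow> ('g, 'c) monoid_scheme \<Rightarrow> ('g \<Rightarrow> 's \<Rightarrow> 's)
       \<Rightarrow> ('g \<Rightarrow> 's multiset \<Rightarrow> 'a) ring" where
  "skew_group_ring k S G \<rho> = (let R = poly_ring k S in
     \<lparr>carrier = {f. (\<forall>g. f g \<in> carrier R) \<and> finite (skew_support R f)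
                     \<and> skew_support R f \<subseteq> carrier G},
      monoid.mult = (\<lambda>f h x. finsum R (\<lambda>(g, g'). f g \<otimes>\<^bsub>R\<^esub> poly_act k S (\<rho> g) (h g'))
                {(g, g'). g \<in> skew_support R f \<and> g' \<in> skew_support R h \<and> g \<otimes>\<^bsub>G\<^esub> g' = x}),
      one = (\<lambda>x. if x = \<one>\<^bsub>G\<^esub> then \<one>\<^bsub>R\<^esub> else \<zero>\<^bsub>R\<^esub>),
      ring.zero = (\<lambda>x. \<zero>\<^bsub>R\<^esub>),
      ring.add = (\<lambda>f h x. f x \<oplus>\<^bsub>R\<^esub> h x)\<rparr>)"

text \<open>The element \<open>1g\<close> of \<open>k[S]G\<close>; it gives the action of \<open>G\<close> on a \<open>k[S]G\<close>-module.\<close>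

definition skew_elem ::
    "('a, 'b) ring_scheme \<Rightarrow> 's set \<Rightarrow> 'g \<Rightarrow> ('g \<Rightarrow> 's multiset \<Rightarrow> 'a)" where
  "skew_elem k S g = (\<lambda>x. if x = g then \<one>\<^bsub>poly_ring k S\<^esub> else \<zero>\<^bsub>poly_ring k S\<^esub>)"

text \<open>
  The fields \<open>mult\<close> and \<open>one\<close>, which the record \<open>module\<close> inherits from \<open>ring\<close>, play no role
  for a module.
\<close>

definition poly_module ::
    "('a, 'b) ring_scheme \<Rightarrow> 's set \<Rightarrow> ('g \<Rightarrow> 's \<Rightarrow> 's)
       \<Rightarrow> ('g \<Rightarrow> 's multiset \<Rightarrow> 'a, 's multiset \<Rightarrow> 'a) module" where
  "poly_module k S \<rho> = (let R = poly_ring k S in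
     \<lparr>carrier = carrier R, monoid.mult = monoid.mult R, one = \<one>\<^bsub>R\<^esub>,
      ring.zero = \<zero>\<^bsub>R\<^esub>, ring.add = ring.add R,
      smult = (\<lambda>f p. \<Oplus>\<^bsub>R\<^esub>g \<in> skew_support R f. f g \<otimes>\<^bsub>R\<^esub> poly_act k S (\<rho> g) p)\<rparr>)"


section \<open>Left modules\<close>

text \<open>
  The library locale \<open>module\<close> demands a commutative base ring; these are its axioms over
  an arbitrary ring.
\<close>

locale left_module = R?: ring R + M?: abelian_group M
  for R :: "('r, 'b) ring_scheme" (structure)
    and M :: "('r, 'm, 'c) module_scheme" (structure) +
  assumes smult_closed [simp, intro]:
      "\<lbrakk>a \<in> carrier R; x \<in> carrier M\<rbrakk> \<Longrightarrow> a \<odot>\<^bsub>M\<^esub> x \<in> carrier M"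
    and smult_l_distr:
      "\<lbrakk>a \<in> carrier R; b \<in> carrier R; x \<in> carrier M\<rbrakk> \<Longrightarrow>
         (a \<oplus> b) \<odot>\<^bsub>M\<^esub> x = a \<odot>\<^bsub>M\<^esub> x \<oplus>\<^bsub>M\<^esub> b \<odot>\<^bsub>M\<^esub> x"
    and smult_r_distr:
      "\<lbrakk>a \<in> carrier R; x \<in> carrier M; y \<in> carrier M\<rbrakk> \<Longrightarrow>
         a \<odot>\<^bsub>M\<^esub> (x \<oplus>\<^bsub>M\<^esub> y) = a \<odot>\<^bsub>M\<^esub> x \<oplus>\<^bsub>M\<^esub> a \<odot>\<^bsub>M\<^esub> y"
    and smult_assoc:
      "\<lbrakk>a \<in> carrier R; b \<in> carrier R; x \<in> carrier M\<rbrakk> \<Longrightarrow>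
         (a \<otimes> b) \<odot>\<^bsub>M\<^esub> x = a \<odot>\<^bsub>M\<^esub> (b \<odot>\<^bsub>M\<^esub> x)"
    and smult_one [simp]:
      "x \<in> carrier M \<Longrightarrow> \<one> \<odot>\<^bsub>M\<^esub> x = x"

definition module_homs ::
    "('r, 'b) ring_scheme \<Rightarrow> ('r, 'm, 'c) module_scheme \<Rightarrow> ('r, 'n, 'd) module_scheme
       \<Rightarrow> ('m \<Rightarrow> 'n) set" where
  "module_homs R M N =
     {f \<in> carrier M \<rightarrow>\<^sub>E carrier N.
        (\<forall>x\<in>carrier M. \<forall>y\<in>carrier M. f (x \<oplus>\<^bsub>M\<^esub> y) = f x \<oplus>\<^bsub>N\<^esub> f y) \<and>
        (\<forall>a\<in>carrier R. \<forall>x\<in>carrier M. f (a \<odot>\<^bsub>M\<^esub> x) = a \<odot>\<^bsub>N\<^esub> f x)}"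

definition generated_submodule ::
    "('r, 'b) ring_scheme \<Rightarrow> ('r, 'm, 'c) module_scheme \<Rightarrow> 'm set \<Rightarrow> 'm set" where
  "generated_submodule R M A = \<Inter>{H. submodule H R M \<and> A \<subseteq> H}"

definition finitely_generated ::
    "('r, 'b) ring_scheme \<Rightarrow> ('r, 'm, 'c) module_scheme \<Rightarrow> bool" where
  "finitely_generated R M \<longleftrightarrow>
     (\<exists>A\<subseteq>carrier M. finite A \<and> generated_submodule R M A = carrier M)"

locale noetherian_module = left_module +
  assumes submodule_finitely_generated:
    "submodule H R M \<Longrightarrow> \<exists>A\<subseteq>carrier M. finite A \<and> H = generated_submodule R M A"

definition discrete_module ::
    "('a, 'b) ring_scheme \<Rightarrow> 's set \<Rightarrow> ('g, 'c) monoid_scheme \<Rightarrow> ('g \<Rightarrow> 's \<Rightarrow> 's)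
       \<Rightarrow> ('g \<Rightarrow> 's multiset \<Rightarrow> 'a, 'm) module \<Rightarrow> bool" where
  "discrete_module k S G \<rho> V \<longleftrightarrow>
     left_module (skew_group_ring k S G \<rho>) V \<and>
     (\<forall>v\<in>carrier V.
        openin (action_topology G S \<rho>) (stabilizer G (\<lambda>g v. skew_elem k S g \<odot>\<^bsub>V\<^esub> v) v))"


section \<open>Categories\<close>

text \<open>
  \<open>cat_hom C U V\<close> is the set of morphisms \<open>U \<rightarrow> V\<close>, and \<open>cat_comp C U V W g f\<close> is the
  composite of \<open>f : U \<rightarrow> V\<close> and \<open>g : V \<rightarrow> W\<close>. Since composition is indexed by the objects
  involved, different hom-sets need not be disjoint.
\<close>

record ('o, 'm) category =
  cat_obj :: "'o set"
  cat_hom :: "'o \<Rightarrow> 'o \<Rightarrow> 'm set"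
  cat_id :: "'o \<Rightarrow> 'm"
  cat_comp :: "'o \<Rightarrow> 'o \<Rightarrow> 'o \<Rightarrow> 'm \<Rightarrow> 'm \<Rightarrow> 'm"

locale category =
  fixes C :: "('o, 'm, 'c) category_scheme"
  assumes id_in_hom: "U \<in> cat_obj C \<Longrightarrow> cat_id C U \<in> cat_hom C U U"
    and comp_in_hom:
      "\<lbrakk>U \<in> cat_obj C; V \<in> cat_obj C; W \<in> cat_obj C; f \<in> cat_hom C U V; g \<in> cat_hom C V W\<rbrakk>
       \<Longrightarrow> cat_comp C U V W g f \<in> cat_hom C U W"
    and comp_id_right:
      "\<lbrakk>U \<in> cat_obj C; V \<in> cat_obj C; f \<in> cat_hom C U V\<rbrakk>
       \<Longrightarrow> cat_comp C U U V f (cat_id C U) = f"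
    and comp_id_left:
      "\<lbrakk>U \<in> cat_obj C; V \<in> cat_obj C; f \<in> cat_hom C U V\<rbrakk>
       \<Longrightarrow> cat_comp C U V V (cat_id C V) f = f"
    and comp_assoc:
      "\<lbrakk>T \<in> cat_obj C; U \<in> cat_obj C; V \<in> cat_obj C; W \<in> cat_obj C;
        f \<in> cat_hom C T U; g \<in> cat_hom C U V; h \<in> cat_hom C V W\<rbrakk>
       \<Longrightarrow> cat_comp C T U W (cat_comp C U V W h g) f
           = cat_comp C T V W h (cat_comp C T U V g f)"

definition is_iso_in :: "('o, 'm, 'c) category_scheme \<Rightarrow> 'o \<Rightarrow> 'o \<Rightarrow> 'm \<Rightarrow> bool" where
  "is_iso_in C U V f \<longleftrightarrow> f \<in> cat_hom C U V \<and>
     (\<exists>g\<in>cat_hom C V U. cat_comp C U V U g f = cat_id C U \<and> cat_comp C V U V f g = cat_id C V)"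

text \<open>A functor is given by its object map \<open>F\<close> and its maps \<open>\<phi> U V\<close> on hom-sets.\<close>

locale category_functor = C: category C + D: category D
  for C :: "('o, 'm, 'c) category_scheme" and D :: "('p, 'n, 'd) category_scheme" +
  fixes F :: "'o \<Rightarrow> 'p" and \<phi> :: "'o \<Rightarrow> 'o \<Rightarrow> 'm \<Rightarrow> 'n"
  assumes map_obj: "U \<in> cat_obj C \<Longrightarrow> F U \<in> cat_obj D"
    and map_hom:
      "\<lbrakk>U \<in> cat_obj C; V \<in> cat_obj C; f \<in> cat_hom C U V\<rbrakk> \<Longrightarrow> \<phi> U V f \<in> cat_hom D (F U) (F V)"
    and map_id: "U \<in> cat_obj C \<Longrightarrow> \<phi> U U (cat_id C U) = cat_id D (F U)"
    and map_comp:
      "\<lbrakk>U \<in> cat_obj C; V \<in> cat_obj C; W \<in> cat_obj C; f \<in> cat_hom C U V; g \<in> cat_hom C V W\<rbrakk>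
       \<Longrightarrow> \<phi> U W (cat_comp C U V W g f) = cat_comp D (F U) (F V) (F W) (\<phi> V W g) (\<phi> U V f)"

locale natural_isomorphism = F: category_functor C D F \<phi> + G: category_functor C D G \<psi>
  for C :: "('o, 'm, 'c) category_scheme" and D :: "('p, 'n, 'd) category_scheme"
    and F \<phi> G \<psi> +
  fixes \<eta> :: "'o \<Rightarrow> 'n"
  assumes iso: "U \<in> cat_obj C \<Longrightarrow> is_iso_in D (F U) (G U) (\<eta> U)"
    and natural:
      "\<lbrakk>U \<in> cat_obj C; V \<in> cat_obj C; f \<in> cat_hom C U V\<rbrakk>
       \<Longrightarrow> cat_comp D (F U) (F V) (G V) (\<eta> V) (\<phi> U V f)
           = cat_comp D (F U) (G U) (G V) (\<psi> U V f) (\<eta> U)"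

definition equivalent_categories ::
    "('o, 'm, 'c) category_scheme \<Rightarrow> ('p, 'n, 'd) category_scheme \<Rightarrow> bool" where
  "equivalent_categories C D \<longleftrightarrow> (\<exists>F \<phi> G \<psi>.
     category_functor C D F \<phi> \<and> category_functor D C G \<psi> \<and>
     (\<exists>\<eta>. natural_isomorphism C C (\<lambda>U. U) (\<lambda>U V f. f)
            (\<lambda>U. G (F U)) (\<lambda>U V f. \<psi> (F U) (F V) (\<phi> U V f)) \<eta>) \<and>
     (\<exists>\<epsilon>. natural_isomorphism D D (\<lambda>U. F (G U)) (\<lambda>U V f. \<phi> (G U) (G V) (\<psi> U V f))
            (\<lambda>U. U) (\<lambda>U V f. f) \<epsilon>))"

text \<open>
  The type \<open>'m\<close> is the universe from which the underlying sets of the modules are taken.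
\<close>

definition discrete_module_category ::
    "('a, 'b) ring_scheme \<Rightarrow> 's set \<Rightarrow> ('g, 'c) monoid_scheme \<Rightarrow> ('g \<Rightarrow> 's \<Rightarrow> 's)
       \<Rightarrow> (('g \<Rightarrow> 's multiset \<Rightarrow> 'a, 'm) module, 'm \<Rightarrow> 'm) category" where
  "discrete_module_category k S G \<rho> =
     \<lparr>cat_obj = {V. discrete_module k S G \<rho> V},
      cat_hom = module_homs (skew_group_ring k S G \<rho>),
      cat_id = (\<lambda>V. \<lambda>v\<in>carrier V. v),
      cat_comp = (\<lambda>U V W g f. compose (carrier U) g f)\<rparr>"

end

theory Submission
  imports Defs "HOL-Library.Sublist" "HOL-Library.Multiset_Order" "HOL-Library.Product_Lexorder"
begin

text \<open>
  \<^bold>\<open>The equivalence.\<close> By high homogeneity some \<open>g \<in> G\<close> moves a given finite set \<open>T\<close> onto its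
  image under a given order automorphism \<open>\<sigma>\<close>, and since there is only one increasing bijection
  between finite linear orders, \<open>g\<close> agrees with \<open>\<sigma>\<close> on \<open>T\<close> (\<open>dense_in_aut\<close>). So the image of
  \<open>G\<close> is dense in the automorphism group. An element \<open>v\<close> of a discrete module has a finite support
  \<open>T\<close>, and \<open>\<sigma> v\<close> can be defined as \<open>g v\<close> for any \<open>g\<close> agreeing with \<open>\<sigma>\<close> on \<open>T\<close>. This turns
  discrete modules over one group into discrete modules over the other, without changing the
  underlying abelian groups or the homomorphisms. Restriction along \<open>\<rho>\<close> is an instance of the same
  construction with the two groups exchanged, so that one functor is studied, and the two composites
  are the identity up to what happens outside the carriers
  (\<open>equivalent_discrete_module_categories\<close>).

  \<^bold>\<open>Noetherianity.\<close> Let \<open>V\<close> be discrete, generated by \<open>v\<^sub>0, \<dots>, v\<^bsub>n-1\<^esub>\<close> with finite supports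
  \<open>T\<^sub>i\<close>. Additively, \<open>V\<close> is spanned over \<open>k\<close> by the elements \<open>x\<^sup>a g v\<^sub>i\<close>, and \<open>g v\<^sub>i\<close> depends
  only on the finite set \<open>g T\<^sub>i\<close>. For an argument with leading terms, these elements should be
  well-ordered in a way compatible with the group, which is impossible on \<open>S\<close> itself unless \<open>S\<close> is
  empty. Therefore an increasing sequence in \<open>S\<close> is fixed. Every element of \<open>V\<close> can be moved by \<open>G\<close> into the span
  of the terms whose positions lie in the sequence, and a submodule of \<open>V\<close> is determined by
  its intersection with that span. Strictly increasing maps
  of \<open>\<nat>\<close> are realised by \<open>G\<close> on any finite set of positions, and together with multiplication
  by monomials they act on the terms, preserving the lexicographic well-order.

  By Higman's lemma, any infinite sequence of terms contains two of which the later one arises from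
  the earlier one by such an operation (\<open>mono_term_almost_full\<close>). As for Hilbert's basis theorem,
  choose elements of a submodule with minimal leading term outside the part generated so far;
  along a chain of comparable terms the leading coefficients generate an ascending chain of
  ideals of \<open>k\<close>, and where it becomes stationary the leading term cancels
  (\<open>finitely_many_generate\<close>).
\<close>

section \<open>Almost full relations and Higman's lemma\<close>

text \<open>
  For a quasi-order this means being a well-quasi-order.
\<close>
definition almost_full_on :: "('a \<Rightarrow> 'a \<Rightarrow> bool) \<Rightarrow> 'a set \<Rightarrow> bool" where
  "almost_full_on P A \<longleftrightarrow>
     (\<forall>f :: nat \<Rightarrow> 'a. range f \<subseteq> A \<longrightarrow> (\<exists>i j. i < j \<and> P (f i) (f j)))"

text \<open>
  Colouring a pair \<open>{i, j}\<close> according to whether \<open>P\<close> relates its two values, Ramsey's theorem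
  gives an infinite monochromatic set, and the colour cannot be the bad one.
\<close>
lemma almost_full_on_subsequence:
  assumes "almost_full_on P A" and "range f \<subseteq> A"
  shows "\<exists>r :: nat \<Rightarrow> nat. strict_mono r \<and> (\<forall>i j. i < j \<longrightarrow> P (f (r i)) (f (r j)))"
proof -
  define c where "c E = (if P (f (Min E)) (f (Max E)) then 0 else 1 :: nat)" for E
  have "\<forall>x\<in>UNIV. \<forall>y\<in>UNIV. x \<noteq> y \<longrightarrow> c {x, y} < 2"
    by (simp add: c_def)
  from Ramsey2[OF infinite_UNIV_nat this]
  obtain Y t where Y: "infinite Y" and t: "\<forall>x\<in>Y. \<forall>y\<in>Y. x \<noteq> y \<longrightarrow> c {x, y} = t"
    by blast
  let ?r = "enumerate Y"
  have r: "strict_mono ?r"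
    using Y by (simp add: strict_mono_enumerate)
  have col: "c {?r i, ?r j} = t" if "i < j" for i j
  proof -
    have "?r i \<in> Y" "?r j \<in> Y"
      using Y by (auto intro: enumerate_in_set)
    moreover have "?r i < ?r j"
      using r that by (simp add: strict_mono_def)
    ultimately show ?thesis
      using t by auto
  qed
  have eq: "c {?r i, ?r j} = (if P (f (?r i)) (f (?r j)) then 0 else 1)" if "i < j" for i j
  proof -
    have "?r i < ?r j"
      using r that by (simp add: strict_mono_def)
    then have "min (?r i) (?r j) = ?r i" "max (?r i) (?r j) = ?r j"
      by auto
    then show ?thesis
      by (simp add: c_def)
  qed
  have "range (\<lambda>n. f (?r n)) \<subseteq> A"
    using assms(2) by auto
  then obtain i j where "i < j" "P (f (?r i)) (f (?r j))"
    using assms(1) unfolding almost_full_on_def by blast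
  then have "t = 0"
    using col[of i j] eq[of i j] by simp
  then have "P (f (?r i)) (f (?r j))" if "i < j" for i j
    using col[OF that] eq[OF that] by (auto split: if_splits)
  with r show ?thesis
    by blast
qed

lemma almost_full_on_nat: "almost_full_on (\<le>) (UNIV :: nat set)"
  unfolding almost_full_on_def
proof (intro allI impI)
  fix f :: "nat \<Rightarrow> nat"
  obtain i where "\<And>j. f i \<le> f j"
    using ex_has_least_nat[of "\<lambda>_. True" 0 f] by auto
  then show "\<exists>i j. i < j \<and> f i \<le> f j"
    by (intro exI[of _ i] exI[of _ "Suc i"]) auto
qed

lemma almost_full_on_eq_finite: "finite A \<Longrightarrow> almost_full_on (=) A"
  unfolding almost_full_on_def
proof (intro allI impI)
  fix f :: "nat \<Rightarrow> 'a"
  assume "finite A" "range f \<subseteq> A"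
  then have "\<not> inj f"
    using finite_imageD infinite_UNIV_nat finite_subset by blast
  then show "\<exists>i j. i < j \<and> f i = f j"
    unfolding inj_def by (metis nat_neq_iff)
qed

lemma almost_full_on_Times:
  assumes "almost_full_on P A" and "almost_full_on Q B"
  shows "almost_full_on (\<lambda>x y. P (fst x) (fst y) \<and> Q (snd x) (snd y)) (A \<times> B)"
  unfolding almost_full_on_def
proof (intro allI impI)
  fix f :: "nat \<Rightarrow> _"
  assume f: "range f \<subseteq> A \<times> B"
  have *: "fst (f n) \<in> A" "snd (f n) \<in> B" for n
    using f[THEN subsetD, OF rangeI, of n] by (auto simp: mem_Times_iff)
  have "range (\<lambda>n. fst (f n)) \<subseteq> A"
    using *(1) by auto
  from almost_full_on_subsequence[OF assms(1) this]
  obtain r :: "nat \<Rightarrow> nat" where r: "strict_mono r" "\<And>i j. i < j \<Longrightarrow> P (fst (f (r i))) (fst (f (r j)))"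
    by blast
  have "range (\<lambda>n. snd (f (r n))) \<subseteq> B"
    using *(2) by auto
  then obtain i j where "i < j" "Q (snd (f (r i))) (snd (f (r j)))"
    using assms(2) unfolding almost_full_on_def by blast
  with r show "\<exists>i j. i < j \<and> P (fst (f i)) (fst (f j)) \<and> Q (snd (f i)) (snd (f j))"
    by (metis strict_mono_def)
qed

lemma almost_full_on_image:
  assumes "almost_full_on Q B"
    and "\<And>x. x \<in> A \<Longrightarrow> h x \<in> B"
    and "\<And>x y. x \<in> A \<Longrightarrow> y \<in> A \<Longrightarrow> Q (h x) (h y) \<Longrightarrow> P x y"
  shows "almost_full_on P A"
  unfolding almost_full_on_def
proof (intro allI impI)
  fix f :: "nat \<Rightarrow> _"
  assume f: "range f \<subseteq> A"
  then have f: "f n \<in> A" for n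
    by auto
  then have "range (\<lambda>n. h (f n)) \<subseteq> B"
    using assms(2) by auto
  then obtain i j where "i < j" "Q (h (f i)) (h (f j))"
    using assms(1) unfolding almost_full_on_def by blast
  then show "\<exists>i j. i < j \<and> P (f i) (f j)"
    using assms(3)[OF f f] by blast
qed

text \<open>
  Nash-Williams' argument: among the bad sequences choose one, \<open>m\<close>, whose entries are
  successively of minimal length; replacing a tail of \<open>m\<close> by the tails of words whose heads
  ascend would give a smaller bad sequence.
\<close>
theorem higman:
  assumes P: "almost_full_on P UNIV"
  shows "almost_full_on (list_emb P) UNIV"
proof (rule ccontr)
  define bad where "bad f \<longleftrightarrow> (\<forall>i j. i < j \<longrightarrow> \<not> list_emb P (f i) (f j))"
    for f :: "nat \<Rightarrow> 'a list"
  define least where "least n f \<longleftrightarrow> bad f \<and>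
     (\<forall>h. bad h \<and> (\<forall>i<n. h i = f i) \<longrightarrow> length (f n) \<le> length (h n))" for n f
  assume "\<not> almost_full_on (list_emb P) UNIV"
  then obtain f0 where f0: "bad f0"
    unfolding almost_full_on_def bad_def by blast
  have step: "\<exists>g. least n g \<and> (\<forall>i<n. g i = f i)" if f: "bad f" for n f
  proof -
    obtain g where "bad g \<and> (\<forall>i<n. g i = f i)"
      and "\<And>h. bad h \<and> (\<forall>i<n. h i = f i) \<Longrightarrow> length (g n) \<le> length (h n)"
      using ex_has_least_nat[of "\<lambda>g. bad g \<and> (\<forall>i<n. g i = f i)" f "\<lambda>g. length (g n)"] f by auto
    then show ?thesis
      unfolding least_def by (intro exI[of _ g]) auto
  qed
  have "\<exists>F. \<forall>n. least n (F n) \<and> (\<forall>i<Suc n. F (Suc n) i = F n i)"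
  proof (rule dependent_nat_choice)
    show "\<exists>x. least 0 x"
      using step[OF f0] by blast
    show "\<exists>y. least (Suc n) y \<and> (\<forall>i<Suc n. y i = x i)" if "least n x" for x n
      using step that unfolding least_def by blast
  qed
  then obtain F where F: "\<And>n. least n (F n)" and F_Suc: "\<And>n i. i < Suc n \<Longrightarrow> F (Suc n) i = F n i"
    by blast
  define m where "m n = F n n" for n
  have Fm: "F n i = m i" if "i \<le> n" for n i
    using that by (induction n) (auto simp: m_def F_Suc le_Suc_eq)
  have bad_m: "bad m"
    unfolding bad_def
  proof (intro allI impI)
    fix i j :: nat assume "i < j"
    moreover have "bad (F j)"
      using F by (simp add: least_def)
    ultimately show "\<not> list_emb P (m i) (m j)"
      using Fm[of i j] Fm[of j j] \<open>i < j\<close> unfolding bad_def by (metis less_or_eq_imp_le)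
  qed
  have minimal: "length (m n) \<le> length (h n)" if "bad h" "\<forall>i<n. h i = m i" for h n
  proof -
    have "\<forall>i<n. h i = F n i"
      using that(2) Fm by simp
    then show ?thesis
      using F[of n] that(1) by (simp add: least_def m_def)
  qed
  have ne: "m i \<noteq> []" for i
    using bad_m[unfolded bad_def, rule_format, of i "Suc i"] by auto
  have "\<exists>r :: nat \<Rightarrow> nat. strict_mono r \<and> (\<forall>i j. i < j \<longrightarrow> P (hd (m (r i))) (hd (m (r j))))"
    by (rule almost_full_on_subsequence[OF P]) simp
  then obtain r :: "nat \<Rightarrow> nat" where r: "strict_mono r"
    and asc: "\<forall>i j. i < j \<longrightarrow> P (hd (m (r i))) (hd (m (r j)))"
    by (elim exE conjE)
  \<comment> \<open>a sequence of the kind excluded by minimality, since \<open>h (r 0)\<close> is a proper suffix\<close>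
  define h where "h i = (if i < r 0 then m i else tl (m (r (i - r 0))))" for i
  have "length (h (r 0)) < length (m (r 0))"
    using ne[of "r 0"] by (simp add: h_def)
  moreover have "\<forall>i<r 0. h i = m i"
    by (simp add: h_def)
  ultimately have "\<not> bad h"
    using minimal[of h "r 0"] by auto
  then obtain i j where ij: "i < j" and emb: "list_emb P (h i) (h j)"
    unfolding bad_def by blast
  have m_tl: "m n = hd (m n) # tl (m n)" for n
    using ne[of n] by simp
  consider "j < r 0" | "i < r 0" "r 0 \<le> j" | "r 0 \<le> i"
    by linarith
  then show False
  proof cases
    case 1
    then have "h i = m i" "h j = m j"
      using ij by (auto simp: h_def)
    then show False
      using ij emb bad_m unfolding bad_def by metis
  next
    case 2
    let ?j = "r (j - r 0)"
    have "list_emb P (m i) (tl (m ?j))"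
      using emb 2 by (simp add: h_def)
    then have "list_emb P (m i) (m ?j)"
      by (subst m_tl[of ?j]) (rule list_emb_Cons)
    moreover have "i < ?j"
      using 2 r strict_mono_less_eq[OF r, of 0 "j - r 0"] by linarith
    ultimately show False
      using bad_m unfolding bad_def by blast
  next
    case 3
    let ?i = "r (i - r 0)" and ?j = "r (j - r 0)"
    have lt: "i - r 0 < j - r 0"
      using 3 ij by auto
    have "list_emb P (tl (m ?i)) (tl (m ?j))"
      using emb 3 ij by (simp add: h_def)
    then have "list_emb P (m ?i) (m ?j)"
      by (subst m_tl[of ?i], subst m_tl[of ?j]) (intro list_emb_Cons2 asc[rule_format, OF lt])
    moreover have "?i < ?j"
      using lt r by (simp add: strict_mono_def)
    ultimately show False
      using bad_m unfolding bad_def by blast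
  qed
qed

lemma list_emb_imp_strict_mono:
  assumes "list_emb P xs ys"
  shows "\<exists>\<phi>. strict_mono \<phi> \<and> (\<forall>i < length xs. \<phi> i < length ys \<and> P (xs ! i) (ys ! \<phi> i))"
  using assms
proof induction
  case (list_emb_Nil ys)
  show ?case
    by (intro exI[of _ id]) (simp add: strict_mono_def)
next
  case (list_emb_Cons xs ys y)
  then obtain \<phi> where "strict_mono \<phi>" "\<forall>i < length xs. \<phi> i < length ys \<and> P (xs ! i) (ys ! \<phi> i)"
    by blast
  then show ?case
    by (intro exI[of _ "\<lambda>i. Suc (\<phi> i)"]) (auto simp: strict_mono_def)
next
  case (list_emb_Cons2 x y xs ys)
  then obtain \<phi> where \<phi>: "strict_mono \<phi>" "\<forall>i < length xs. \<phi> i < length ys \<and> P (xs ! i) (ys ! \<phi> i)"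
    by blast
  let ?\<psi> = "\<lambda>i. case i of 0 \<Rightarrow> 0 | Suc i \<Rightarrow> Suc (\<phi> i)"
  have "strict_mono ?\<psi>"
    using \<phi>(1) by (auto simp: strict_mono_def split: nat.split)
  then show ?case
    using \<phi>(2) list_emb_Cons2.hyps(1)
    by (intro exI[of _ ?\<psi>]) (auto simp: less_Suc_eq_0_disj)
qed


section \<open>Monomials with positions in the natural numbers\<close>

text \<open>
  The triple \<open>(i, a, A)\<close> stands for the element \<open>x\<^sup>a g v\<^sub>i\<close>, where \<open>v\<^sub>i\<close> is the \<open>i\<close>-th
  generator of a module and \<open>g\<close> moves its finite support onto the positions in \<open>A\<close>. Being a
  lexicographic product of a well-order and two multiset orders, this type is well-ordered.
\<close>
type_synonym mono_term = "nat \<times> nat multiset \<times> nat multiset"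

text \<open>
  What becomes of \<open>x\<^sup>a g v\<^sub>i\<close> when it is hit by a group element that acts as \<open>\<phi>\<close> on the relevant
  positions and is then multiplied by \<open>x\<^sup>m\<close>.
\<close>
definition move :: "nat multiset \<Rightarrow> (nat \<Rightarrow> nat) \<Rightarrow> mono_term \<Rightarrow> mono_term" where
  "move m \<phi> = (\<lambda>(i, a, A). (i, m + image_mset \<phi> a, image_mset \<phi> A))"

text \<open>
  The order is chosen for this property: it makes leading terms go to leading terms.
\<close>
lemma move_strict_mono:
  assumes "strict_mono \<phi>" and "t < t'"
  shows "move m \<phi> t < move m \<phi> t'"
proof -
  have "image_mset \<phi> a < image_mset \<phi> b" if "a < b" for a b
    using that assms(1) by (intro image_mset_strict_mono) (auto simp: strict_mono_def)
  then show ?thesis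
    using assms(2) by (cases t, cases t') (auto simp: move_def less_prod_def less_eq_prod_def le_less)
qed

lemma image_mset_subseteq_if_counts:
  assumes "inj \<phi>" and "\<And>p. p \<in># a \<Longrightarrow> count a p \<le> count b (\<phi> p)"
  shows "image_mset \<phi> a \<subseteq># b"
proof (rule mset_subset_eqI)
  fix q
  show "count (image_mset \<phi> a) q \<le> count b q"
  proof (cases "q \<in> \<phi> ` set_mset a")
    case True
    then obtain p where p: "p \<in># a" "q = \<phi> p"
      by auto
    then have "\<phi> -` {q} \<inter> set_mset a = {p}"
      using assms(1) by (auto simp: inj_def)
    then show ?thesis
      using assms(2) p by (simp add: count_image_mset)
  next
    case False
    then have "count (image_mset \<phi> a) q = 0"
      by (auto simp: count_eq_zero_iff)
    then show ?thesis
      by simp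
  qed
qed

text \<open>
  A triple is read as the word of multiplicities over its initial segment of positions, and
  an embedding of words extends to a strictly increasing map of positions. It need only
  respect \<open>A\<close> up to inclusion: since the size of \<open>A\<close> is determined by \<open>i\<close>, inclusion is
  equality.
\<close>
theorem mono_term_almost_full:
  "almost_full_on
     (\<lambda>t t'. \<exists>m \<phi>. strict_mono \<phi> \<and> set_mset m \<subseteq> set_mset (fst (snd t')) \<and> move m \<phi> t = t')
     {(i, a, A). i < n \<and> size A = c i}"
proof -
  \<comment> \<open>the inserted \<open>0\<close> makes the maximum meaningful for empty multisets\<close>
  define word where "word a A = map (\<lambda>p. (count a p, count A p)) [0..<Suc (Max (insert 0 (set_mset (a + A))))]"
    for a A :: "nat multiset"
  have len: "p < length (word a A)" if "p \<in># a + A" for p a A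
    using that by (auto simp: word_def less_Suc_eq_le)
  let ?le = "\<lambda>x y :: nat \<times> nat. fst x \<le> fst y \<and> snd x \<le> snd y"
  have "almost_full_on (list_emb ?le) UNIV"
    using higman almost_full_on_Times[OF almost_full_on_nat almost_full_on_nat] by simp
  then have "almost_full_on (\<lambda>x y. fst x = fst y \<and> list_emb ?le (snd x) (snd y)) ({..<n} \<times> UNIV)"
    by (intro almost_full_on_Times almost_full_on_eq_finite) auto
  then show ?thesis
  proof (rule almost_full_on_image[where h = "\<lambda>(i, a, A). (i, word a A)"])
    fix t t' :: mono_term
    assume t: "t \<in> {(i, a, A). i < n \<and> size A = c i}" "t' \<in> {(i, a, A). i < n \<and> size A = c i}"
      and "fst (case t of (i, a, A) \<Rightarrow> (i, word a A)) = fst (case t' of (i, a, A) \<Rightarrow> (i, word a A)) \<and>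
        list_emb ?le (snd (case t of (i, a, A) \<Rightarrow> (i, word a A))) (snd (case t' of (i, a, A) \<Rightarrow> (i, word a A)))"
    then obtain i a A b B where [simp]: "t = (i, a, A)" "t' = (i, b, B)"
      and emb: "list_emb ?le (word a A) (word b B)" and sz: "size A = size B"
      by (cases t, cases t') auto
    obtain \<phi> where \<phi>: "strict_mono \<phi>"
      and le: "\<And>p. p < length (word a A) \<Longrightarrow> \<phi> p < length (word b B) \<and> ?le (word a A ! p) (word b B ! \<phi> p)"
      using list_emb_imp_strict_mono[OF emb] by blast
    have cnt: "count a p \<le> count b (\<phi> p) \<and> count A p \<le> count B (\<phi> p)" if "p \<in># a + A" for p
      using le[OF len[OF that]] len[OF that] by (auto simp: word_def simp del: upt_Suc)
    have inj: "inj \<phi>"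
      using \<phi> by (simp add: strict_mono_imp_inj_on)
    have a: "image_mset \<phi> a \<subseteq># b" and A: "image_mset \<phi> A \<subseteq># B"
      using cnt by (auto intro!: image_mset_subseteq_if_counts[OF inj])
    have "image_mset \<phi> A = B"
      using A sz by (metis mset_subset_size nless_le size_image_mset subset_mset.le_less)
    then have "move (b - image_mset \<phi> a) \<phi> t = t'"
      using a by (simp add: move_def)
    then show "\<exists>m \<phi>. strict_mono \<phi> \<and> set_mset m \<subseteq> set_mset (fst (snd t')) \<and> move m \<phi> t = t'"
      using \<phi> by (intro exI[of _ "b - image_mset \<phi> a"] exI[of _ \<phi>]) (auto dest: in_diffD)
  qed auto
qed


section \<open>Twisted monoid rings and their modules\<close>

text \<open>
  The element \<open>a g\<close> of a monoid ring: a single term of a polynomial, or of a skew group ring.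
\<close>
definition single :: "('r, 'b) ring_scheme \<Rightarrow> 'r \<Rightarrow> 'g \<Rightarrow> 'g \<Rightarrow> 'r" where
  "single R a g = (\<lambda>x. if x = g then a else \<zero>\<^bsub>R\<^esub>)"

lemma skew_support_single: "skew_support R (single R a g) \<subseteq> {g}"
  by (auto simp: skew_support_def single_def)

lemma single_same [simp]: "single R a g g = a"
  by (simp add: single_def)

text \<open>
  Polynomial rings (a trivial action of the monoid of monomials on the coefficients) and skew
  group rings are both instances, so the ring axioms are checked only once. The product is
  prescribed on the carrier only, because the two instances extend it differently.
\<close>
locale twisted_monoid_ring = R: ring R + M: monoid M
  for R :: "('r, 'b) ring_scheme" and M :: "('g, 'c) monoid_scheme" +
  fixes \<alpha> :: "'g \<Rightarrow> 'r \<Rightarrow> 'r" and P :: "('g \<Rightarrow> 'r, 'p) ring_scheme"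
  assumes act_hom: "g \<in> carrier M \<Longrightarrow> \<alpha> g \<in> ring_hom R R"
    and act_mult: "\<lbrakk>g \<in> carrier M; g' \<in> carrier M; a \<in> carrier R\<rbrakk> \<Longrightarrow> \<alpha> (g \<otimes>\<^bsub>M\<^esub> g') a = \<alpha> g (\<alpha> g' a)"
    and act_one: "a \<in> carrier R \<Longrightarrow> \<alpha> \<one>\<^bsub>M\<^esub> a = a"
    and carrier_eq: "carrier P = {f. (\<forall>g. f g \<in> carrier R) \<and> finite (skew_support R f)
                                     \<and> skew_support R f \<subseteq> carrier M}"
    and zero_eq: "\<zero>\<^bsub>P\<^esub> = (\<lambda>g. \<zero>\<^bsub>R\<^esub>)"
    and one_eq: "\<one>\<^bsub>P\<^esub> = single R \<one>\<^bsub>R\<^esub> \<one>\<^bsub>M\<^esub>"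
    and add_eq: "f \<oplus>\<^bsub>P\<^esub> h = (\<lambda>g. f g \<oplus>\<^bsub>R\<^esub> h g)"
    and mult_eq: "\<lbrakk>f \<in> carrier P; h \<in> carrier P\<rbrakk> \<Longrightarrow> (f \<otimes>\<^bsub>P\<^esub> h) x =
          finsum R (\<lambda>(g, g'). f g \<otimes>\<^bsub>R\<^esub> \<alpha> g (h g'))
            {(g, g'). g \<in> skew_support R f \<and> g' \<in> skew_support R h \<and> g \<otimes>\<^bsub>M\<^esub> g' = x}"
begin

lemma act_closed: "\<lbrakk>g \<in> carrier M; a \<in> carrier R\<rbrakk> \<Longrightarrow> \<alpha> g a \<in> carrier R"
  using act_hom ring_hom_closed by metis

lemma act_add:
  "\<lbrakk>g \<in> carrier M; a \<in> carrier R; b \<in> carrier R\<rbrakk> \<Longrightarrow> \<alpha> g (a \<oplus>\<^bsub>R\<^esub> b) = \<alpha> g a \<oplus>\<^bsub>R\<^esub> \<alpha> g b"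
  using act_hom ring_hom_add by metis

lemma act_times:
  "\<lbrakk>g \<in> carrier M; a \<in> carrier R; b \<in> carrier R\<rbrakk> \<Longrightarrow> \<alpha> g (a \<otimes>\<^bsub>R\<^esub> b) = \<alpha> g a \<otimes>\<^bsub>R\<^esub> \<alpha> g b"
  using act_hom ring_hom_mult by metis

lemma act_unit: "g \<in> carrier M \<Longrightarrow> \<alpha> g \<one>\<^bsub>R\<^esub> = \<one>\<^bsub>R\<^esub>"
  using act_hom ring_hom_one by metis

lemma act_zero: "g \<in> carrier M \<Longrightarrow> \<alpha> g \<zero>\<^bsub>R\<^esub> = \<zero>\<^bsub>R\<^esub>"
  by (metis act_add act_closed R.add.l_cancel_one R.zero_closed R.r_zero)

lemma in_carrierD:
  assumes "f \<in> carrier P"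
  shows "f g \<in> carrier R" and "finite (skew_support R f)" and "skew_support R f \<subseteq> carrier M"
  using assms by (auto simp: carrier_eq)

lemma carrierI:
  assumes "\<And>g. f g \<in> carrier R" and "finite A" and "A \<subseteq> carrier M"
    and "\<And>g. g \<notin> A \<Longrightarrow> f g = \<zero>\<^bsub>R\<^esub>"
  shows "f \<in> carrier P"
proof -
  have "skew_support R f \<subseteq> A"
    using assms(4) by (auto simp: skew_support_def)
  with assms show ?thesis
    by (auto simp: carrier_eq intro: finite_subset)
qed

lemma single_closed [simp, intro]:
  "\<lbrakk>a \<in> carrier R; g \<in> carrier M\<rbrakk> \<Longrightarrow> single R a g \<in> carrier P"
  by (rule carrierI[of _ "{g}"]) (auto simp: single_def)

lemma zero_single: "\<zero>\<^bsub>P\<^esub> = single R \<zero>\<^bsub>R\<^esub> g"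
  by (auto simp: zero_eq single_def)

lemma add_closed [simp, intro]:
  assumes "f \<in> carrier P" "h \<in> carrier P"
  shows "f \<oplus>\<^bsub>P\<^esub> h \<in> carrier P"
  by (rule carrierI[of _ "skew_support R f \<union> skew_support R h"])
    (use assms in_carrierD in \<open>auto simp: add_eq skew_support_def\<close>)

lemma single_add:
  "\<lbrakk>a \<in> carrier R; b \<in> carrier R\<rbrakk> \<Longrightarrow> single R (a \<oplus>\<^bsub>R\<^esub> b) g = single R a g \<oplus>\<^bsub>P\<^esub> single R b g"
  by (auto simp: single_def add_eq)

text \<open>
  Both the ring and the module axioms are additive in every argument, so that they reduce to
  elements \<open>a g\<close>.
\<close>
lemma single_induct [consumes 1, case_names single add]:
  assumes f: "f \<in> carrier P"
    and single: "\<And>a g. \<lbrakk>a \<in> carrier R; g \<in> carrier M\<rbrakk> \<Longrightarrow> Q (single R a g)"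
    and add: "\<And>f h. \<lbrakk>f \<in> carrier P; h \<in> carrier P; Q f; Q h\<rbrakk> \<Longrightarrow> Q (f \<oplus>\<^bsub>P\<^esub> h)"
  shows "Q f"
proof -
  have "Q f" if "finite A" "A \<subseteq> carrier M" "\<And>g. f g \<in> carrier R" "\<And>g. g \<notin> A \<Longrightarrow> f g = \<zero>\<^bsub>R\<^esub>" for A f
    using that
  proof (induction A arbitrary: f rule: finite_induct)
    case empty
    then have "f = single R \<zero>\<^bsub>R\<^esub> \<one>\<^bsub>M\<^esub>"
      by (auto simp: single_def)
    then show ?case
      using single by simp
  next
    case (insert g A)
    let ?f = "f(g := \<zero>\<^bsub>R\<^esub>)"
    have "Q ?f"
      using insert.prems by (intro insert.IH) auto
    moreover have "?f \<in> carrier P"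
      using insert.prems insert.hyps by (intro carrierI[of _ A]) auto
    moreover have "Q (single R (f g) g)"
      using insert.prems single by auto
    moreover have "f = single R (f g) g \<oplus>\<^bsub>P\<^esub> ?f"
      using insert.prems by (auto simp: single_def add_eq)
    ultimately show ?case
      using add[of "single R (f g) g" ?f] insert.prems by auto
  qed
  then show ?thesis
    using in_carrierD[OF f] by (auto simp: skew_support_def)
qed

text \<open>
  Over index sets that do not depend on the supports, the product is visibly additive in each
  factor.
\<close>
lemma mult_superset:
  assumes f: "f \<in> carrier P" and h: "h \<in> carrier P"
    and A: "finite A" "skew_support R f \<subseteq> A" "A \<subseteq> carrier M"
    and B: "finite B" "skew_support R h \<subseteq> B" "B \<subseteq> carrier M"
  shows "(f \<otimes>\<^bsub>P\<^esub> h) x =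
    finsum R (\<lambda>p. if fst p \<otimes>\<^bsub>M\<^esub> snd p = x then f (fst p) \<otimes>\<^bsub>R\<^esub> \<alpha> (fst p) (h (snd p)) else \<zero>\<^bsub>R\<^esub>) (A \<times> B)"
  unfolding mult_eq[OF f h]
proof (rule R.add.finprod_mono_neutral_cong_left)
  show "finite (A \<times> B)"
    using A B by simp
  show "{(g, g'). g \<in> skew_support R f \<and> g' \<in> skew_support R h \<and> g \<otimes>\<^bsub>M\<^esub> g' = x} \<subseteq> A \<times> B"
    using A B by auto
  show "(if fst p \<otimes>\<^bsub>M\<^esub> snd p = x then f (fst p) \<otimes>\<^bsub>R\<^esub> \<alpha> (fst p) (h (snd p)) else \<zero>\<^bsub>R\<^esub>) = \<zero>\<^bsub>R\<^esub>"
    if "p \<in> A \<times> B - {(g, g'). g \<in> skew_support R f \<and> g' \<in> skew_support R h \<and> g \<otimes>\<^bsub>M\<^esub> g' = x}" for p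
  proof -
    have "f (fst p) = \<zero>\<^bsub>R\<^esub> \<or> h (snd p) = \<zero>\<^bsub>R\<^esub> \<or> fst p \<otimes>\<^bsub>M\<^esub> snd p \<noteq> x"
      using that by (auto simp: skew_support_def)
    moreover have "fst p \<in> carrier M"
      using that A by auto
    ultimately show ?thesis
      using in_carrierD(1)[OF f] in_carrierD(1)[OF h] by (auto simp: act_zero act_closed)
  qed
  show "(case p of (g, g') \<Rightarrow> f g \<otimes>\<^bsub>R\<^esub> \<alpha> g (h g')) =
    (if fst p \<otimes>\<^bsub>M\<^esub> snd p = x then f (fst p) \<otimes>\<^bsub>R\<^esub> \<alpha> (fst p) (h (snd p)) else \<zero>\<^bsub>R\<^esub>)"
    if "p \<in> {(g, g'). g \<in> skew_support R f \<and> g' \<in> skew_support R h \<and> g \<otimes>\<^bsub>M\<^esub> g' = x}" for p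
    using that by auto
  show "(\<lambda>p. if fst p \<otimes>\<^bsub>M\<^esub> snd p = x then f (fst p) \<otimes>\<^bsub>R\<^esub> \<alpha> (fst p) (h (snd p)) else \<zero>\<^bsub>R\<^esub>)
    \<in> A \<times> B \<rightarrow> carrier R"
    using A B in_carrierD(1)[OF f] in_carrierD(1)[OF h] by (auto simp: act_closed subset_iff)
qed

lemma mult_closed:
  assumes f: "f \<in> carrier P" and h: "h \<in> carrier P"
  shows "f \<otimes>\<^bsub>P\<^esub> h \<in> carrier P"
proof -
  let ?A = "skew_support R f" and ?B = "skew_support R h"
  note fh = in_carrierD[OF f] in_carrierD[OF h]
  let ?X = "(\<lambda>p. fst p \<otimes>\<^bsub>M\<^esub> snd p) ` (?A \<times> ?B)"
  note eq = mult_superset[OF f h fh(2) order_refl fh(3) fh(5) order_refl fh(6)]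
  show ?thesis
  proof (rule carrierI)
    show "finite ?X"
      using fh by blast
    show "?X \<subseteq> carrier M"
      using fh(3,6) by (auto intro!: M.m_closed)
    show "(f \<otimes>\<^bsub>P\<^esub> h) x \<in> carrier R" for x
      unfolding eq using fh by (intro R.finsum_closed) (auto simp: act_closed subset_iff)
    show "(f \<otimes>\<^bsub>P\<^esub> h) x = \<zero>\<^bsub>R\<^esub>" if "x \<notin> ?X" for x
      unfolding eq
    proof (rule R.add.finprod_one_eqI)
      fix p assume "p \<in> ?A \<times> ?B"
      with that have "fst p \<otimes>\<^bsub>M\<^esub> snd p \<noteq> x"
        by blast
      then show "(if fst p \<otimes>\<^bsub>M\<^esub> snd p = x then f (fst p) \<otimes>\<^bsub>R\<^esub> \<alpha> (fst p) (h (snd p)) else \<zero>\<^bsub>R\<^esub>) = \<zero>\<^bsub>R\<^esub>"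
        by simp
    qed
  qed
qed

lemma skew_support_add:
  assumes "f \<in> carrier P" "h \<in> carrier P"
  shows "skew_support R (f \<oplus>\<^bsub>P\<^esub> h) \<subseteq> skew_support R f \<union> skew_support R h"
  using in_carrierD(1)[OF assms(1)] by (auto simp: skew_support_def add_eq)

lemma mult_add_left:
  assumes f: "f \<in> carrier P" and f': "f' \<in> carrier P" and h: "h \<in> carrier P"
  shows "(f \<oplus>\<^bsub>P\<^esub> f') \<otimes>\<^bsub>P\<^esub> h = f \<otimes>\<^bsub>P\<^esub> h \<oplus>\<^bsub>P\<^esub> f' \<otimes>\<^bsub>P\<^esub> h"
proof
  fix x
  let ?A = "skew_support R f \<union> skew_support R f'" and ?B = "skew_support R h"
  note fh = in_carrierD[OF f] in_carrierD[OF f'] in_carrierD[OF h]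
  have A: "finite ?A" "?A \<subseteq> carrier M"
    using fh by auto
  note m = mult_superset[OF _ h A(1) _ A(2) fh(8) order_refl fh(9)]
  show "((f \<oplus>\<^bsub>P\<^esub> f') \<otimes>\<^bsub>P\<^esub> h) x = (f \<otimes>\<^bsub>P\<^esub> h \<oplus>\<^bsub>P\<^esub> f' \<otimes>\<^bsub>P\<^esub> h) x"
    unfolding m[OF add_closed[OF f f'] skew_support_add[OF f f']] add_eq[of "f \<otimes>\<^bsub>P\<^esub> h"]
      m[OF f Un_upper1] m[OF f' Un_upper2]
  proof (subst R.finsum_addf[symmetric])
    show "(\<lambda>p. if fst p \<otimes>\<^bsub>M\<^esub> snd p = x then f (fst p) \<otimes>\<^bsub>R\<^esub> \<alpha> (fst p) (h (snd p)) else \<zero>\<^bsub>R\<^esub>)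
        \<in> ?A \<times> ?B \<rightarrow> carrier R"
      "(\<lambda>p. if fst p \<otimes>\<^bsub>M\<^esub> snd p = x then f' (fst p) \<otimes>\<^bsub>R\<^esub> \<alpha> (fst p) (h (snd p)) else \<zero>\<^bsub>R\<^esub>)
        \<in> ?A \<times> ?B \<rightarrow> carrier R"
      using fh A by (auto simp: act_closed subset_iff)
    then show "(\<Oplus>\<^bsub>R\<^esub>p\<in>?A \<times> ?B. if fst p \<otimes>\<^bsub>M\<^esub> snd p = x
          then (f \<oplus>\<^bsub>P\<^esub> f') (fst p) \<otimes>\<^bsub>R\<^esub> \<alpha> (fst p) (h (snd p)) else \<zero>\<^bsub>R\<^esub>) =
      (\<Oplus>\<^bsub>R\<^esub>p\<in>?A \<times> ?B. (if fst p \<otimes>\<^bsub>M\<^esub> snd p = x then f (fst p) \<otimes>\<^bsub>R\<^esub> \<alpha> (fst p) (h (snd p)) else \<zero>\<^bsub>R\<^esub>)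
        \<oplus>\<^bsub>R\<^esub> (if fst p \<otimes>\<^bsub>M\<^esub> snd p = x then f' (fst p) \<otimes>\<^bsub>R\<^esub> \<alpha> (fst p) (h (snd p)) else \<zero>\<^bsub>R\<^esub>))"
      using fh A by (intro R.finsum_cong') (auto simp: add_eq act_closed R.l_distr subset_iff)
  qed
qed

lemma mult_add_right:
  assumes h: "h \<in> carrier P" and f: "f \<in> carrier P" and f': "f' \<in> carrier P"
  shows "h \<otimes>\<^bsub>P\<^esub> (f \<oplus>\<^bsub>P\<^esub> f') = h \<otimes>\<^bsub>P\<^esub> f \<oplus>\<^bsub>P\<^esub> h \<otimes>\<^bsub>P\<^esub> f'"
proof
  fix x
  let ?A = "skew_support R f \<union> skew_support R f'" and ?B = "skew_support R h"
  note fh = in_carrierD[OF f] in_carrierD[OF f'] in_carrierD[OF h]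
  have A: "finite ?A" "?A \<subseteq> carrier M"
    using fh by auto
  note m = mult_superset[OF h _ fh(8) order_refl fh(9) A(1) _ A(2)]
  show "(h \<otimes>\<^bsub>P\<^esub> (f \<oplus>\<^bsub>P\<^esub> f')) x = (h \<otimes>\<^bsub>P\<^esub> f \<oplus>\<^bsub>P\<^esub> h \<otimes>\<^bsub>P\<^esub> f') x"
    unfolding m[OF add_closed[OF f f'] skew_support_add[OF f f']] add_eq[of "h \<otimes>\<^bsub>P\<^esub> f"]
      m[OF f Un_upper1] m[OF f' Un_upper2]
  proof (subst R.finsum_addf[symmetric])
    show "(\<lambda>p. if fst p \<otimes>\<^bsub>M\<^esub> snd p = x then h (fst p) \<otimes>\<^bsub>R\<^esub> \<alpha> (fst p) (f (snd p)) else \<zero>\<^bsub>R\<^esub>)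
        \<in> ?B \<times> ?A \<rightarrow> carrier R"
      "(\<lambda>p. if fst p \<otimes>\<^bsub>M\<^esub> snd p = x then h (fst p) \<otimes>\<^bsub>R\<^esub> \<alpha> (fst p) (f' (snd p)) else \<zero>\<^bsub>R\<^esub>)
        \<in> ?B \<times> ?A \<rightarrow> carrier R"
      using fh A by (auto simp: act_closed subset_iff)
    then show "(\<Oplus>\<^bsub>R\<^esub>p\<in>?B \<times> ?A. if fst p \<otimes>\<^bsub>M\<^esub> snd p = x
          then h (fst p) \<otimes>\<^bsub>R\<^esub> \<alpha> (fst p) ((f \<oplus>\<^bsub>P\<^esub> f') (snd p)) else \<zero>\<^bsub>R\<^esub>) =
      (\<Oplus>\<^bsub>R\<^esub>p\<in>?B \<times> ?A. (if fst p \<otimes>\<^bsub>M\<^esub> snd p = x then h (fst p) \<otimes>\<^bsub>R\<^esub> \<alpha> (fst p) (f (snd p)) else \<zero>\<^bsub>R\<^esub>)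
        \<oplus>\<^bsub>R\<^esub> (if fst p \<otimes>\<^bsub>M\<^esub> snd p = x then h (fst p) \<otimes>\<^bsub>R\<^esub> \<alpha> (fst p) (f' (snd p)) else \<zero>\<^bsub>R\<^esub>))"
      using fh A by (intro R.finsum_cong') (auto simp: add_eq act_closed act_add R.r_distr subset_iff)
  qed
qed

lemma mult_single:
  assumes "a \<in> carrier R" "g \<in> carrier M" "b \<in> carrier R" "h \<in> carrier M"
  shows "single R a g \<otimes>\<^bsub>P\<^esub> single R b h = single R (a \<otimes>\<^bsub>R\<^esub> \<alpha> g b) (g \<otimes>\<^bsub>M\<^esub> h)"
proof
  fix x
  have *: "a \<otimes>\<^bsub>R\<^esub> \<alpha> g b \<in> carrier R"
    using assms by (simp add: act_closed)
  have "(single R a g \<otimes>\<^bsub>P\<^esub> single R b h) x = finsum R (\<lambda>p. if fst p \<otimes>\<^bsub>M\<^esub> snd p = x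
      then single R a g (fst p) \<otimes>\<^bsub>R\<^esub> \<alpha> (fst p) (single R b h (snd p)) else \<zero>\<^bsub>R\<^esub>) ({g} \<times> {h})"
    using assms by (intro mult_superset skew_support_single single_closed) auto
  also have "\<dots> = single R (a \<otimes>\<^bsub>R\<^esub> \<alpha> g b) (g \<otimes>\<^bsub>M\<^esub> h) x"
    using * by (auto simp: single_def)
  finally show "(single R a g \<otimes>\<^bsub>P\<^esub> single R b h) x = single R (a \<otimes>\<^bsub>R\<^esub> \<alpha> g b) (g \<otimes>\<^bsub>M\<^esub> h) x" .
qed

lemma mult_assoc:
  assumes "f \<in> carrier P" "g \<in> carrier P" "h \<in> carrier P"
  shows "(f \<otimes>\<^bsub>P\<^esub> g) \<otimes>\<^bsub>P\<^esub> h = f \<otimes>\<^bsub>P\<^esub> (g \<otimes>\<^bsub>P\<^esub> h)"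
  using assms
proof (induction f rule: single_induct)
  case (single a x)
  note a = single(1,2)
  from single(3,4) show ?case
  proof (induction g rule: single_induct)
    case (single b y)
    note b = single(1,2)
    from single(3) show ?case
    proof (induction h rule: single_induct)
      case (single c z)
      show ?case
        using a b single
        by (simp add: mult_single act_closed act_times act_mult R.m_assoc M.m_assoc)
    qed (use a b in \<open>simp add: mult_add_right mult_closed\<close>)
  qed (use a in \<open>simp add: mult_add_right mult_add_left mult_closed\<close>)
qed (simp add: mult_add_left mult_closed)

theorem ring_twisted: "ring P"
proof (rule ringI)
  show "abelian_group P"
  proof (rule abelian_groupI)
    show "\<zero>\<^bsub>P\<^esub> \<in> carrier P"
      using zero_single[of "\<one>\<^bsub>M\<^esub>"] by simp
    show "\<exists>y\<in>carrier P. y \<oplus>\<^bsub>P\<^esub> f = \<zero>\<^bsub>P\<^esub>" if f: "f \<in> carrier P" for f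
    proof (rule bexI)
      show "(\<lambda>g. \<ominus>\<^bsub>R\<^esub> f g) \<oplus>\<^bsub>P\<^esub> f = \<zero>\<^bsub>P\<^esub>"
        using in_carrierD(1)[OF f] by (simp add: add_eq zero_eq R.l_neg)
      show "(\<lambda>g. \<ominus>\<^bsub>R\<^esub> f g) \<in> carrier P"
        using in_carrierD[OF f] by (intro carrierI[of _ "skew_support R f"]) (auto simp: skew_support_def)
    qed
    show "f \<oplus>\<^bsub>P\<^esub> h \<in> carrier P" if "f \<in> carrier P" "h \<in> carrier P" for f h
      using that by (rule add_closed)
  qed (use in_carrierD(1) in \<open>auto simp: add_eq zero_eq R.a_ac\<close>)
  show "Group.monoid P"
  proof (rule monoidI)
    show "\<one>\<^bsub>P\<^esub> \<in> carrier P"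
      by (simp add: one_eq single_closed)
    show "\<one>\<^bsub>P\<^esub> \<otimes>\<^bsub>P\<^esub> f = f" if "f \<in> carrier P" for f
      using that
    proof (induction f rule: single_induct)
      case (single a g)
      then show ?case
        by (simp add: one_eq mult_single act_one)
    qed (simp add: mult_add_right one_eq single_closed)
    show "f \<otimes>\<^bsub>P\<^esub> \<one>\<^bsub>P\<^esub> = f" if "f \<in> carrier P" for f
      using that
    proof (induction f rule: single_induct)
      case (single a g)
      then show ?case
        by (simp add: one_eq mult_single act_unit)
    qed (simp add: mult_add_left one_eq single_closed)
  qed (auto intro: mult_closed simp: mult_assoc)
qed (auto simp: mult_add_left mult_add_right)

end

text \<open>
  A module over the twisted ring is a module over the coefficients on which the monoid acts
  semilinearly.
\<close>
locale semilinear_module = twisted_monoid_ring R M \<alpha> P + V: abelian_group V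
  for R :: "('r, 'b) ring_scheme" and M :: "('g, 'c) monoid_scheme"
    and \<alpha> :: "'g \<Rightarrow> 'r \<Rightarrow> 'r" and P :: "('g \<Rightarrow> 'r, 'p) ring_scheme"
    and V :: "('g \<Rightarrow> 'r, 'v, 'd) module_scheme" +
  fixes sc :: "'r \<Rightarrow> 'v \<Rightarrow> 'v" and \<beta> :: "'g \<Rightarrow> 'v \<Rightarrow> 'v"
  assumes sc_closed [simp]: "\<lbrakk>a \<in> carrier R; v \<in> carrier V\<rbrakk> \<Longrightarrow> sc a v \<in> carrier V"
    and sc_add_left: "\<lbrakk>a \<in> carrier R; b \<in> carrier R; v \<in> carrier V\<rbrakk> \<Longrightarrow>
          sc (a \<oplus>\<^bsub>R\<^esub> b) v = sc a v \<oplus>\<^bsub>V\<^esub> sc b v"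
    and sc_add_right: "\<lbrakk>a \<in> carrier R; v \<in> carrier V; w \<in> carrier V\<rbrakk> \<Longrightarrow>
          sc a (v \<oplus>\<^bsub>V\<^esub> w) = sc a v \<oplus>\<^bsub>V\<^esub> sc a w"
    and sc_mult: "\<lbrakk>a \<in> carrier R; b \<in> carrier R; v \<in> carrier V\<rbrakk> \<Longrightarrow> sc (a \<otimes>\<^bsub>R\<^esub> b) v = sc a (sc b v)"
    and sc_one: "v \<in> carrier V \<Longrightarrow> sc \<one>\<^bsub>R\<^esub> v = v"
    and move_closed [simp]: "\<lbrakk>g \<in> carrier M; v \<in> carrier V\<rbrakk> \<Longrightarrow> \<beta> g v \<in> carrier V"
    and move_add: "\<lbrakk>g \<in> carrier M; v \<in> carrier V; w \<in> carrier V\<rbrakk> \<Longrightarrow>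
          \<beta> g (v \<oplus>\<^bsub>V\<^esub> w) = \<beta> g v \<oplus>\<^bsub>V\<^esub> \<beta> g w"
    and move_sc: "\<lbrakk>g \<in> carrier M; a \<in> carrier R; v \<in> carrier V\<rbrakk> \<Longrightarrow> \<beta> g (sc a v) = sc (\<alpha> g a) (\<beta> g v)"
    and move_mult: "\<lbrakk>g \<in> carrier M; g' \<in> carrier M; v \<in> carrier V\<rbrakk> \<Longrightarrow> \<beta> (g \<otimes>\<^bsub>M\<^esub> g') v = \<beta> g (\<beta> g' v)"
    and move_one: "v \<in> carrier V \<Longrightarrow> \<beta> \<one>\<^bsub>M\<^esub> v = v"
    and smult_eq: "\<lbrakk>f \<in> carrier P; v \<in> carrier V\<rbrakk> \<Longrightarrow>
          f \<odot>\<^bsub>V\<^esub> v = (\<Oplus>\<^bsub>V\<^esub>g\<in>skew_support R f. sc (f g) (\<beta> g v))"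
begin

lemma sc_zero [simp]: "v \<in> carrier V \<Longrightarrow> sc \<zero>\<^bsub>R\<^esub> v = \<zero>\<^bsub>V\<^esub>"
  by (metis R.zero_closed R.r_zero sc_add_left sc_closed V.add.l_cancel_one)

lemma smult_superset:
  assumes f: "f \<in> carrier P" and v: "v \<in> carrier V"
    and A: "finite A" "skew_support R f \<subseteq> A" "A \<subseteq> carrier M"
  shows "f \<odot>\<^bsub>V\<^esub> v = (\<Oplus>\<^bsub>V\<^esub>g\<in>A. sc (f g) (\<beta> g v))"
  unfolding smult_eq[OF f v]
  using A v in_carrierD(1)[OF f]
  by (intro V.add.finprod_mono_neutral_cong_left) (auto simp: skew_support_def subset_iff)

lemma smult_single:
  assumes "a \<in> carrier R" "g \<in> carrier M" "v \<in> carrier V"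
  shows "single R a g \<odot>\<^bsub>V\<^esub> v = sc a (\<beta> g v)"
proof -
  have "single R a g \<odot>\<^bsub>V\<^esub> v = (\<Oplus>\<^bsub>V\<^esub>x\<in>{g}. sc (single R a g x) (\<beta> x v))"
    using assms by (intro smult_superset skew_support_single) auto
  then show ?thesis
    using assms by simp
qed

lemma smult_closed':
  assumes "f \<in> carrier P" and "v \<in> carrier V"
  shows "f \<odot>\<^bsub>V\<^esub> v \<in> carrier V"
  unfolding smult_eq[OF assms] using assms in_carrierD[OF assms(1)]
  by (intro V.finsum_closed) auto

lemma smult_add_left:
  assumes f: "f \<in> carrier P" and h: "h \<in> carrier P" and v: "v \<in> carrier V"
  shows "(f \<oplus>\<^bsub>P\<^esub> h) \<odot>\<^bsub>V\<^esub> v = f \<odot>\<^bsub>V\<^esub> v \<oplus>\<^bsub>V\<^esub> h \<odot>\<^bsub>V\<^esub> v"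
proof -
  let ?A = "skew_support R f \<union> skew_support R h"
  note fh = in_carrierD[OF f] in_carrierD[OF h]
  have A: "finite ?A" "?A \<subseteq> carrier M"
    using fh by auto
  note m = smult_superset[OF _ v A(1) _ A(2)]
  have "(\<lambda>g. sc (f g) (\<beta> g v)) \<in> ?A \<rightarrow> carrier V" "(\<lambda>g. sc (h g) (\<beta> g v)) \<in> ?A \<rightarrow> carrier V"
    using fh A v by (auto simp: subset_iff)
  then have "(\<Oplus>\<^bsub>V\<^esub>g\<in>?A. sc (f g) (\<beta> g v)) \<oplus>\<^bsub>V\<^esub> (\<Oplus>\<^bsub>V\<^esub>g\<in>?A. sc (h g) (\<beta> g v))
      = (\<Oplus>\<^bsub>V\<^esub>g\<in>?A. sc (f g) (\<beta> g v) \<oplus>\<^bsub>V\<^esub> sc (h g) (\<beta> g v))"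
    by (simp add: V.finsum_addf)
  also have "\<dots> = (\<Oplus>\<^bsub>V\<^esub>g\<in>?A. sc ((f \<oplus>\<^bsub>P\<^esub> h) g) (\<beta> g v))"
    using fh A v by (intro V.finsum_cong') (auto simp: add_eq sc_add_left subset_iff)
  finally show ?thesis
    using m[OF add_closed[OF f h] skew_support_add[OF f h]] m[OF f Un_upper1] m[OF h Un_upper2]
    by simp
qed

lemma smult_add_right:
  assumes f: "f \<in> carrier P" and v: "v \<in> carrier V" and w: "w \<in> carrier V"
  shows "f \<odot>\<^bsub>V\<^esub> (v \<oplus>\<^bsub>V\<^esub> w) = f \<odot>\<^bsub>V\<^esub> v \<oplus>\<^bsub>V\<^esub> f \<odot>\<^bsub>V\<^esub> w"
  using f
proof (induction f rule: single_induct)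
  case (single a g)
  then show ?case
    using v w by (simp add: smult_single move_add sc_add_right)
next
  case (add f h)
  then show ?case
    using v w by (simp add: smult_add_left smult_closed' V.a_ac)
qed

lemma smult_mult:
  assumes "f \<in> carrier P" and "h \<in> carrier P" and v: "v \<in> carrier V"
  shows "(f \<otimes>\<^bsub>P\<^esub> h) \<odot>\<^bsub>V\<^esub> v = f \<odot>\<^bsub>V\<^esub> (h \<odot>\<^bsub>V\<^esub> v)"
  using assms(1,2)
proof (induction f rule: single_induct)
  case (single a g)
  note a = single(1,2)
  from single(3) show ?case
  proof (induction h rule: single_induct)
    case (single b y)
    then show ?case
      using a v by (simp add: mult_single smult_single act_closed sc_mult move_sc move_mult)
  qed (use a v in \<open>simp add: mult_add_right mult_closed smult_add_left smult_add_right smult_closed'\<close>)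
qed (use v in \<open>simp add: mult_add_left mult_closed smult_add_left smult_closed'\<close>)

theorem left_module_semilinear: "left_module P V"
proof (rule left_module.intro)
  show "left_module_axioms P V"
  proof
    show "\<one>\<^bsub>P\<^esub> \<odot>\<^bsub>V\<^esub> v = v" if "v \<in> carrier V" for v
      using that by (simp add: one_eq smult_single move_one sc_one)
  qed (auto simp: smult_closed' smult_add_left smult_add_right smult_mult)
qed (simp_all add: ring_twisted V.abelian_group_axioms)

end


section \<open>The polynomial ring\<close>

definition monomials :: "'s set \<Rightarrow> 's multiset monoid" where
  "monomials S = \<lparr>carrier = {m. set_mset m \<subseteq> S}, monoid.mult = (+), one = {#}\<rparr>"

lemma monoid_monomials: "Group.monoid (monomials S)"
  by (rule monoidI) (auto simp: monomials_def)

lemma finite_multiset_decompositions: "finite {(a, b). a + b = (m :: 's multiset)}"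
proof (induction m)
  case empty
  have "{(a, b). a + b = ({#} :: 's multiset)} = {({#}, {#})}"
    by auto
  then show ?case
    by simp
next
  case (add x m)
  let ?D = "{(a, b). a + b = m}"
  have "(a, b) \<in> (\<lambda>(a, b). (add_mset x a, b)) ` ?D \<union> (\<lambda>(a, b). (a, add_mset x b)) ` ?D"
    if ab: "a + b = add_mset x m" for a b
  proof (cases "x \<in># a")
    case True
    then obtain a' where "a = add_mset x a'"
      by (metis insert_DiffM)
    with ab show ?thesis
      by (auto simp: image_iff)
  next
    case False
    then have "x \<in># b"
      using ab by (metis union_iff union_single_eq_member)
    then obtain b' where "b = add_mset x b'"
      by (metis insert_DiffM)
    with ab show ?thesis
      by (auto simp: image_iff)
  qed
  then have "{(a, b). a + b = add_mset x m} \<subseteq>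
      (\<lambda>(a, b). (add_mset x a, b)) ` ?D \<union> (\<lambda>(a, b). (a, add_mset x b)) ` ?D"
    by blast
  then show ?case
    by (rule finite_subset) (use add in auto)
qed

text \<open>
  The inductive construction of polynomials from constants, sums and products with
  indeterminates reaches exactly the functions of finite support.
\<close>
lemma carrier_poly_ring:
  fixes S :: "'s set"
  assumes "ring k"
  shows "carrier (poly_ring k S) =
    {p. (\<forall>m. p m \<in> carrier k) \<and> finite (skew_support k p) \<and> skew_support k p \<subseteq> carrier (monomials S)}"
    (is "?L = ?R")
proof -
  interpret ring k by fact
  have c: "?L = indexed_pset S (carrier k)"
    by (simp add: poly_ring_def)
  show ?thesis
  proof
    have "p \<in> ?R" if "p \<in> indexed_pset S (carrier k)" for p :: "'s multiset \<Rightarrow> 'a"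
      using that
    proof induction
      case (indexed_const c)
      have "skew_support k (indexed_const c) \<subseteq> {{#}}"
        by (auto simp: skew_support_def indexed_const_def)
      with indexed_const show ?case
        by (auto simp: indexed_const_def monomials_def intro: finite_subset)
    next
      case (indexed_padd p q)
      have "skew_support k (indexed_padd p q) \<subseteq> skew_support k p \<union> skew_support k q"
        using indexed_padd by (auto simp: skew_support_def indexed_padd_def)
      moreover have "finite (skew_support k p \<union> skew_support k q)"
        using indexed_padd by simp
      ultimately have "finite (skew_support k (indexed_padd p q))"
        "skew_support k (indexed_padd p q) \<subseteq> skew_support k p \<union> skew_support k q"
        by (auto intro: finite_subset)
      then show ?case
        using indexed_padd by (auto simp: indexed_padd_def)
    next
      case (indexed_pmult p s)
      have "skew_support k (indexed_pmult p s) \<subseteq> add_mset s ` skew_support k p"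
      proof
        fix m assume m: "m \<in> skew_support k (indexed_pmult p s)"
        then have "s \<in># m" "p (m - {#s#}) \<noteq> \<zero>\<^bsub>k\<^esub>"
          by (auto simp: skew_support_def indexed_pmult_def split: if_splits)
        then show "m \<in> add_mset s ` skew_support k p"
          by (intro image_eqI[of _ _ "m - {#s#}"]) (auto simp: skew_support_def)
      qed
      moreover have "finite (add_mset s ` skew_support k p)"
        using indexed_pmult by simp
      ultimately have "finite (skew_support k (indexed_pmult p s))"
        "skew_support k (indexed_pmult p s) \<subseteq> add_mset s ` skew_support k p"
        by (auto intro: finite_subset)
      then show ?case
        using indexed_pmult by (fastforce simp: indexed_pmult_def monomials_def)
    qed
    then show "?L \<subseteq> ?R"
      using c by blast
    have single: "single k a m \<in> indexed_pset S (carrier k)" if "a \<in> carrier k" "set_mset m \<subseteq> S"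
      for a and m :: "'s multiset"
      using that(2)
    proof (induction m)
      case empty
      have "(single k a {#} :: 's multiset \<Rightarrow> 'a) = indexed_const a"
        by (auto simp: single_def indexed_const_def)
      then show ?case
        using that(1) by (simp add: indexed_pset.indexed_const)
    next
      case (add s m)
      have "single k a (add_mset s m) = indexed_pmult (single k a m) s"
        by (auto simp: single_def indexed_pmult_def fun_eq_iff)
      then show ?case
        using add by (auto intro: indexed_pset.indexed_pmult)
    qed
    have "p \<in> indexed_pset S (carrier k)"
      if "finite A" "A \<subseteq> carrier (monomials S)" "\<And>m. p m \<in> carrier k" "\<And>m. m \<notin> A \<Longrightarrow> p m = \<zero>\<^bsub>k\<^esub>"
      for A and p :: "'s multiset \<Rightarrow> 'a"
      using that
    proof (induction A arbitrary: p rule: finite_induct)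
      case empty
      then have "p = indexed_const \<zero>\<^bsub>k\<^esub>"
        by (auto simp: indexed_const_def)
      then show ?case
        by (auto intro: indexed_pset.indexed_const)
    next
      case (insert m A)
      have "p(m := \<zero>\<^bsub>k\<^esub>) \<in> indexed_pset S (carrier k)"
        using insert.prems by (intro insert.IH) auto
      moreover have "single k (p m) m \<in> indexed_pset S (carrier k)"
        using insert.prems by (intro single) (auto simp: monomials_def)
      moreover have "p = indexed_padd (single k (p m) m) (p(m := \<zero>\<^bsub>k\<^esub>))"
        using insert.prems by (auto simp: single_def indexed_padd_def)
      ultimately show ?case
        by (metis indexed_pset.indexed_padd)
    qed
    then have "p \<in> indexed_pset S (carrier k)" if "p \<in> ?R" for p
      using that by (auto simp: skew_support_def)
    then show "?R \<subseteq> ?L"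
      using c by blast
  qed
qed

lemma twisted_poly_ring:
  fixes S :: "'s set"
  assumes "ring k"
  shows "twisted_monoid_ring k (monomials S) (\<lambda>m a. a) (poly_ring k S)"
proof -
  interpret ring k by fact
  note carrier = carrier_poly_ring[OF assms, of S]
  show ?thesis
  proof (intro twisted_monoid_ring.intro twisted_monoid_ring_axioms.intro)
    fix p q :: "'s multiset \<Rightarrow> 'a" and m
    assume pq: "p \<in> carrier (poly_ring k S)" "q \<in> carrier (poly_ring k S)"
    have "(p \<otimes>\<^bsub>poly_ring k S\<^esub> q) m = finsum k (\<lambda>(a, b). p a \<otimes>\<^bsub>k\<^esub> q b) {(a, b). a + b = m}"
      by (simp add: poly_ring_def)
    also have "\<dots> = finsum k (\<lambda>(a, b). p a \<otimes>\<^bsub>k\<^esub> q b)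
        {(a, b). a \<in> skew_support k p \<and> b \<in> skew_support k q \<and> a \<otimes>\<^bsub>monomials S\<^esub> b = m}"
      using pq unfolding carrier
      by (intro add.finprod_mono_neutral_cong_right finite_multiset_decompositions)
        (auto simp: skew_support_def monomials_def)
    finally show "(p \<otimes>\<^bsub>poly_ring k S\<^esub> q) m = finsum k (\<lambda>(a, b). p a \<otimes>\<^bsub>k\<^esub> q b)
        {(a, b). a \<in> skew_support k p \<and> b \<in> skew_support k q \<and> a \<otimes>\<^bsub>monomials S\<^esub> b = m}" .
  next
    show "\<one>\<^bsub>poly_ring k S\<^esub> = single k \<one>\<^bsub>k\<^esub> \<one>\<^bsub>monomials S\<^esub>"
      by (auto simp: poly_ring_def single_def indexed_const_def monomials_def)
  next
    show "\<zero>\<^bsub>poly_ring k S\<^esub> = (\<lambda>m. \<zero>\<^bsub>k\<^esub>)"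
      by (auto simp: poly_ring_def indexed_const_def)
  next
    show "p \<oplus>\<^bsub>poly_ring k S\<^esub> q = (\<lambda>m. p m \<oplus>\<^bsub>k\<^esub> q m)" for p q
      by (auto simp: poly_ring_def indexed_padd_def)
  qed (auto simp: assms monoid_monomials carrier ring_hom_def)
qed


section \<open>Permutations of the indeterminates\<close>

locale polynomials = cring k for k :: "('a, 'b) ring_scheme" (structure) +
  fixes S :: "'s set"
begin

abbreviation KS where "KS \<equiv> poly_ring k S"

sublocale KS: twisted_monoid_ring k "monomials S" "\<lambda>m a. a" KS
  by (rule twisted_poly_ring) (rule ring_axioms)

sublocale KSr: ring KS
  by (rule KS.ring_twisted)

lemma image_mset_inv_into:
  assumes "\<pi> \<in> Bij S" and "set_mset m \<subseteq> S"
  shows "image_mset (inv_into S \<pi>) (image_mset \<pi> m) = m"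
    and "image_mset \<pi> (image_mset (inv_into S \<pi>) m) = m"
    and "set_mset (image_mset \<pi> m) \<subseteq> S"
    and "set_mset (image_mset (inv_into S \<pi>) m) \<subseteq> S"
proof -
  have \<pi>: "inj_on \<pi> S" "\<pi> ` S = S"
    using assms(1) by (auto simp: Bij_def bij_betw_def)
  have "image_mset (\<lambda>x. inv_into S \<pi> (\<pi> x)) m = image_mset (\<lambda>x. x) m"
    using \<pi> assms(2) by (intro image_mset_cong) auto
  then show "image_mset (inv_into S \<pi>) (image_mset \<pi> m) = m"
    by (simp add: multiset.map_comp comp_def)
  have "image_mset (\<lambda>x. \<pi> (inv_into S \<pi> x)) m = image_mset (\<lambda>x. x) m"
    using \<pi> assms(2) by (intro image_mset_cong) (auto simp: f_inv_into_f)
  then show "image_mset \<pi> (image_mset (inv_into S \<pi>) m) = m"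
    by (simp add: multiset.map_comp comp_def)
  show "set_mset (image_mset \<pi> m) \<subseteq> S"
    using \<pi> assms(2) by auto
  show "set_mset (image_mset (inv_into S \<pi>) m) \<subseteq> S"
    using inv_into_into[of _ \<pi> S] \<pi>(2) assms(2) by fastforce
qed

lemma image_mset_monomials:
  "\<lbrakk>\<pi> \<in> Bij S; m \<in> carrier (monomials S)\<rbrakk> \<Longrightarrow> image_mset \<pi> m \<in> carrier (monomials S)"
  using image_mset_inv_into(3) by (auto simp: monomials_def)

lemma poly_act_closed:
  assumes \<pi>: "\<pi> \<in> Bij S" and p: "p \<in> carrier KS"
  shows "poly_act k S \<pi> p \<in> carrier KS"
proof (rule KS.carrierI)
  note p' = KS.in_carrierD[OF p]
  show "poly_act k S \<pi> p m \<in> carrier k" for m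
    using p' by (simp add: poly_act_def)
  show "finite (image_mset \<pi> ` skew_support k p)"
    using p' by simp
  show "image_mset \<pi> ` skew_support k p \<subseteq> carrier (monomials S)"
    using p'(3) by (auto intro!: image_mset_monomials[OF \<pi>])
  show "poly_act k S \<pi> p m = \<zero>" if "m \<notin> image_mset \<pi> ` skew_support k p" for m
  proof (rule ccontr)
    assume "poly_act k S \<pi> p m \<noteq> \<zero>"
    then have "set_mset m \<subseteq> S" "image_mset (inv_into S \<pi>) m \<in> skew_support k p"
      by (auto simp: poly_act_def skew_support_def split: if_splits)
    then have "m \<in> image_mset \<pi> ` skew_support k p"
      using image_mset_inv_into(2)[OF \<pi>] by (metis image_eqI)
    with that show False
      by simp
  qed
qed

lemma poly_act_add:
  "poly_act k S \<pi> (p \<oplus>\<^bsub>KS\<^esub> q) = poly_act k S \<pi> p \<oplus>\<^bsub>KS\<^esub> poly_act k S \<pi> q"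
  by (auto simp: poly_act_def KS.add_eq)

lemma poly_act_single:
  assumes \<pi>: "\<pi> \<in> Bij S" and m: "m \<in> carrier (monomials S)"
  shows "poly_act k S \<pi> (single k a m) = single k a (image_mset \<pi> m)"
proof
  fix m'
  have "image_mset (inv_into S \<pi>) m' = m \<longleftrightarrow> m' = image_mset \<pi> m" if "set_mset m' \<subseteq> S"
    using that m image_mset_inv_into[OF \<pi>] by (auto simp: monomials_def)
  then show "poly_act k S \<pi> (single k a m) m' = single k a (image_mset \<pi> m) m'"
    using m image_mset_inv_into(3)[OF \<pi>, of m] by (auto simp: poly_act_def single_def monomials_def)
qed

lemma poly_act_mult:
  assumes \<pi>: "\<pi> \<in> Bij S" and p: "p \<in> carrier KS" and q: "q \<in> carrier KS"
  shows "poly_act k S \<pi> (p \<otimes>\<^bsub>KS\<^esub> q) = poly_act k S \<pi> p \<otimes>\<^bsub>KS\<^esub> poly_act k S \<pi> q"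
  using p q
proof (induction p rule: KS.single_induct)
  case (single a m)
  note a = single(1,2)
  from single(3) show ?case
  proof (induction q rule: KS.single_induct)
    case (single b n)
    have "m + n \<in> carrier (monomials S)"
      using a single by (auto simp: monomials_def)
    then show ?case
      using a single \<pi>
      by (simp add: KS.mult_single poly_act_single image_mset_monomials) (simp add: monomials_def poly_act_single \<pi>)
  qed (use a \<pi> in \<open>simp add: KS.mult_add_right poly_act_add poly_act_closed\<close>)
qed (use \<pi> in \<open>simp add: KS.mult_add_left poly_act_add poly_act_closed\<close>)

lemma poly_act_one: "\<pi> \<in> Bij S \<Longrightarrow> poly_act k S \<pi> \<one>\<^bsub>KS\<^esub> = \<one>\<^bsub>KS\<^esub>"
  by (simp add: KS.one_eq poly_act_single monomials_def)

lemma poly_act_comp: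
  assumes \<pi>: "\<pi> \<in> Bij S" and \<tau>: "\<tau> \<in> Bij S" and p: "p \<in> carrier KS"
  shows "poly_act k S (compose S \<pi> \<tau>) p = poly_act k S \<pi> (poly_act k S \<tau> p)"
  using p
proof (induction p rule: KS.single_induct)
  case (single a m)
  have "image_mset (compose S \<pi> \<tau>) m = image_mset \<pi> (image_mset \<tau> m)"
    using single by (auto simp: multiset.map_comp monomials_def compose_def intro!: image_mset_cong)
  then show ?case
    using single \<pi> \<tau> by (simp add: poly_act_single compose_Bij image_mset_monomials)
qed (simp add: poly_act_add)

text \<open>A polynomial involves finitely many indeterminates, and only their images matter.\<close>
lemma poly_act_finite_support:
  assumes p: "p \<in> carrier KS"
  shows "\<exists>U. finite U \<and> U \<subseteq> S \<and> (\<forall>\<pi>\<in>Bij S. \<forall>\<tau>\<in>Bij S. (\<forall>u\<in>U. \<pi> u = \<tau> u) \<longrightarrow>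
           poly_act k S \<pi> p = poly_act k S \<tau> p)"
  using p
proof (induction p rule: KS.single_induct)
  case (single a m)
  have "poly_act k S \<pi> (single k a m) = poly_act k S \<tau> (single k a m)"
    if "\<pi> \<in> Bij S" "\<tau> \<in> Bij S" "\<forall>u\<in>set_mset m. \<pi> u = \<tau> u" for \<pi> \<tau>
  proof -
    have "image_mset \<pi> m = image_mset \<tau> m"
      using that by (intro image_mset_cong) auto
    then show ?thesis
      using that single by (simp add: poly_act_single)
  qed
  moreover have "set_mset m \<subseteq> S"
    using single by (simp add: monomials_def)
  ultimately show ?case
    by (intro exI[of _ "set_mset m"]) blast
next
  case (add p q)
  from add(3) obtain U where U: "finite U" "U \<subseteq> S" "\<And>\<pi> \<tau>. \<lbrakk>\<pi> \<in> Bij S; \<tau> \<in> Bij S; \<forall>u\<in>U. \<pi> u = \<tau> u\<rbrakk> \<Longrightarrow>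
      poly_act k S \<pi> p = poly_act k S \<tau> p"
    by blast
  from add(4) obtain U' where U': "finite U'" "U' \<subseteq> S" "\<And>\<pi> \<tau>. \<lbrakk>\<pi> \<in> Bij S; \<tau> \<in> Bij S; \<forall>u\<in>U'. \<pi> u = \<tau> u\<rbrakk> \<Longrightarrow>
      poly_act k S \<pi> q = poly_act k S \<tau> q"
    by blast
  show ?case
  proof (intro exI[of _ "U \<union> U'"] conjI ballI impI)
    fix \<pi> \<tau> assume "\<pi> \<in> Bij S" "\<tau> \<in> Bij S" "\<forall>u\<in>U \<union> U'. \<pi> u = \<tau> u"
    then show "poly_act k S \<pi> (p \<oplus>\<^bsub>KS\<^esub> q) = poly_act k S \<tau> (p \<oplus>\<^bsub>KS\<^esub> q)"
      using U(3)[of \<pi> \<tau>] U'(3)[of \<pi> \<tau>] by (simp add: poly_act_add)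
  qed (use U U' in auto)
qed

end


section \<open>The skew group ring\<close>

locale poly_action = polynomials k S + G: group G
  for k :: "('a, 'b) ring_scheme" (structure) and S :: "'s set"
    and G :: "('g, 'c) monoid_scheme" +
  fixes \<rho> :: "'g \<Rightarrow> 's \<Rightarrow> 's"
  assumes rho_hom: "\<rho> \<in> hom G (BijGroup S)"
begin

abbreviation KSG where "KSG \<equiv> skew_group_ring k S G \<rho>"

abbreviation act where "act g \<equiv> poly_act k S (\<rho> g)"

lemma rho_Bij: "g \<in> carrier G \<Longrightarrow> \<rho> g \<in> Bij S"
  using rho_hom by (auto simp: hom_def BijGroup_def)

lemma rho_mult: "\<lbrakk>g \<in> carrier G; h \<in> carrier G\<rbrakk> \<Longrightarrow> \<rho> (g \<otimes>\<^bsub>G\<^esub> h) = compose S (\<rho> g) (\<rho> h)"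
  using rho_hom rho_Bij by (auto simp: hom_def BijGroup_def)

lemma rho_mult_app:
  "\<lbrakk>g \<in> carrier G; h \<in> carrier G; s \<in> S\<rbrakk> \<Longrightarrow> \<rho> (g \<otimes>\<^bsub>G\<^esub> h) s = \<rho> g (\<rho> h s)"
  by (simp add: rho_mult compose_def)

lemma rho_closed: "\<lbrakk>g \<in> carrier G; s \<in> S\<rbrakk> \<Longrightarrow> \<rho> g s \<in> S"
  using rho_Bij by (auto simp: Bij_def bij_betw_def)

lemma rho_one: "\<rho> \<one>\<^bsub>G\<^esub> = (\<lambda>x\<in>S. x)"
proof -
  interpret group_hom G "BijGroup S" \<rho>
    by (intro group_hom.intro group_hom_axioms.intro group_BijGroup rho_hom G.group_axioms)
  show ?thesis
    using hom_one by (simp add: BijGroup_def)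
qed

lemma rho_one_app: "s \<in> S \<Longrightarrow> \<rho> \<one>\<^bsub>G\<^esub> s = s"
  by (simp add: rho_one)

lemma rho_inv_app: "\<lbrakk>g \<in> carrier G; s \<in> S\<rbrakk> \<Longrightarrow> \<rho> (inv\<^bsub>G\<^esub> g) (\<rho> g s) = s"
  by (metis G.inv_closed G.l_inv rho_mult_app rho_one_app)

lemma act_one': "p \<in> carrier KS \<Longrightarrow> act \<one>\<^bsub>G\<^esub> p = p"
proof (induction p rule: KS.single_induct)
  case (single a m)
  have "image_mset (\<rho> \<one>\<^bsub>G\<^esub>) m = image_mset (\<lambda>x. x) m"
    using single by (intro image_mset_cong) (auto simp: monomials_def rho_one_app)
  then show ?case
    using single by (simp add: poly_act_single rho_Bij)
qed (simp add: poly_act_add)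

sublocale KSG: twisted_monoid_ring KS G act KSG
proof (intro twisted_monoid_ring.intro twisted_monoid_ring_axioms.intro)
  show "act g \<in> ring_hom KS KS" if "g \<in> carrier G" for g
    using that by (auto simp: ring_hom_def poly_act_closed poly_act_mult poly_act_add poly_act_one rho_Bij)
  show "act (g \<otimes>\<^bsub>G\<^esub> g') a = act g (act g' a)"
    if "g \<in> carrier G" "g' \<in> carrier G" "a \<in> carrier KS" for g g' a
    using that by (simp add: rho_mult poly_act_comp rho_Bij)
qed (auto simp: act_one' KSr.ring_axioms skew_group_ring_def Let_def single_def)

sublocale KSGr: ring KSG
  by (rule KSG.ring_twisted)

lemma skew_elem_eq: "skew_elem k S g = single KS \<one>\<^bsub>KS\<^esub> g"
  by (simp add: skew_elem_def single_def)

lemma poly_module_simps: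
  "carrier (poly_module k S \<rho>) = carrier KS"
  "p \<oplus>\<^bsub>poly_module k S \<rho>\<^esub> q = p \<oplus>\<^bsub>KS\<^esub> q"
  "\<zero>\<^bsub>poly_module k S \<rho>\<^esub> = \<zero>\<^bsub>KS\<^esub>"
  "finsum (poly_module k S \<rho>) F A = finsum KS F A"
  "f \<odot>\<^bsub>poly_module k S \<rho>\<^esub> p = (\<Oplus>\<^bsub>KS\<^esub>g\<in>skew_support KS f. f g \<otimes>\<^bsub>KS\<^esub> act g p)"
  by (simp_all add: poly_module_def Let_def finsum_def finprod_def)

lemma semilinear_poly_module:
  "semilinear_module KS G act KSG (poly_module k S \<rho>) (\<lambda>a p. a \<otimes>\<^bsub>KS\<^esub> p) act"
proof (intro semilinear_module.intro semilinear_module_axioms.intro)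
  show "twisted_monoid_ring KS G act KSG"
    by (rule KSG.twisted_monoid_ring_axioms)
  show "abelian_group (poly_module k S \<rho>)"
  proof (rule abelian_groupI)
    show "\<exists>q\<in>carrier (poly_module k S \<rho>). q \<oplus>\<^bsub>poly_module k S \<rho>\<^esub> p = \<zero>\<^bsub>poly_module k S \<rho>\<^esub>"
      if "p \<in> carrier (poly_module k S \<rho>)" for p
      using that KSr.l_neg[of p] KSr.a_inv_closed[of p] unfolding poly_module_simps by blast
  qed (simp_all add: poly_module_simps KSr.a_ac)
qed (simp_all add: poly_module_simps KSr.l_distr KSr.r_distr KSr.m_assoc
    KSG.act_closed KSG.act_add KSG.act_times KSG.act_mult KSG.act_one)

end


section \<open>Modules over the skew group ring\<close>

text \<open>
  The action of \<open>G\<close> and that of \<open>k[S]\<close>, both recovered from the action of \<open>k[S]G\<close>.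
\<close>
definition group_move ::
    "('a, 'b) ring_scheme \<Rightarrow> 's set \<Rightarrow> ('g \<Rightarrow> 's multiset \<Rightarrow> 'a, 'v) module \<Rightarrow> 'g \<Rightarrow> 'v \<Rightarrow> 'v" where
  "group_move k S V g v = skew_elem k S g \<odot>\<^bsub>V\<^esub> v"

definition poly_scale ::
    "('a, 'b) ring_scheme \<Rightarrow> 's set \<Rightarrow> ('g, 'c) monoid_scheme \<Rightarrow> ('g \<Rightarrow> 's multiset \<Rightarrow> 'a, 'v) module
      \<Rightarrow> ('s multiset \<Rightarrow> 'a) \<Rightarrow> 'v \<Rightarrow> 'v" where
  "poly_scale k S G V a v = single (poly_ring k S) a \<one>\<^bsub>G\<^esub> \<odot>\<^bsub>V\<^esub> v"

definition supports ::
    "('a, 'b) ring_scheme \<Rightarrow> 's set \<Rightarrow> ('g, 'c) monoid_scheme \<Rightarrow> ('g \<Rightarrow> 's \<Rightarrow> 's)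
      \<Rightarrow> ('g \<Rightarrow> 's multiset \<Rightarrow> 'a, 'v) module \<Rightarrow> 's set \<Rightarrow> 'v \<Rightarrow> bool" where
  "supports k S G \<rho> V T v \<longleftrightarrow> finite T \<and> T \<subseteq> S \<and>
     (\<forall>g\<in>carrier G. (\<forall>t\<in>T. \<rho> g t = t) \<longrightarrow> group_move k S V g v = v)"

locale poly_action_module = poly_action k S G \<rho> + V: left_module "skew_group_ring k S G \<rho>" V
  for k :: "('a, 'b) ring_scheme" (structure) and S :: "'s set"
    and G :: "('g, 'c) monoid_scheme" and \<rho> :: "'g \<Rightarrow> 's \<Rightarrow> 's"
    and V :: "('g \<Rightarrow> 's multiset \<Rightarrow> 'a, 'v) module"
begin

abbreviation mv where "mv \<equiv> group_move k S V"
abbreviation sc where "sc \<equiv> poly_scale k S G V"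
abbreviation supp where "supp \<equiv> supports k S G \<rho> V"

lemma mv_eq: "mv g v = single KS \<one>\<^bsub>KS\<^esub> g \<odot>\<^bsub>V\<^esub> v"
  by (simp add: group_move_def skew_elem_eq)

lemma mv_closed [simp]: "\<lbrakk>g \<in> carrier G; v \<in> carrier V\<rbrakk> \<Longrightarrow> mv g v \<in> carrier V"
  by (simp add: mv_eq KSG.single_closed)

lemma sc_closed [simp]: "\<lbrakk>a \<in> carrier KS; v \<in> carrier V\<rbrakk> \<Longrightarrow> sc a v \<in> carrier V"
  by (simp add: poly_scale_def KSG.single_closed)

lemma mv_add:
  "\<lbrakk>g \<in> carrier G; v \<in> carrier V; w \<in> carrier V\<rbrakk> \<Longrightarrow> mv g (v \<oplus>\<^bsub>V\<^esub> w) = mv g v \<oplus>\<^bsub>V\<^esub> mv g w"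
  by (simp add: mv_eq KSG.single_closed V.smult_r_distr)

lemma sc_add_right:
  "\<lbrakk>a \<in> carrier KS; v \<in> carrier V; w \<in> carrier V\<rbrakk> \<Longrightarrow> sc a (v \<oplus>\<^bsub>V\<^esub> w) = sc a v \<oplus>\<^bsub>V\<^esub> sc a w"
  by (simp add: poly_scale_def KSG.single_closed V.smult_r_distr)

lemma sc_add_left:
  "\<lbrakk>a \<in> carrier KS; b \<in> carrier KS; v \<in> carrier V\<rbrakk> \<Longrightarrow> sc (a \<oplus>\<^bsub>KS\<^esub> b) v = sc a v \<oplus>\<^bsub>V\<^esub> sc b v"
  by (simp add: poly_scale_def KSG.single_closed V.smult_l_distr KSG.single_add)

lemma smult_single:
  assumes "a \<in> carrier KS" "g \<in> carrier G" "v \<in> carrier V"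
  shows "single KS a g \<odot>\<^bsub>V\<^esub> v = sc a (mv g v)"
  using assms
  by (simp add: mv_eq poly_scale_def KSG.single_closed V.smult_assoc[symmetric] KSG.mult_single KSG.act_unit
    KSG.act_one)

lemma sc_mult:
  "\<lbrakk>a \<in> carrier KS; b \<in> carrier KS; v \<in> carrier V\<rbrakk> \<Longrightarrow> sc (a \<otimes>\<^bsub>KS\<^esub> b) v = sc a (sc b v)"
  by (simp add: poly_scale_def KSG.single_closed V.smult_assoc[symmetric] KSG.mult_single KSG.act_one)

lemma mv_mult:
  "\<lbrakk>g \<in> carrier G; h \<in> carrier G; v \<in> carrier V\<rbrakk> \<Longrightarrow> mv (g \<otimes>\<^bsub>G\<^esub> h) v = mv g (mv h v)"
  by (simp add: mv_eq KSG.single_closed V.smult_assoc[symmetric] KSG.mult_single KSG.act_unit)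

lemma mv_one: "v \<in> carrier V \<Longrightarrow> mv \<one>\<^bsub>G\<^esub> v = v"
  by (simp add: mv_eq KSG.one_eq[symmetric])

lemma sc_one: "v \<in> carrier V \<Longrightarrow> sc \<one>\<^bsub>KS\<^esub> v = v"
  by (simp add: poly_scale_def KSG.one_eq[symmetric])

lemma mv_sc:
  assumes "g \<in> carrier G" "a \<in> carrier KS" "v \<in> carrier V"
  shows "mv g (sc a v) = sc (act g a) (mv g v)"
proof -
  have "mv g (sc a v) = single KS (act g a) g \<odot>\<^bsub>V\<^esub> v"
    using assms by (simp add: mv_eq poly_scale_def KSG.single_closed V.smult_assoc[symmetric]
        KSG.mult_single KSG.act_closed)
  then show ?thesis
    using assms by (simp add: smult_single KSG.act_closed)
qed

lemma mv_inv: "\<lbrakk>g \<in> carrier G; v \<in> carrier V\<rbrakk> \<Longrightarrow> mv (inv\<^bsub>G\<^esub> g) (mv g v) = v"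
  by (simp add: mv_mult[symmetric] mv_one)

text \<open>
  Group elements that agree on a support differ by an element of its pointwise stabilizer.
\<close>
lemma supp_agree:
  assumes T: "supp T v" and v: "v \<in> carrier V" and g: "g \<in> carrier G" and h: "h \<in> carrier G"
    and eq: "\<And>t. t \<in> T \<Longrightarrow> \<rho> g t = \<rho> h t"
  shows "mv g v = mv h v"
proof -
  have "\<rho> (inv\<^bsub>G\<^esub> h \<otimes>\<^bsub>G\<^esub> g) t = t" if "t \<in> T" for t
    using that T g h eq by (auto simp: supports_def rho_mult_app rho_inv_app subset_iff)
  then have "mv (inv\<^bsub>G\<^esub> h \<otimes>\<^bsub>G\<^esub> g) v = v"
    using T g h by (simp add: supports_def)
  then have "mv h (mv (inv\<^bsub>G\<^esub> h \<otimes>\<^bsub>G\<^esub> g) v) = mv h v"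
    by simp
  then show ?thesis
    using g h v by (simp add: mv_mult[symmetric] G.m_assoc[symmetric])
qed

lemma supp_mv:
  assumes T: "supp T v" and v: "v \<in> carrier V" and g: "g \<in> carrier G"
  shows "supp (\<rho> g ` T) (mv g v)"
  unfolding supports_def
proof (intro conjI ballI impI)
  show "finite (\<rho> g ` T)" "\<rho> g ` T \<subseteq> S"
    using T g by (auto simp: supports_def rho_closed subset_iff)
  fix h assume h: "h \<in> carrier G" "\<forall>t\<in>\<rho> g ` T. \<rho> h t = t"
  have "mv (h \<otimes>\<^bsub>G\<^esub> g) v = mv g v"
    using T h g by (intro supp_agree[OF T v]) (auto simp: supports_def rho_mult_app subset_iff)
  then show "mv h (mv g v) = mv g v"
    using h g v by (simp add: mv_mult)
qed

lemma supp_mono: "\<lbrakk>supp T v; T \<subseteq> T'; finite T'; T' \<subseteq> S\<rbrakk> \<Longrightarrow> supp T' v"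
  unfolding supports_def by blast

lemma supp_add:
  "\<lbrakk>supp T v; supp T w; v \<in> carrier V; w \<in> carrier V\<rbrakk> \<Longrightarrow> supp T (v \<oplus>\<^bsub>V\<^esub> w)"
  by (simp add: supports_def mv_add)

text \<open>
  A stabilizer is a subgroup, so that it is open as soon as it is a neighbourhood of the identity.
\<close>
lemma discrete_iff:
  "openin (action_topology G S \<rho>) (stabilizer G (\<lambda>g v. skew_elem k S g \<odot>\<^bsub>V\<^esub> v) v)
     \<longleftrightarrow> (\<exists>T. supp T v)" if v: "v \<in> carrier V"
proof -
  let ?St = "{g \<in> carrier G. mv g v = v}"
  have st: "stabilizer G (\<lambda>g v. skew_elem k S g \<odot>\<^bsub>V\<^esub> v) v = ?St"
    by (auto simp: stabilizer_def group_move_def)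
  have pw: "pointwise_stabilizer G \<rho> T = {g \<in> carrier G. \<forall>t\<in>T. \<rho> g t = t}" for T
    by (auto simp: pointwise_stabilizer_def stabilizer_def)
  show ?thesis
    unfolding st openin_action_topology
  proof (intro iffI conjI ballI)
    assume "?St \<subseteq> carrier G \<and>
      (\<forall>g\<in>?St. \<exists>T. finite T \<and> T \<subseteq> S \<and> g <#\<^bsub>G\<^esub> pointwise_stabilizer G \<rho> T \<subseteq> ?St)"
    moreover have "\<one>\<^bsub>G\<^esub> \<in> ?St"
      using v by (simp add: mv_one)
    ultimately obtain T where T: "finite T" "T \<subseteq> S" "\<one>\<^bsub>G\<^esub> <#\<^bsub>G\<^esub> pointwise_stabilizer G \<rho> T \<subseteq> ?St"
      by blast
    have "mv g v = v" if "g \<in> carrier G" "\<forall>t\<in>T. \<rho> g t = t" for g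
    proof -
      have "\<one>\<^bsub>G\<^esub> \<otimes>\<^bsub>G\<^esub> g \<in> \<one>\<^bsub>G\<^esub> <#\<^bsub>G\<^esub> pointwise_stabilizer G \<rho> T"
        using that unfolding pw l_coset_def by blast
      then show ?thesis
        using T(3) that by auto
    qed
    with T show "\<exists>T. supp T v"
      unfolding supports_def by blast
  next
    fix g assume T: "\<exists>T. supp T v" and g: "g \<in> ?St"
    from T obtain T where T: "supp T v"
      by blast
    have "g <#\<^bsub>G\<^esub> pointwise_stabilizer G \<rho> T \<subseteq> ?St"
    proof
      fix x assume "x \<in> g <#\<^bsub>G\<^esub> pointwise_stabilizer G \<rho> T"
      then obtain h where h: "h \<in> carrier G" "\<forall>t\<in>T. \<rho> h t = t" "x = g \<otimes>\<^bsub>G\<^esub> h"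
        unfolding pw l_coset_def by blast
      then have "mv h v = v"
        using T by (simp add: supports_def)
      then show "x \<in> ?St"
        using h g v by (simp add: mv_mult)
    qed
    with T show "\<exists>T. finite T \<and> T \<subseteq> S \<and> g <#\<^bsub>G\<^esub> pointwise_stabilizer G \<rho> T \<subseteq> ?St"
      unfolding supports_def by blast
  qed auto
qed

lemma smult_finite_support:
  assumes a: "a \<in> carrier KS" and v: "v \<in> carrier V" and T: "supp T v"
  shows "\<exists>U. finite U \<and> U \<subseteq> S \<and> supp (T \<union> U) (sc a v) \<and> (\<forall>\<pi>\<in>Bij S. \<forall>\<tau>\<in>Bij S. (\<forall>u\<in>U. \<pi> u = \<tau> u) \<longrightarrow>
           poly_act k S \<pi> a = poly_act k S \<tau> a)"
proof -
  obtain U where U: "finite U" "U \<subseteq> S" and eq: "\<And>\<pi> \<tau>. \<lbrakk>\<pi> \<in> Bij S; \<tau> \<in> Bij S; \<forall>u\<in>U. \<pi> u = \<tau> u\<rbrakk> \<Longrightarrow>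
      poly_act k S \<pi> a = poly_act k S \<tau> a"
    using poly_act_finite_support[OF a] by blast
  have TS: "finite (T \<union> U)" "T \<union> U \<subseteq> S"
    using T U by (auto simp: supports_def)
  have "mv g (sc a v) = sc a v" if g: "g \<in> carrier G" "\<forall>t\<in>T \<union> U. \<rho> g t = t" for g
  proof -
    have "\<forall>u\<in>U. \<rho> g u = \<rho> \<one>\<^bsub>G\<^esub> u"
      using g U by (auto simp: rho_one_app subset_iff)
    then have "act g a = a"
      using eq[of "\<rho> g" "\<rho> \<one>\<^bsub>G\<^esub>"] g a by (simp add: rho_Bij act_one')
    moreover have "mv g v = v"
      using g T by (simp add: supports_def)
    ultimately show ?thesis
      using g a v by (simp add: mv_sc)
  qed
  with TS have "supp (T \<union> U) (sc a v)"
    by (auto simp: supports_def)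
  with U eq show ?thesis
    by blast
qed

end

locale discrete_poly_module = poly_action_module +
  assumes finite_support: "v \<in> carrier V \<Longrightarrow> \<exists>T. supports k S G \<rho> V T v"

lemma (in poly_action) discrete_module_iff:
  "discrete_module k S G \<rho> V \<longleftrightarrow> discrete_poly_module k S G \<rho> V"
proof -
  have "discrete_module k S G \<rho> V \<longleftrightarrow> (\<forall>v\<in>carrier V. \<exists>T. supports k S G \<rho> V T v)"
    if "poly_action_module k S G \<rho> V"
  proof -
    interpret poly_action_module k S G \<rho> V by fact
    show ?thesis
      by (simp add: discrete_module_def V.left_module_axioms discrete_iff)
  qed
  moreover have "poly_action_module k S G \<rho> V \<longleftrightarrow> left_module KSG V"
    by (simp add: poly_action_module_def poly_action_axioms)
  ultimately show ?thesis
    unfolding discrete_poly_module_def discrete_poly_module_axioms_def discrete_module_def by blast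
qed


section \<open>Transfer of discrete modules between groups with the same closure\<close>

text \<open>
  The choice of \<open>g\<close> and of the support \<open>T\<close> does not matter, by \<open>transferred_move_eq\<close> below.
\<close>
definition transferred_move ::
    "('a, 'b) ring_scheme \<Rightarrow> 's set \<Rightarrow> ('g, 'c) monoid_scheme \<Rightarrow> ('g \<Rightarrow> 's \<Rightarrow> 's) \<Rightarrow> ('h \<Rightarrow> 's \<Rightarrow> 's)
      \<Rightarrow> ('g \<Rightarrow> 's multiset \<Rightarrow> 'a, 'v) module \<Rightarrow> 'h \<Rightarrow> 'v \<Rightarrow> 'v" where
  "transferred_move k S G \<rho> \<tau> V h v = group_move k S V
     (SOME g. g \<in> carrier G \<and> (\<exists>T. supports k S G \<rho> V T v \<and> (\<forall>t\<in>T. \<rho> g t = \<tau> h t))) v"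

definition transfer_module ::
    "('a, 'b) ring_scheme \<Rightarrow> 's set \<Rightarrow> ('g, 'c) monoid_scheme \<Rightarrow> ('g \<Rightarrow> 's \<Rightarrow> 's) \<Rightarrow> ('h \<Rightarrow> 's \<Rightarrow> 's)
      \<Rightarrow> ('g \<Rightarrow> 's multiset \<Rightarrow> 'a, 'v) module \<Rightarrow> ('h \<Rightarrow> 's multiset \<Rightarrow> 'a, 'v) module" where
  "transfer_module k S G \<rho> \<tau> V =
     \<lparr>carrier = carrier V, monoid.mult = monoid.mult V, one = \<one>\<^bsub>V\<^esub>,
      ring.zero = \<zero>\<^bsub>V\<^esub>, ring.add = ring.add V,
      smult = (\<lambda>f v. \<Oplus>\<^bsub>V\<^esub>h \<in> skew_support (poly_ring k S) f.
                 poly_scale k S G V (f h) (transferred_move k S G \<rho> \<tau> V h v))\<rparr>"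

lemma transfer_module_simps:
  "carrier (transfer_module k S G \<rho> \<tau> V) = carrier V"
  "v \<oplus>\<^bsub>transfer_module k S G \<rho> \<tau> V\<^esub> w = v \<oplus>\<^bsub>V\<^esub> w"
  "\<zero>\<^bsub>transfer_module k S G \<rho> \<tau> V\<^esub> = \<zero>\<^bsub>V\<^esub>"
  "finsum (transfer_module k S G \<rho> \<tau> V) F A = finsum V F A"
  "f \<odot>\<^bsub>transfer_module k S G \<rho> \<tau> V\<^esub> v = (\<Oplus>\<^bsub>V\<^esub>h \<in> skew_support (poly_ring k S) f.
                 poly_scale k S G V (f h) (transferred_move k S G \<rho> \<tau> V h v))"
  by (simp_all add: transfer_module_def finsum_def finprod_def)

text \<open>
  Every element of the second group agrees with some element of the first on any given finite
  set. An element of a discrete module only feels the action on a finite support, so the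
  second group acts as well. The condition for the converse direction is the same with the
  two groups exchanged.
\<close>
locale dense_actions = A: poly_action k S G \<rho> + B: poly_action k S H \<tau>
  for k :: "('a, 'b) ring_scheme" (structure) and S :: "'s set"
    and G :: "('g, 'c) monoid_scheme" and \<rho> :: "'g \<Rightarrow> 's \<Rightarrow> 's"
    and H :: "('h, 'd) monoid_scheme" and \<tau> :: "'h \<Rightarrow> 's \<Rightarrow> 's" +
  assumes dense: "\<lbrakk>h \<in> carrier H; finite T; T \<subseteq> S\<rbrakk> \<Longrightarrow> \<exists>g\<in>carrier G. \<forall>t\<in>T. \<rho> g t = \<tau> h t"
begin

abbreviation tm where "tm \<equiv> transfer_module k S G \<rho> \<tau>"

context
  fixes V :: "('g \<Rightarrow> 's multiset \<Rightarrow> 'a, 'v) module"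
  assumes V: "discrete_poly_module k S G \<rho> V"
begin

interpretation V: discrete_poly_module k S G \<rho> V
  by (rule V)

abbreviation mvH where "mvH \<equiv> transferred_move k S G \<rho> \<tau> V"

text \<open>
  Two approximations with respect to different supports are compared through a third one, on the
  union of the supports.
\<close>
lemma transferred_move_eq:
  assumes T: "V.supp T v" and v: "v \<in> carrier V" and g: "g \<in> carrier G" and h: "h \<in> carrier H"
    and eq: "\<And>t. t \<in> T \<Longrightarrow> \<rho> g t = \<tau> h t"
  shows "mvH h v = V.mv g v"
proof -
  let ?P = "\<lambda>g. g \<in> carrier G \<and> (\<exists>T. V.supp T v \<and> (\<forall>t\<in>T. \<rho> g t = \<tau> h t))"
  have "?P g"
    using g T eq by blast
  then have "?P (Eps ?P)"
    by (rule someI)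
  then obtain g' T' where g': "g' \<in> carrier G" "V.supp T' v" "\<forall>t\<in>T'. \<rho> g' t = \<tau> h t"
    and m: "mvH h v = V.mv g' v"
    unfolding transferred_move_def by blast
  have "finite (T \<union> T')" "T \<union> T' \<subseteq> S"
    using T g' by (auto simp: supports_def)
  then obtain u where u: "u \<in> carrier G" "\<forall>t\<in>T \<union> T'. \<rho> u t = \<tau> h t"
    using dense[OF h] by blast
  have "V.mv g' v = V.mv u v"
    using g' u by (intro V.supp_agree[OF g'(2) v]) auto
  also have "\<dots> = V.mv g v"
    using u g eq by (intro V.supp_agree[OF T v]) auto
  finally show ?thesis
    using m by simp
qed

lemma obtain_approximation:
  assumes v: "v \<in> carrier V" and h: "h \<in> carrier H" and U: "finite U" "U \<subseteq> S"
  obtains T g where "V.supp T v" "U \<subseteq> T" "g \<in> carrier G" "\<And>t. t \<in> T \<Longrightarrow> \<rho> g t = \<tau> h t"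
    "mvH h v = V.mv g v"
proof -
  obtain T where T: "V.supp T v"
    using V.finite_support[OF v] by blast
  then have TU: "finite (T \<union> U)" "T \<union> U \<subseteq> S"
    using U by (auto simp: supports_def)
  then have T': "V.supp (T \<union> U) v"
    using V.supp_mono[OF T] by blast
  obtain g where g: "g \<in> carrier G" "\<forall>t\<in>T \<union> U. \<rho> g t = \<tau> h t"
    using dense[OF h TU] by blast
  show thesis
    using transferred_move_eq[OF T' v g(1) h] g T' by (intro that[of "T \<union> U" g]) auto
qed

lemma transferred_move_closed: "\<lbrakk>h \<in> carrier H; v \<in> carrier V\<rbrakk> \<Longrightarrow> mvH h v \<in> carrier V"
  by (rule obtain_approximation[of v h "{}"]) auto

lemma transferred_move_add:
  assumes h: "h \<in> carrier H" and v: "v \<in> carrier V" and w: "w \<in> carrier V"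
  shows "mvH h (v \<oplus>\<^bsub>V\<^esub> w) = mvH h v \<oplus>\<^bsub>V\<^esub> mvH h w"
proof -
  obtain U where U: "V.supp U w"
    using V.finite_support[OF w] by blast
  then have "finite U" "U \<subseteq> S"
    by (auto simp: supports_def)
  then obtain T g where T: "V.supp T v" "U \<subseteq> T" "g \<in> carrier G" "\<And>t. t \<in> T \<Longrightarrow> \<rho> g t = \<tau> h t"
    "mvH h v = V.mv g v"
    using obtain_approximation[OF v h] by metis
  have w': "V.supp T w"
    using T(1) V.supp_mono[OF U T(2)] by (simp add: supports_def)
  show ?thesis
    using transferred_move_eq[OF w' w T(3) h T(4)] T
      transferred_move_eq[OF V.supp_add[OF T(1) w' v w] _ T(3) h T(4)] v w by (simp add: V.mv_add)
qed

text \<open>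
  The approximation of \<open>h\<close> has to be good on the indeterminates of \<open>a\<close> too.
\<close>
lemma transferred_move_scale:
  assumes h: "h \<in> carrier H" and a: "a \<in> carrier A.KS" and v: "v \<in> carrier V"
  shows "mvH h (V.sc a v) = V.sc (B.act h a) (mvH h v)"
proof -
  obtain T0 where T0: "V.supp T0 v"
    using V.finite_support[OF v] by blast
  obtain U where U: "finite U" "U \<subseteq> S" "V.supp (T0 \<union> U) (V.sc a v)"
    and eq: "\<And>\<pi> \<tau>. \<lbrakk>\<pi> \<in> Bij S; \<tau> \<in> Bij S; \<forall>u\<in>U. \<pi> u = \<tau> u\<rbrakk> \<Longrightarrow>
           poly_act k S \<pi> a = poly_act k S \<tau> a"
    using V.smult_finite_support[OF a v T0] by blast
  have TU: "finite (T0 \<union> U)" "T0 \<union> U \<subseteq> S"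
    using T0 U by (auto simp: supports_def)
  obtain T g where T: "V.supp T v" "T0 \<union> U \<subseteq> T" "g \<in> carrier G" "\<And>t. t \<in> T \<Longrightarrow> \<rho> g t = \<tau> h t"
    "mvH h v = V.mv g v"
    using obtain_approximation[OF v h TU] by metis
  have "V.supp T (V.sc a v)"
    using T(1) V.supp_mono[OF U(3) T(2)] by (simp add: supports_def)
  then have "mvH h (V.sc a v) = V.mv g (V.sc a v)"
    using a v by (intro transferred_move_eq[OF _ _ T(3) h T(4)]) auto
  also have "\<dots> = V.sc (A.act g a) (V.mv g v)"
    using T a v by (simp add: V.mv_sc)
  also have "A.act g a = B.act h a"
    using T U h by (intro eq A.rho_Bij B.rho_Bij) auto
  finally show ?thesis
    using T by simp
qed

text \<open>
  Here \<open>h'\<close> is approximated on a support of \<open>v\<close>, and \<open>h\<close> on the image of that support, which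
  supports \<open>h' v\<close>.
\<close>
lemma transferred_move_mult:
  assumes h: "h \<in> carrier H" and h': "h' \<in> carrier H" and v: "v \<in> carrier V"
  shows "mvH (h \<otimes>\<^bsub>H\<^esub> h') v = mvH h (mvH h' v)"
proof -
  obtain T g' where T: "V.supp T v" "g' \<in> carrier G" "\<And>t. t \<in> T \<Longrightarrow> \<rho> g' t = \<tau> h' t"
    "mvH h' v = V.mv g' v"
    using obtain_approximation[OF v h', of "{}"] by auto
  have T': "V.supp (\<rho> g' ` T) (V.mv g' v)"
    using V.supp_mv[OF T(1) v T(2)] .
  then have "finite (\<rho> g' ` T)" "\<rho> g' ` T \<subseteq> S"
    by (auto simp: supports_def)
  then obtain g where g: "g \<in> carrier G" "\<forall>t\<in>\<rho> g' ` T. \<rho> g t = \<tau> h t"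
    using dense[OF h] by blast
  have TS: "T \<subseteq> S"
    using T(1) by (simp add: supports_def)
  have "mvH h (mvH h' v) = V.mv g (V.mv g' v)"
    unfolding T(4) using T(2) g v h by (intro transferred_move_eq[OF T']) auto
  also have "\<dots> = V.mv (g \<otimes>\<^bsub>G\<^esub> g') v"
    using T g v by (simp add: V.mv_mult)
  also have "\<dots> = mvH (h \<otimes>\<^bsub>H\<^esub> h') v"
    using T g h h' TS
    by (intro transferred_move_eq[OF T(1) v, symmetric])
      (auto simp: A.rho_mult_app B.rho_mult_app subset_iff)
  finally show ?thesis
    by simp
qed

lemma transferred_move_one: "v \<in> carrier V \<Longrightarrow> mvH \<one>\<^bsub>H\<^esub> v = v"
proof -
  assume v: "v \<in> carrier V"
  obtain T where T: "V.supp T v"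
    using V.finite_support[OF v] by blast
  then have "mvH \<one>\<^bsub>H\<^esub> v = V.mv \<one>\<^bsub>G\<^esub> v"
    using v by (intro transferred_move_eq[OF T])
      (auto simp: A.rho_one_app B.rho_one_app supports_def subset_iff)
  then show ?thesis
    using v by (simp add: V.mv_one)
qed

lemma semilinear_transfer:
  "semilinear_module A.KS H B.act B.KSG (tm V) V.sc mvH"
proof (intro semilinear_module.intro semilinear_module_axioms.intro)
  show "twisted_monoid_ring A.KS H B.act B.KSG"
    by (rule B.KSG.twisted_monoid_ring_axioms)
  show "abelian_group (tm V)"
  proof (rule abelian_groupI)
    show "\<exists>w\<in>carrier (tm V). w \<oplus>\<^bsub>tm V\<^esub> v = \<zero>\<^bsub>tm V\<^esub>" if "v \<in> carrier (tm V)" for v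
      using that V.V.l_neg[of v] V.V.a_inv_closed[of v] unfolding transfer_module_simps by blast
  qed (simp_all add: transfer_module_simps V.V.a_ac)
qed (simp_all add: transfer_module_simps V.sc_add_left V.sc_add_right V.sc_mult V.sc_one
    transferred_move_closed transferred_move_add transferred_move_scale transferred_move_mult
    transferred_move_one)

lemma transfer_smult_single:
  "\<lbrakk>a \<in> carrier A.KS; h \<in> carrier H; v \<in> carrier V\<rbrakk> \<Longrightarrow> single A.KS a h \<odot>\<^bsub>tm V\<^esub> v = V.sc a (mvH h v)"
  by (rule semilinear_module.smult_single[OF semilinear_transfer]) (simp_all add: transfer_module_simps)

lemma transfer_group_move:
  "\<lbrakk>h \<in> carrier H; v \<in> carrier V\<rbrakk> \<Longrightarrow> group_move k S (tm V) h v = mvH h v"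
  by (simp add: group_move_def B.skew_elem_eq transfer_smult_single V.sc_one transferred_move_closed)

lemma transfer_poly_scale:
  "\<lbrakk>a \<in> carrier A.KS; v \<in> carrier V\<rbrakk> \<Longrightarrow> poly_scale k S H (tm V) a v = V.sc a v"
  by (simp add: poly_scale_def[of k S H] transfer_smult_single transferred_move_one)

lemma transfer_supports:
  assumes v: "v \<in> carrier V" and T: "V.supp T v"
  shows "supports k S H \<tau> (tm V) T v"
  unfolding supports_def
proof (intro conjI ballI impI)
  fix h assume h: "h \<in> carrier H" "\<forall>t\<in>T. \<tau> h t = t"
  have "mvH h v = V.mv \<one>\<^bsub>G\<^esub> v"
    using T h by (intro transferred_move_eq[OF T v]) (auto simp: A.rho_one_app supports_def subset_iff)
  then show "group_move k S (tm V) h v = v"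
    using h v by (simp add: transfer_group_move V.mv_one)
qed (use T in \<open>auto simp: supports_def\<close>)

lemma discrete_transfer: "discrete_poly_module k S H \<tau> (tm V)"
proof (intro discrete_poly_module.intro discrete_poly_module_axioms.intro poly_action_module.intro)
  show "left_module B.KSG (tm V)"
    by (rule semilinear_module.left_module_semilinear[OF semilinear_transfer])
  show "\<exists>T. supports k S H \<tau> (tm V) T v" if "v \<in> carrier (tm V)" for v
    using that V.finite_support transfer_supports unfolding transfer_module_simps by blast
qed (rule B.poly_action_axioms)

end

text \<open>
  A support of \<open>v\<close> is one of \<open>f v\<close>, so that the same approximation computes the action on both.
\<close>
lemma module_homs_transfer:
  assumes V: "discrete_poly_module k S G \<rho> V" and W: "discrete_poly_module k S G \<rho> W"
    and f: "f \<in> module_homs A.KSG V W"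
  shows "f \<in> module_homs B.KSG (tm V) (tm W)"
proof -
  interpret V: discrete_poly_module k S G \<rho> V by fact
  interpret W: discrete_poly_module k S G \<rho> W by fact
  interpret TV: discrete_poly_module k S H \<tau> "tm V"
    by (rule discrete_transfer) fact
  interpret TW: discrete_poly_module k S H \<tau> "tm W"
    by (rule discrete_transfer) fact
  have f_closed: "f v \<in> carrier W" if "v \<in> carrier V" for v
    using f that by (auto simp: module_homs_def)
  have f_add: "f (v \<oplus>\<^bsub>V\<^esub> w) = f v \<oplus>\<^bsub>W\<^esub> f w" if "v \<in> carrier V" "w \<in> carrier V" for v w
    using f that by (auto simp: module_homs_def)
  have f_smult: "f (a \<odot>\<^bsub>V\<^esub> v) = a \<odot>\<^bsub>W\<^esub> f v" if "a \<in> carrier A.KSG" "v \<in> carrier V" for a v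
    using f that by (auto simp: module_homs_def)
  have f_mv: "f (V.mv g v) = W.mv g (f v)" if "g \<in> carrier G" "v \<in> carrier V" for g v
    using that by (simp add: V.mv_eq W.mv_eq f_smult A.KSG.single_closed)
  have f_sc: "f (V.sc a v) = W.sc a (f v)" if "a \<in> carrier A.KS" "v \<in> carrier V" for a v
    using that by (simp add: poly_scale_def f_smult A.KSG.single_closed)
  have f_mvH: "f (transferred_move k S G \<rho> \<tau> V h v) = transferred_move k S G \<rho> \<tau> W h (f v)"
    if h: "h \<in> carrier H" and v: "v \<in> carrier V" for h v
  proof -
    obtain T g where T: "V.supp T v" "g \<in> carrier G" "\<And>t. t \<in> T \<Longrightarrow> \<rho> g t = \<tau> h t"
      "transferred_move k S G \<rho> \<tau> V h v = V.mv g v"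
      using obtain_approximation[OF V v h, of "{}"] by auto
    have "W.supp T (f v)"
      using T(1) v by (auto simp: supports_def f_mv[symmetric])
    then have "transferred_move k S G \<rho> \<tau> W h (f v) = W.mv g (f v)"
      using T h v by (intro transferred_move_eq[OF W]) (auto simp: f_closed)
    then show ?thesis
      using T v by (simp add: f_mv)
  qed
  have "f (a \<odot>\<^bsub>tm V\<^esub> v) = a \<odot>\<^bsub>tm W\<^esub> f v" if a: "a \<in> carrier B.KSG" and v: "v \<in> carrier V" for a v
    using a
  proof (induction a rule: B.KSG.single_induct)
    case (single a h)
    then show ?case
      using v by (simp add: transfer_smult_single[OF V] transfer_smult_single[OF W] f_closed
          f_sc f_mvH transferred_move_closed[OF V])
  next
    case (add a b)
    have "a \<odot>\<^bsub>tm V\<^esub> v \<in> carrier V" "b \<odot>\<^bsub>tm V\<^esub> v \<in> carrier V"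
      using TV.V.smult_closed[OF add(1), of v] TV.V.smult_closed[OF add(2), of v] v
      by (simp_all add: transfer_module_simps(1))
    moreover have "(a \<oplus>\<^bsub>B.KSG\<^esub> b) \<odot>\<^bsub>tm V\<^esub> v = a \<odot>\<^bsub>tm V\<^esub> v \<oplus>\<^bsub>V\<^esub> b \<odot>\<^bsub>tm V\<^esub> v"
      using TV.V.smult_l_distr[OF add(1,2), of v] v by (simp add: transfer_module_simps(1,2))
    moreover have "(a \<oplus>\<^bsub>B.KSG\<^esub> b) \<odot>\<^bsub>tm W\<^esub> f v = a \<odot>\<^bsub>tm W\<^esub> f v \<oplus>\<^bsub>W\<^esub> b \<odot>\<^bsub>tm W\<^esub> f v"
      using TW.V.smult_l_distr[OF add(1,2), of "f v"] f_closed[OF v]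
      by (simp add: transfer_module_simps(1,2))
    ultimately show ?case
      using add f_add by simp
  qed
  then show ?thesis
    using f unfolding module_homs_def by (simp add: transfer_module_simps(1,2))
qed

end

lemma (in poly_action) category_discrete_modules:
  "category (discrete_module_category k S G \<rho> :: (('g \<Rightarrow> 's multiset \<Rightarrow> 'a, 'm) module, 'm \<Rightarrow> 'm) category)"
proof -
  have V: "left_module KSG V" if "discrete_module k S G \<rho> V"
    for V :: "('g \<Rightarrow> 's multiset \<Rightarrow> 'a, 'm) module"
    using that by (simp add: discrete_module_def)
  have closed: "a \<odot>\<^bsub>V\<^esub> v \<in> carrier V"
    if "discrete_module k S G \<rho> V" "v \<in> carrier V" "a \<in> carrier KSG"
    for V :: "('g \<Rightarrow> 's multiset \<Rightarrow> 'a, 'm) module" and a v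
    using that left_module.smult_closed[OF V] by blast
  have add_closed: "v \<oplus>\<^bsub>V\<^esub> w \<in> carrier V"
    if "discrete_module k S G \<rho> V" "v \<in> carrier V" "w \<in> carrier V"
    for V :: "('g \<Rightarrow> 's multiset \<Rightarrow> 'a, 'm) module" and v w
  proof -
    interpret V: left_module KSG V
      by (rule V) fact
    show ?thesis
      using that by auto
  qed
  show ?thesis
  proof
    fix U :: "('g \<Rightarrow> 's multiset \<Rightarrow> 'a, 'm) module"
    assume "U \<in> cat_obj (discrete_module_category k S G \<rho>)"
    then show "cat_id (discrete_module_category k S G \<rho>) U
        \<in> cat_hom (discrete_module_category k S G \<rho>) U U"
      using closed add_closed by (auto simp: discrete_module_category_def module_homs_def)
  next
    fix U V W :: "('g \<Rightarrow> 's multiset \<Rightarrow> 'a, 'm) module" and f g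
    assume "U \<in> cat_obj (discrete_module_category k S G \<rho>)"
      and "f \<in> cat_hom (discrete_module_category k S G \<rho>) U V"
      and "g \<in> cat_hom (discrete_module_category k S G \<rho>) V W"
    then have U: "discrete_module k S G \<rho> U" and fg: "f \<in> module_homs KSG U V" "g \<in> module_homs KSG V W"
      by (simp_all add: discrete_module_category_def)
    then have "f x \<in> carrier V" if "x \<in> carrier U" for x
      using that by (auto simp: module_homs_def)
    with U fg closed add_closed have "compose (carrier U) g f \<in> module_homs KSG U W"
      by (simp add: module_homs_def compose_def PiE_iff)
    then show "cat_comp (discrete_module_category k S G \<rho>) U V W g f
        \<in> cat_hom (discrete_module_category k S G \<rho>) U W"
      by (simp add: discrete_module_category_def)
  next
    fix T U V W :: "('g \<Rightarrow> 's multiset \<Rightarrow> 'a, 'm) module" and f g h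
    assume "f \<in> cat_hom (discrete_module_category k S G \<rho>) T U"
    then show "cat_comp (discrete_module_category k S G \<rho>) T U W
          (cat_comp (discrete_module_category k S G \<rho>) U V W h g) f
        = cat_comp (discrete_module_category k S G \<rho>) T V W h
          (cat_comp (discrete_module_category k S G \<rho>) T U V g f)"
      by (auto simp: discrete_module_category_def module_homs_def compose_def fun_eq_iff)
  qed (auto simp: discrete_module_category_def module_homs_def compose_def fun_eq_iff PiE_def
      extensional_def)
qed

lemma category_functor_compose:
  assumes "category_functor C D F \<phi>" and "category_functor D E G \<psi>"
  shows "category_functor C E (\<lambda>U. G (F U)) (\<lambda>U V f. \<psi> (F U) (F V) (\<phi> U V f))"
proof -
  interpret F: category_functor C D F \<phi> by fact
  interpret G: category_functor D E G \<psi> by fact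
  show ?thesis
    by (intro category_functor.intro category_functor_axioms.intro F.C.category_axioms
        G.D.category_axioms)
      (auto simp: F.map_id F.map_comp intro!: F.map_obj G.map_obj F.map_hom G.map_hom
        G.map_id G.map_comp)
qed

text \<open>
  Both transfers keep carriers and homomorphisms. Transferring forth and back reproduces the action
  on the carrier, while the scalar multiplication may change outside of it: the identity maps are
  natural isomorphisms, but the composite functors need not be equal to the identity.
\<close>
locale mutually_dense_actions = AB: dense_actions k S G \<rho> H \<tau> + BA: dense_actions k S H \<tau> G \<rho>
  for k :: "('a, 'b) ring_scheme" (structure) and S :: "'s set"
    and G :: "('g, 'c) monoid_scheme" and \<rho> :: "'g \<Rightarrow> 's \<Rightarrow> 's"
    and H :: "('h, 'd) monoid_scheme" and \<tau> :: "'h \<Rightarrow> 's \<Rightarrow> 's"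
begin

lemma functor_transfer:
  "category_functor (discrete_module_category k S G \<rho> :: (('g \<Rightarrow> 's multiset \<Rightarrow> 'a, 'm) module, 'm \<Rightarrow> 'm) category)
     (discrete_module_category k S H \<tau>) AB.tm (\<lambda>U V f. f)"
proof (intro category_functor.intro category_functor_axioms.intro)
  fix U V :: "('g \<Rightarrow> 's multiset \<Rightarrow> 'a, 'm) module" and f
  assume "U \<in> cat_obj (discrete_module_category k S G \<rho>)" "V \<in> cat_obj (discrete_module_category k S G \<rho>)"
    "f \<in> cat_hom (discrete_module_category k S G \<rho>) U V"
  then show "f \<in> cat_hom (discrete_module_category k S H \<tau>) (AB.tm U) (AB.tm V)"
    using AB.module_homs_transfer
    by (simp add: discrete_module_category_def AB.A.discrete_module_iff)
qed (rule AB.A.category_discrete_modules AB.B.category_discrete_modules |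
    simp add: AB.discrete_transfer discrete_module_category_def AB.A.discrete_module_iff AB.B.discrete_module_iff
    transfer_module_simps(1))+

lemma transfer_transfer_smult:
  assumes V: "discrete_poly_module k S G \<rho> V" and f: "f \<in> carrier AB.A.KSG" and v: "v \<in> carrier V"
  shows "f \<odot>\<^bsub>BA.tm (AB.tm V)\<^esub> v = f \<odot>\<^bsub>V\<^esub> v"
proof -
  interpret V: discrete_poly_module k S G \<rho> V by fact
  interpret T: discrete_poly_module k S H \<tau> "AB.tm V"
    by (rule AB.discrete_transfer) fact
  interpret TT: discrete_poly_module k S G \<rho> "BA.tm (AB.tm V)"
    by (rule BA.discrete_transfer) (rule T.discrete_poly_module_axioms)
  note T' = T.discrete_poly_module_axioms
  show ?thesis
    using f
  proof (induction f rule: AB.A.KSG.single_induct)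
    case (single a g)
    obtain U where U: "V.supp U v"
      using V.finite_support[OF v] by blast
    then have "finite U" "U \<subseteq> S"
      by (auto simp: supports_def)
    then obtain h where h: "h \<in> carrier H" "\<forall>t\<in>U. \<tau> h t = \<rho> g t"
      using BA.dense[OF single(2)] by blast
    have "transferred_move k S H \<tau> \<rho> (AB.tm V) g v = group_move k S (AB.tm V) h v"
      using h v by (intro BA.transferred_move_eq[OF T' AB.transfer_supports[OF V v U] _ _ single(2)])
        (auto simp: transfer_module_simps(1))
    also have "\<dots> = transferred_move k S G \<rho> \<tau> V h v"
      by (rule AB.transfer_group_move[OF V h(1) v])
    also have "\<dots> = V.mv g v"
      using h by (intro AB.transferred_move_eq[OF V U v single(2)]) auto
    finally have m: "transferred_move k S H \<tau> \<rho> (AB.tm V) g v = V.mv g v" .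
    show ?case
      using single v by (simp add: BA.transfer_smult_single[OF T'] transfer_module_simps(1) m
          AB.transfer_poly_scale[OF V] V.smult_single)
  next
    case (add f h)
    have "(f \<oplus>\<^bsub>AB.A.KSG\<^esub> h) \<odot>\<^bsub>BA.tm (AB.tm V)\<^esub> v
        = f \<odot>\<^bsub>BA.tm (AB.tm V)\<^esub> v \<oplus>\<^bsub>V\<^esub> h \<odot>\<^bsub>BA.tm (AB.tm V)\<^esub> v"
      using TT.V.smult_l_distr[OF add(1,2), of v] v by (simp add: transfer_module_simps(1,2))
    then show ?case
      using add v by (simp add: V.V.smult_l_distr)
  qed
qed

lemma identity_hom_transfer_transfer:
  assumes V: "discrete_poly_module k S G \<rho> V"
  shows "(\<lambda>v\<in>carrier V. v) \<in> module_homs AB.A.KSG V (BA.tm (AB.tm V))"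
    and "(\<lambda>v\<in>carrier V. v) \<in> module_homs AB.A.KSG (BA.tm (AB.tm V)) V"
proof -
  interpret V: discrete_poly_module k S G \<rho> V by fact
  show "(\<lambda>v\<in>carrier V. v) \<in> module_homs AB.A.KSG V (BA.tm (AB.tm V))"
    "(\<lambda>v\<in>carrier V. v) \<in> module_homs AB.A.KSG (BA.tm (AB.tm V)) V"
    unfolding module_homs_def
    by (auto simp: transfer_module_simps(1,2) transfer_transfer_smult[OF V])
qed

lemma restrict_id_compose:
  assumes "f \<in> module_homs R U V"
  shows "compose (carrier U) (\<lambda>v\<in>carrier V. v) f = f"
    and "compose (carrier U) f (\<lambda>v\<in>carrier U. v) = f"
  using assms by (auto simp: module_homs_def compose_def fun_eq_iff PiE_def extensional_def)

lemma natural_isomorphisms_transfer: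
  fixes C :: "(('g \<Rightarrow> 's multiset \<Rightarrow> 'a, 'm) module, 'm \<Rightarrow> 'm) category"
  defines "C \<equiv> discrete_module_category k S G \<rho>"
  assumes F: "category_functor C C (\<lambda>U. BA.tm (AB.tm U)) (\<lambda>U V f. f)"
  shows "natural_isomorphism C C (\<lambda>U. U) (\<lambda>U V f. f)
           (\<lambda>U. BA.tm (AB.tm U)) (\<lambda>U V f. f) (\<lambda>U. \<lambda>v\<in>carrier U. v)"
    and "natural_isomorphism C C (\<lambda>U. BA.tm (AB.tm U)) (\<lambda>U V f. f)
           (\<lambda>U. U) (\<lambda>U V f. f) (\<lambda>U. \<lambda>v\<in>carrier U. v)"
proof -
  have C: "category C"
    unfolding C_def by (rule AB.A.category_discrete_modules)
  have I: "category_functor C C (\<lambda>U. U) (\<lambda>U V f. f)"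
    by (intro category_functor.intro category_functor_axioms.intro C) simp_all
  have obj: "U \<in> cat_obj C \<longleftrightarrow> discrete_poly_module k S G \<rho> U" for U
    by (simp add: C_def discrete_module_category_def AB.A.discrete_module_iff)
  have homs: "cat_hom C = module_homs AB.A.KSG"
    "cat_comp C U V W g f = compose (carrier U) g f" "cat_id C U = (\<lambda>v\<in>carrier U. v)" for U V W f g
    by (simp_all add: C_def discrete_module_category_def)
  have cr: "carrier (BA.tm (AB.tm U)) = carrier U" for U :: "('g \<Rightarrow> 's multiset \<Rightarrow> 'a, 'm) module"
    by (simp add: transfer_module_simps(1))
  have id: "compose (carrier U) (\<lambda>v\<in>carrier U. v) (\<lambda>v\<in>carrier U. v) = (\<lambda>v\<in>carrier U. v)"
    for U :: "('g \<Rightarrow> 's multiset \<Rightarrow> 'a, 'm) module"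
    by (auto simp: compose_def)
  show "natural_isomorphism C C (\<lambda>U. U) (\<lambda>U V f. f)
           (\<lambda>U. BA.tm (AB.tm U)) (\<lambda>U V f. f) (\<lambda>U. \<lambda>v\<in>carrier U. v)"
    "natural_isomorphism C C (\<lambda>U. BA.tm (AB.tm U)) (\<lambda>U V f. f)
           (\<lambda>U. U) (\<lambda>U V f. f) (\<lambda>U. \<lambda>v\<in>carrier U. v)"
    by (intro natural_isomorphism.intro natural_isomorphism_axioms.intro F I;
        simp add: obj homs is_iso_in_def cr restrict_id_compose;
        use identity_hom_transfer_transfer id in blast)+
qed

end

theorem (in mutually_dense_actions) equivalent_discrete_module_categories:
  "equivalent_categories
     (discrete_module_category k S G \<rho> :: (('g \<Rightarrow> 's multiset \<Rightarrow> 'a, 'm) module, 'm \<Rightarrow> 'm) category)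
     (discrete_module_category k S H \<tau> :: (('h \<Rightarrow> 's multiset \<Rightarrow> 'a, 'm) module, 'm \<Rightarrow> 'm) category)"
proof -
  let ?C = "discrete_module_category k S G \<rho> :: (('g \<Rightarrow> 's multiset \<Rightarrow> 'a, 'm) module, 'm \<Rightarrow> 'm) category"
  let ?D = "discrete_module_category k S H \<tau> :: (('h \<Rightarrow> 's multiset \<Rightarrow> 'a, 'm) module, 'm \<Rightarrow> 'm) category"
  interpret opp: mutually_dense_actions k S H \<tau> G \<rho> ..
  have F: "category_functor ?C ?D AB.tm (\<lambda>U V f. f)"
    by (rule functor_transfer)
  have G: "category_functor ?D ?C BA.tm (\<lambda>U V f. f)"
    by (rule opp.functor_transfer)
  have FG: "category_functor ?C ?C (\<lambda>U. BA.tm (AB.tm U)) (\<lambda>U V f. f)"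
    and GF: "category_functor ?D ?D (\<lambda>U. AB.tm (BA.tm U)) (\<lambda>U V f. f)"
    by (fact category_functor_compose[OF F G] category_functor_compose[OF G F])+
  show ?thesis
    unfolding equivalent_categories_def
  proof (rule exI[of _ AB.tm], rule exI[of _ "\<lambda>U V f. f"], rule exI[of _ BA.tm],
      rule exI[of _ "\<lambda>U V f. f"], intro conjI)
    show "category_functor ?C ?D AB.tm (\<lambda>U V f. f)" "category_functor ?D ?C BA.tm (\<lambda>U V f. f)"
      by (fact F G)+
    show "\<exists>\<eta>. natural_isomorphism ?C ?C (\<lambda>U. U) (\<lambda>U V f. f) (\<lambda>U. BA.tm (AB.tm U)) (\<lambda>U V f. f) \<eta>"
      by (rule exI) (rule natural_isomorphisms_transfer(1)[OF FG])
    show "\<exists>\<epsilon>. natural_isomorphism ?D ?D (\<lambda>U. AB.tm (BA.tm U)) (\<lambda>U V f. f) (\<lambda>U. U) (\<lambda>U V f. f) \<epsilon>"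
      by (rule exI) (rule opp.natural_isomorphisms_transfer(2)[OF GF])
  qed
qed


section \<open>Finite generation from leading terms\<close>

text \<open>
  The elements \<open>el t\<close> with \<open>t \<in> T\<close> need not be linearly independent. Leading terms therefore belong
  to representations, and one element can have several of them.
\<close>
locale leading_terms = k: cring k + k: noetherian_ring k + V: abelian_group V
  for k :: "('a, 'b) ring_scheme" and V :: "('v, 'd) ring_scheme" +
  fixes sc :: "'a \<Rightarrow> 'v \<Rightarrow> 'v" and el :: "'t :: wellorder \<Rightarrow> 'v" and T :: "'t set"
  assumes sc_closed [simp]: "\<lbrakk>c \<in> carrier k; v \<in> carrier V\<rbrakk> \<Longrightarrow> sc c v \<in> carrier V"
    and sc_add_left: "\<lbrakk>c \<in> carrier k; d \<in> carrier k; v \<in> carrier V\<rbrakk> \<Longrightarrow>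
          sc (c \<oplus>\<^bsub>k\<^esub> d) v = sc c v \<oplus>\<^bsub>V\<^esub> sc d v"
    and sc_add_right: "\<lbrakk>c \<in> carrier k; v \<in> carrier V; w \<in> carrier V\<rbrakk> \<Longrightarrow>
          sc c (v \<oplus>\<^bsub>V\<^esub> w) = sc c v \<oplus>\<^bsub>V\<^esub> sc c w"
    and sc_mult: "\<lbrakk>c \<in> carrier k; d \<in> carrier k; v \<in> carrier V\<rbrakk> \<Longrightarrow> sc (c \<otimes>\<^bsub>k\<^esub> d) v = sc c (sc d v)"
    and sc_one: "v \<in> carrier V \<Longrightarrow> sc \<one>\<^bsub>k\<^esub> v = v"
    and el_closed [simp]: "t \<in> T \<Longrightarrow> el t \<in> carrier V"
begin

inductive_set below :: "'t \<Rightarrow> 'v set" for t :: 't where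
  below_zero: "\<zero>\<^bsub>V\<^esub> \<in> below t"
| below_term: "\<lbrakk>t' \<in> T; t' < t; c \<in> carrier k; u \<in> below t\<rbrakk> \<Longrightarrow> sc c (el t') \<oplus>\<^bsub>V\<^esub> u \<in> below t"

definition has_lead :: "'v \<Rightarrow> 't \<Rightarrow> 'a \<Rightarrow> bool" where
  "has_lead v t c \<longleftrightarrow> t \<in> T \<and> c \<in> carrier k \<and> (\<exists>u\<in>below t. v = sc c (el t) \<oplus>\<^bsub>V\<^esub> u)"

definition subspace :: "'v set \<Rightarrow> bool" where
  "subspace W \<longleftrightarrow> W \<subseteq> carrier V \<and> \<zero>\<^bsub>V\<^esub> \<in> W \<and> (\<forall>v\<in>W. \<forall>w\<in>W. v \<oplus>\<^bsub>V\<^esub> w \<in> W) \<and>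
     (\<forall>c\<in>carrier k. \<forall>v\<in>W. sc c v \<in> W)"

lemma sc_zero [simp]: "v \<in> carrier V \<Longrightarrow> sc \<zero>\<^bsub>k\<^esub> v = \<zero>\<^bsub>V\<^esub>"
  by (metis k.zero_closed k.r_zero sc_add_left sc_closed V.add.l_cancel_one)

lemma sc_zero_right [simp]: "c \<in> carrier k \<Longrightarrow> sc c \<zero>\<^bsub>V\<^esub> = \<zero>\<^bsub>V\<^esub>"
  by (metis V.zero_closed V.r_zero sc_add_right sc_closed V.add.l_cancel_one)

lemma sc_minus_one: "v \<in> carrier V \<Longrightarrow> sc (\<ominus>\<^bsub>k\<^esub> \<one>\<^bsub>k\<^esub>) v = \<ominus>\<^bsub>V\<^esub> v"
  by (metis V.minus_equality k.a_inv_closed k.l_neg k.one_closed sc_add_left sc_closed sc_one sc_zero)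

lemma below_closed: "u \<in> below t \<Longrightarrow> u \<in> carrier V"
  by (induction rule: below.induct) auto

lemma below_add: "\<lbrakk>u \<in> below t; w \<in> below t\<rbrakk> \<Longrightarrow> u \<oplus>\<^bsub>V\<^esub> w \<in> below t"
proof (induction rule: below.induct)
  case (below_term t' c u)
  then have "sc c (el t') \<oplus>\<^bsub>V\<^esub> (u \<oplus>\<^bsub>V\<^esub> w) \<in> below t"
    by (intro below.below_term) auto
  then show ?case
    using below_term by (simp add: V.a_assoc below_closed)
qed (simp add: below_closed)

lemma below_scale: "\<lbrakk>u \<in> below t; c \<in> carrier k\<rbrakk> \<Longrightarrow> sc c u \<in> below t"
proof (induction rule: below.induct)
  case (below_term t' d u)
  then have "sc (c \<otimes>\<^bsub>k\<^esub> d) (el t') \<oplus>\<^bsub>V\<^esub> sc c u \<in> below t"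
    by (intro below.below_term) auto
  then show ?case
    using below_term by (simp add: sc_add_right sc_mult below_closed)
qed (simp add: below.below_zero)

lemma below_minus: "u \<in> below t \<Longrightarrow> \<ominus>\<^bsub>V\<^esub> u \<in> below t"
  using below_scale[of u t "\<ominus>\<^bsub>k\<^esub> \<one>\<^bsub>k\<^esub>"] by (simp add: sc_minus_one below_closed)

lemma below_mono: "\<lbrakk>u \<in> below t; t \<le> t'\<rbrakk> \<Longrightarrow> u \<in> below t'"
  by (induction rule: below.induct) (auto intro: below.intros)

lemma single_term_below: "\<lbrakk>t' \<in> T; t' < t; c \<in> carrier k\<rbrakk> \<Longrightarrow> sc c (el t') \<in> below t"
  using below_term[OF _ _ _ below_zero, of t' t c] by simp

text \<open>
  A representation lists its terms in any order; the greatest one is sorted to the front, and equal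
  ones are merged.
\<close>
lemma below_has_lead:
  "u \<in> below t \<Longrightarrow> u = \<zero>\<^bsub>V\<^esub> \<or> (\<exists>t' c. t' < t \<and> has_lead u t' c)"
proof (induction rule: below.induct)
  case below_zero
  then show ?case
    by simp
next
  case (below_term s c u)
  have cl: "u \<in> carrier V" "sc c (el s) \<in> carrier V"
    using below_term by (auto simp: below_closed)
  have lead_s: ?case if "u \<in> below s"
    using below_term that by (auto simp: has_lead_def)
  from below_term(5) show ?case
  proof (elim disjE exE conjE)
    assume "u = \<zero>\<^bsub>V\<^esub>"
    then show ?case
      using lead_s below_zero by simp
  next
    fix t' d assume t': "t' < t" and lead: "has_lead u t' d"
    then obtain w where w: "t' \<in> T" "d \<in> carrier k" "w \<in> below t'" "u = sc d (el t') \<oplus>\<^bsub>V\<^esub> w"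
      by (auto simp: has_lead_def)
    have wc: "w \<in> carrier V"
      using w by (simp add: below_closed)
    consider "t' < s" | "t' = s" | "s < t'"
      by fastforce
    then show ?case
    proof cases
      case 1
      then have "w \<in> below s"
        using below_mono[OF w(3), of s] by simp
      then have "u \<in> below s"
        using w 1 by (auto intro: below.below_term)
      then show ?thesis
        by (rule lead_s)
    next
      case 2
      then have "sc c (el s) \<oplus>\<^bsub>V\<^esub> u = sc (c \<oplus>\<^bsub>k\<^esub> d) (el s) \<oplus>\<^bsub>V\<^esub> w"
        using w below_term wc by (simp add: sc_add_left V.a_assoc)
      then have "has_lead (sc c (el s) \<oplus>\<^bsub>V\<^esub> u) s (c \<oplus>\<^bsub>k\<^esub> d)"
        using w below_term 2 unfolding has_lead_def by blast
      then show ?thesis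
        using below_term(2) by blast
    next
      case 3
      have "sc c (el s) \<oplus>\<^bsub>V\<^esub> u = sc d (el t') \<oplus>\<^bsub>V\<^esub> (sc c (el s) \<oplus>\<^bsub>V\<^esub> w)"
        using w wc cl by (simp add: V.a_ac)
      moreover have "sc c (el s) \<oplus>\<^bsub>V\<^esub> w \<in> below t'"
        using 3 below_term w by (intro below.below_term) auto
      ultimately have "has_lead (sc c (el s) \<oplus>\<^bsub>V\<^esub> u) t' d"
        using w unfolding has_lead_def by blast
      then show ?thesis
        using t' by blast
    qed
  qed
qed

lemma ideal_of_leading_coefficients:
  assumes "subspace W" and t: "t \<in> T"
  shows "ideal {c \<in> carrier k. \<exists>u\<in>below t. sc c (el t) \<oplus>\<^bsub>V\<^esub> u \<in> W} k" (is "ideal ?J k")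
proof -
  note W = assms(1)[unfolded subspace_def]
  have scale: "a \<otimes>\<^bsub>k\<^esub> c \<in> ?J" if c: "c \<in> ?J" and a: "a \<in> carrier k" for a c
  proof -
    from c obtain u where u: "u \<in> below t" "sc c (el t) \<oplus>\<^bsub>V\<^esub> u \<in> W" and ck: "c \<in> carrier k"
      by blast
    have "sc (a \<otimes>\<^bsub>k\<^esub> c) (el t) \<oplus>\<^bsub>V\<^esub> sc a u = sc a (sc c (el t) \<oplus>\<^bsub>V\<^esub> u)"
      using a ck u t by (simp add: sc_mult sc_add_right below_closed)
    also have "\<dots> \<in> W"
      using W u a by blast
    finally show ?thesis
      using below_scale[OF u(1) a] a ck by auto
  qed
  show ?thesis
  proof (rule idealI)
    show "ring k"
      by (rule k.ring_axioms)
    show "subgroup ?J (add_monoid k)"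
    proof (rule k.add.subgroupI)
      have "sc \<zero>\<^bsub>k\<^esub> (el t) \<oplus>\<^bsub>V\<^esub> \<zero>\<^bsub>V\<^esub> \<in> W"
        using W t by simp
      then have "\<zero>\<^bsub>k\<^esub> \<in> ?J"
        using below_zero by blast
      then show "?J \<noteq> {}"
        by blast
      show "\<ominus>\<^bsub>k\<^esub> c \<in> ?J" if "c \<in> ?J" for c
        using scale[OF that, of "\<ominus>\<^bsub>k\<^esub> \<one>\<^bsub>k\<^esub>"] that by (simp add: k.l_minus)
      show "c \<oplus>\<^bsub>k\<^esub> d \<in> ?J" if "c \<in> ?J" "d \<in> ?J" for c d
      proof -
        from that(1) obtain u
          where u: "u \<in> below t" "sc c (el t) \<oplus>\<^bsub>V\<^esub> u \<in> W" "c \<in> carrier k"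
          by blast
        from that(2) obtain w
          where w: "w \<in> below t" "sc d (el t) \<oplus>\<^bsub>V\<^esub> w \<in> W" "d \<in> carrier k"
          by blast
        have "sc (c \<oplus>\<^bsub>k\<^esub> d) (el t) \<oplus>\<^bsub>V\<^esub> (u \<oplus>\<^bsub>V\<^esub> w)
            = (sc c (el t) \<oplus>\<^bsub>V\<^esub> u) \<oplus>\<^bsub>V\<^esub> (sc d (el t) \<oplus>\<^bsub>V\<^esub> w)"
          using u w t by (simp add: sc_add_left below_closed V.a_ac)
        also have "\<dots> \<in> W"
          using W u w by blast
        finally show ?thesis
          using below_add[OF u(1) w(1)] u w by auto
      qed
    qed auto
    show "a \<otimes>\<^bsub>k\<^esub> c \<in> ?J" if "c \<in> ?J" "a \<in> carrier k" for a c
      using scale that by blast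
    show "c \<otimes>\<^bsub>k\<^esub> a \<in> ?J" if "c \<in> ?J" "a \<in> carrier k" for a c
      using scale[OF that] that k.m_comm[of c a] by simp
  qed
qed

text \<open>The ideals generated by the initial segments of the sequence form a chain, which becomes stationary.\<close>
lemma sequence_dependent:
  assumes "range c \<subseteq> carrier k"
  shows "\<exists>n :: nat. c n \<in> genideal k (c ` {..<n})"
proof -
  let ?I = "\<lambda>n. genideal k (c ` {..<n})"
  have sub: "c ` A \<subseteq> carrier k" for A
    using assms by auto
  have mono: "?I m \<subseteq> ?I n" if "m \<le> n" for m n
    using that k.genideal_self[OF sub[of "{..<n}"]]
    by (intro k.genideal_minimal k.genideal_ideal sub) auto
  have "\<Union>(range ?I) \<in> range ?I"
  proof (rule k.ideal_chain_is_trivial)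
    show "subset.chain {I. ideal I k} (range ?I)"
      unfolding subset_chain_def using k.genideal_ideal[OF sub] mono
      by (auto, metis nle_le subsetD)
  qed simp
  then obtain n where n: "\<Union>(range ?I) = ?I n"
    by auto
  have "c n \<in> ?I (Suc n)"
    using k.genideal_self[OF sub[of "{..<Suc n}"]] by auto
  then have "c n \<in> \<Union>(range ?I)"
    by blast
  with n show ?thesis
    by blast
qed

text \<open>
  If no finite subset generated, elements of minimal leading term outside the part generated
  so far would form a sequence. Pass to a subsequence along which the leading terms ascend in
  the sense of \<open>rel\<close>. Eventually a leading coefficient is a combination of the previous
  ones, so that the element can be reduced by the generated part to one with a smaller leading
  term, a contradiction.
\<close>
theorem finitely_many_generate:
  fixes N :: "'v set" and gen :: "'v set \<Rightarrow> 'v set"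
  assumes rel: "almost_full_on rel T"
    and N: "subspace N"
    and gen: "\<And>B. B \<subseteq> N \<Longrightarrow> subspace (gen B) \<and> B \<subseteq> gen B \<and> gen B \<subseteq> N"
    and transport: "\<And>B w t t' c. \<lbrakk>B \<subseteq> N; w \<in> gen B; has_lead w t c; t' \<in> T; rel t t'\<rbrakk> \<Longrightarrow>
          \<exists>w'\<in>gen B. has_lead w' t' c"
  shows "\<exists>B\<subseteq>N. finite B \<and> (\<forall>v\<in>N. \<forall>t c. has_lead v t c \<longrightarrow> v \<in> gen B)"
proof (rule ccontr)
  assume no: "\<not> ?thesis"
  define cand where "cand B v t c \<longleftrightarrow> v \<in> N \<and> v \<notin> gen B \<and> has_lead v t c" for B v t c
  define minimal where "minimal B p \<longleftrightarrow> (case p of (v, t, c) \<Rightarrow>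
      cand B v t c \<and> (\<forall>v' t' c'. cand B v' t' c' \<longrightarrow> t \<le> t'))" for B p
  have ex_minimal: "\<exists>p. minimal B p"
    if B: "B \<subseteq> N" "finite B" for B
  proof -
    have ex: "\<exists>t. \<exists>v c. cand B v t c"
      using no B unfolding cand_def by blast
    define t where "t = (LEAST t. \<exists>v c. cand B v t c)"
    have "\<exists>v c. cand B v t c"
      unfolding t_def by (rule LeastI_ex[OF ex])
    then obtain v c where "cand B v t c"
      by blast
    moreover have "t \<le> t'" if "cand B v' t' c'" for v' t' c'
      unfolding t_def using that by (intro Least_le) blast
    ultimately show ?thesis
      by (intro exI[of _ "(v, t, c)"]) (auto simp: minimal_def)
  qed
  define pick where "pick B = (SOME p. minimal B p)" for B
  have pick: "cand B v t c \<and> (\<forall>v' t' c'. cand B v' t' c' \<longrightarrow> t \<le> t')"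
    if "B \<subseteq> N" "finite B" "pick B = (v, t, c)" for B v t c
  proof -
    have "minimal B (pick B)"
      unfolding pick_def by (rule someI_ex[OF ex_minimal[OF that(1,2)]])
    then show ?thesis
      unfolding that(3) by (auto simp: minimal_def)
  qed
  define Bs where "Bs = rec_nat {} (\<lambda>n B. insert (fst (pick B)) B)"
  define v t c where "v n = fst (pick (Bs n))" and "t n = fst (snd (pick (Bs n)))"
    and "c n = snd (snd (pick (Bs n)))" for n
  have Bs: "Bs 0 = {}" "Bs (Suc n) = insert (v n) (Bs n)" for n
    by (simp_all add: Bs_def v_def)
  have pick_Bs: "pick (Bs n) = (v n, t n, c n)" for n
    by (simp add: v_def t_def c_def)
  have Bs_N: "Bs n \<subseteq> N \<and> finite (Bs n)" for n
  proof (induction n)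
    case (Suc n)
    then show ?case
      using pick[OF _ _ pick_Bs, of n] by (simp add: Bs cand_def)
  qed (simp add: Bs)
  have cand: "cand (Bs n) (v n) (t n) (c n)"
    and least: "cand (Bs n) v' t' c' \<Longrightarrow> t n \<le> t'" for n v' t' c'
    using pick[OF _ _ pick_Bs, of n] Bs_N by blast+
  have vN: "v n \<in> N" "v n \<notin> gen (Bs n)" "has_lead (v n) (t n) (c n)" "t n \<in> T" "c n \<in> carrier k" for n
    using cand[of n] by (auto simp: cand_def has_lead_def)
  have v_Bs: "v m \<in> Bs n" if "m < n" for m n
    using that by (induction n) (auto simp: Bs less_Suc_eq)
  have "range t \<subseteq> T"
    using vN by auto
  from almost_full_on_subsequence[OF rel this]
  obtain s :: "nat \<Rightarrow> nat" where s: "strict_mono s" "\<And>i j. i < j \<Longrightarrow> rel (t (s i)) (t (s j))"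
    by blast
  have "range (\<lambda>j. c (s j)) \<subseteq> carrier k"
    using vN(5) by auto
  from sequence_dependent[OF this]
  obtain n where n: "c (s n) \<in> genideal k ((\<lambda>j. c (s j)) ` {..<n})"
    by blast
  let ?B = "Bs (s n)" and ?t = "t (s n)"
  have genB: "subspace (gen ?B)" "?B \<subseteq> gen ?B" "gen ?B \<subseteq> N"
    using gen[of ?B] Bs_N by auto
  \<comment> \<open>an ideal, to which the earlier leading coefficients belong by \<open>transport\<close>\<close>
  let ?J = "{c \<in> carrier k. \<exists>u\<in>below ?t. sc c (el ?t) \<oplus>\<^bsub>V\<^esub> u \<in> gen ?B}"
  have "c (s j) \<in> ?J" if "j < n" for j
  proof -
    have "s j < s n"
      using s(1) that by (simp add: strict_mono_def)
    then have "v (s j) \<in> gen ?B"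
      using v_Bs genB(2) by blast
    moreover have "rel (t (s j)) ?t"
      using s(2) that by blast
    ultimately obtain w where "w \<in> gen ?B" "has_lead w ?t (c (s j))"
      using transport[of ?B "v (s j)" "t (s j)" "c (s j)" ?t] Bs_N vN by blast
    then show ?thesis
      by (auto simp: has_lead_def)
  qed
  then have "genideal k ((\<lambda>j. c (s j)) ` {..<n}) \<subseteq> ?J"
    by (intro k.genideal_minimal ideal_of_leading_coefficients genB vN) auto
  with n obtain u' where u': "u' \<in> below ?t" "sc (c (s n)) (el ?t) \<oplus>\<^bsub>V\<^esub> u' \<in> gen ?B"
    by blast
  obtain u where u: "u \<in> below ?t" "v (s n) = sc (c (s n)) (el ?t) \<oplus>\<^bsub>V\<^esub> u"
    using vN(3)[of "s n"] by (auto simp: has_lead_def)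
  let ?w = "sc (c (s n)) (el ?t) \<oplus>\<^bsub>V\<^esub> u'" and ?x = "u \<oplus>\<^bsub>V\<^esub> \<ominus>\<^bsub>V\<^esub> u'"
  have cl: "u \<in> carrier V" "u' \<in> carrier V" "sc (c (s n)) (el ?t) \<in> carrier V"
    using u u' vN by (auto simp: below_closed)
  have x: "?x \<in> below ?t"
    using u u' by (intro below_add below_minus)
  have v_eq: "v (s n) = ?x \<oplus>\<^bsub>V\<^esub> ?w"
  proof -
    have "?x \<oplus>\<^bsub>V\<^esub> ?w = u \<oplus>\<^bsub>V\<^esub> (\<ominus>\<^bsub>V\<^esub> u' \<oplus>\<^bsub>V\<^esub> (u' \<oplus>\<^bsub>V\<^esub> sc (c (s n)) (el ?t)))"
      using cl by (simp add: V.a_assoc V.a_comm[of _ u'])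
    also have "\<dots> = v (s n)"
      unfolding u(2) using cl by (simp add: V.r_neg1 V.a_comm)
    finally show ?thesis
      by simp
  qed
  have "\<ominus>\<^bsub>V\<^esub> ?w \<in> N"
    using N genB(3) u'(2) sc_minus_one[of ?w] cl unfolding subspace_def
    by (metis V.a_closed k.a_inv_closed k.one_closed subsetD)
  moreover have "?x = v (s n) \<oplus>\<^bsub>V\<^esub> \<ominus>\<^bsub>V\<^esub> ?w"
    using cl v_eq by (simp add: V.a_assoc V.r_neg)
  ultimately have xN: "?x \<in> N"
    using N vN(1)[of "s n"] unfolding subspace_def by metis
  have x_gen: "?x \<notin> gen ?B"
    using vN(2)[of "s n"] v_eq u'(2) genB(1) unfolding subspace_def by metis
  then have "?x \<noteq> \<zero>\<^bsub>V\<^esub>"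
    using genB(1) unfolding subspace_def by metis
  then obtain t' c' where "t' < ?t" "has_lead ?x t' c'"
    using below_has_lead[OF x] by blast
  then have "cand ?B ?x t' c'"
    using xN x_gen by (simp add: cand_def)
  then show False
    using least[of "s n"] \<open>t' < ?t\<close> by fastforce
qed

end


section \<open>Order automorphisms on finite sets\<close>

text \<open>
  At a least \<open>x\<close> with \<open>f x \<noteq> g x\<close>, the value \<open>f x\<close> is taken by \<open>g\<close> after \<open>x\<close>, and \<open>g x\<close> is taken by
  \<open>f\<close> after \<open>x\<close>. So each of the two values would exceed the other.
\<close>
lemma increasing_maps_eq:
  assumes r: "linear_order_on S r" and A: "finite A" "A \<subseteq> S"
    and f: "\<And>x y. \<lbrakk>x \<in> A; y \<in> A; (x, y) \<in> r - Id\<rbrakk> \<Longrightarrow> (f x, f y) \<in> r - Id"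
    and g: "\<And>x y. \<lbrakk>x \<in> A; y \<in> A; (x, y) \<in> r - Id\<rbrakk> \<Longrightarrow> (g x, g y) \<in> r - Id"
    and image: "f ` A = g ` A" and x: "x \<in> A"
  shows "f x = g x"
proof -
  have tot: "(x, y) \<in> r - Id \<or> (y, x) \<in> r - Id \<or> x = y" if "x \<in> S" "y \<in> S" for x y
    using r that by (auto simp: linear_order_on_def total_on_def)
  have anti: "\<not> ((x, y) \<in> r - Id \<and> (y, x) \<in> r)" for x y
    using r by (auto simp: linear_order_on_def partial_order_on_def antisym_def)
  let ?R = "{(x, y). x \<in> A \<and> y \<in> A \<and> (x, y) \<in> r - Id}"
  have "wf ?R"
  proof (rule finite_acyclic_wf)
    show "finite ?R"
      by (rule finite_subset[of _ "A \<times> A"]) (use A in auto)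
    have "trans (r - Id)"
      using r by (auto simp: linear_order_on_def partial_order_on_def preorder_on_def intro: trans_diff_Id)
    then have "trans ?R"
      unfolding trans_def by blast
    then show "acyclic ?R"
      by (auto simp: acyclic_def trancl_id)
  qed
  then show ?thesis
    using x
  proof (induction x rule: wf_induct_rule)
    case (less x)
    have IH: "f y = g y" if "y \<in> A" "(y, x) \<in> r - Id" for y
      using less that by auto
    obtain y where y: "y \<in> A" "f x = g y"
      using less(2) image by blast
    obtain z where z: "z \<in> A" "g x = f z"
      using less(2) image by blast
    have "\<not> (y, x) \<in> r - Id"
      using IH[of y] f[of y x] y less(2) by fastforce
    moreover have "\<not> (z, x) \<in> r - Id"
      using IH[of z] g[of z x] z less(2) by fastforce
    ultimately consider "x = y" | "x = z" | "(x, y) \<in> r - Id" "(x, z) \<in> r - Id"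
      using tot[of x y] tot[of x z] y z less(2) A(2) by blast
    then show ?case
    proof cases
      case 3
      then have "(f x, f z) \<in> r - Id" "(g x, g y) \<in> r - Id"
        using f g y z less(2) by blast+
      then show ?thesis
        using y z anti[of "f x" "g x"] by auto
    qed (use y z in auto)
  qed
qed

locale homogeneous_action =
  fixes S :: "'s set" and r :: "'s rel" and G :: "('g, 'c) monoid_scheme" and \<rho> :: "'g \<Rightarrow> 's \<Rightarrow> 's"
  assumes linear: "linear_order_on S r"
    and no_max: "x \<in> S \<Longrightarrow> \<exists>y\<in>S. (x, y) \<in> r - Id"
    and action: "\<rho> \<in> hom G (order_aut_group S r)"
    and hom_sets: "highly_homogeneous G S \<rho>"
begin

lemma order_aut_group_simps:
  "carrier (order_aut_group S r) = Bij S \<inter> order_isos r S S"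
  "monoid.mult (order_aut_group S r) = monoid.mult (BijGroup S)"
  by (simp_all add: order_aut_group_def)

lemma action_BijGroup: "\<rho> \<in> hom G (BijGroup S)"
  using action by (auto simp: hom_def order_aut_group_def BijGroup_def Pi_iff)

lemma aut_increasing:
  assumes "f \<in> carrier (order_aut_group S r)" and "x \<in> S" and "y \<in> S" and "(x, y) \<in> r - Id"
  shows "(f x, f y) \<in> r - Id"
  using assms by (auto simp: order_aut_group_simps order_isos_def Bij_def bij_betw_def inj_on_def)

lemma rho_aut: "g \<in> carrier G \<Longrightarrow> \<rho> g \<in> carrier (order_aut_group S r)"
  using action by (auto simp: hom_def)

lemma rho_increasing:
  "\<lbrakk>g \<in> carrier G; x \<in> S; y \<in> S; (x, y) \<in> r - Id\<rbrakk> \<Longrightarrow> (\<rho> g x, \<rho> g y) \<in> r - Id"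
  by (rule aut_increasing[OF rho_aut])

lemma rho_rigid:
  assumes "finite A" "A \<subseteq> S" "g \<in> carrier G" "h \<in> carrier G" "\<rho> g ` A = \<rho> h ` A" "x \<in> A"
  shows "\<rho> g x = \<rho> h x"
  by (rule increasing_maps_eq[OF linear assms(1,2) _ _ assms(5,6)])
    (use assms rho_increasing in blast)+

text \<open>High homogeneity moves the set, and the order leaves only one way of doing so.\<close>
lemma extend_increasing:
  assumes A: "finite A" "A \<subseteq> S" and f: "f ` A \<subseteq> S"
    and inc: "\<And>x y. \<lbrakk>x \<in> A; y \<in> A; (x, y) \<in> r - Id\<rbrakk> \<Longrightarrow> (f x, f y) \<in> r - Id"
  shows "\<exists>g\<in>carrier G. \<forall>x\<in>A. \<rho> g x = f x"
proof -
  have "inj_on f A"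
  proof (rule inj_onI, rule ccontr)
    fix x y assume xy: "x \<in> A" "y \<in> A" "f x = f y" "x \<noteq> y"
    then have "(x, y) \<in> r - Id \<or> (y, x) \<in> r - Id"
      using linear A by (auto simp: linear_order_on_def total_on_def)
    then show False
      using inc xy by fastforce
  qed
  then have "A \<in> nsets S (card A)" "f ` A \<in> nsets S (card A)"
    using A f by (auto simp: nsets_def card_image)
  then obtain g where g: "g \<in> carrier G" "\<rho> g ` A = f ` A"
    using hom_sets unfolding highly_homogeneous_def by blast
  have "\<rho> g x = f x" if "x \<in> A" for x
    by (rule increasing_maps_eq[OF linear A _ inc g(2) that])
      (use A g rho_increasing in blast)+
  with g show ?thesis
    by blast
qed

lemma dense_in_aut:
  assumes "f \<in> carrier (order_aut_group S r)" and "finite A" and "A \<subseteq> S"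
  shows "\<exists>g\<in>carrier G. \<forall>x\<in>A. \<rho> g x = f x"
proof (rule extend_increasing[OF assms(2,3)])
  show "f ` A \<subseteq> S"
    using assms by (auto simp: order_aut_group_simps Bij_def bij_betw_def)
qed (use assms aut_increasing in blast)

lemma increasing_sequence:
  assumes "S \<noteq> {}"
  shows "\<exists>\<iota> :: nat \<Rightarrow> 's. range \<iota> \<subseteq> S \<and> (\<forall>m n. m < n \<longrightarrow> (\<iota> m, \<iota> n) \<in> r - Id)"
proof -
  have "\<exists>\<iota>. \<forall>n. \<iota> n \<in> S \<and> (\<iota> n, \<iota> (Suc n)) \<in> r - Id"
    by (rule dependent_nat_choice) (use assms no_max in auto)
  then obtain \<iota> :: "nat \<Rightarrow> 's" where \<iota>: "\<And>n. \<iota> n \<in> S" "\<And>n. (\<iota> n, \<iota> (Suc n)) \<in> r - Id"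
    by blast
  have "trans (r - Id)"
    using linear by (auto simp: linear_order_on_def partial_order_on_def preorder_on_def intro: trans_diff_Id)
  then have "(\<iota> m, \<iota> n) \<in> r - Id" if "m < n" for m n
    using that \<iota>(2)
  proof (induction n)
    case (Suc n)
    then show ?case
      by (metis less_Suc_eq transD)
  qed simp
  with \<iota> show ?thesis
    by blast
qed

lemma group_order_aut: "group (order_aut_group S r)"
proof -
  have "subgroup (Bij S \<inter> order_isos r S S) (BijGroup S)"
  proof (rule group.subgroupI[OF group_BijGroup])
    show "Bij S \<inter> order_isos r S S \<subseteq> carrier (BijGroup S)"
      by (auto simp: BijGroup_def)
    have "(\<lambda>x\<in>S. x) \<in> Bij S \<inter> order_isos r S S"
      using id_Bij[of S] by (auto simp: order_isos_def bij_betw_def inj_on_def)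
    then show "Bij S \<inter> order_isos r S S \<noteq> {}"
      by blast
  next
    fix f assume f: "f \<in> Bij S \<inter> order_isos r S S"
    have inv: "inv\<^bsub>BijGroup S\<^esub> f = restrict (inv_into S f) S"
      using f by (intro inv_BijGroup) auto
    have "(inv_into S f x, inv_into S f y) \<in> r \<longleftrightarrow> (x, y) \<in> r" if "x \<in> S" "y \<in> S" for x y
    proof -
      have "inv_into S f x \<in> S" "inv_into S f y \<in> S" "f (inv_into S f x) = x" "f (inv_into S f y) = y"
        using f that by (auto simp: Bij_def bij_betw_def inv_into_into f_inv_into_f)
      then show ?thesis
        using f unfolding order_isos_def by (metis (mono_tags, lifting) IntD2 mem_Collect_eq)
    qed
    moreover have "restrict (inv_into S f) S \<in> Bij S"
      using f restrict_inv_into_Bij by auto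
    ultimately show "inv\<^bsub>BijGroup S\<^esub> f \<in> Bij S \<inter> order_isos r S S"
      unfolding inv by (auto simp: order_isos_def Bij_def)
  next
    fix f g assume fg: "f \<in> Bij S \<inter> order_isos r S S" "g \<in> Bij S \<inter> order_isos r S S"
    then have "compose S f g \<in> Bij S"
      by (intro compose_Bij) auto
    moreover have "(x, y) \<in> r \<longleftrightarrow> (f (g x), f (g y)) \<in> r" if "x \<in> S" "y \<in> S" for x y
    proof -
      have "g x \<in> S" "g y \<in> S"
        using fg that by (auto simp: Bij_def bij_betw_def)
      then show ?thesis
        using fg that by (auto simp: order_isos_def)
    qed
    ultimately show "f \<otimes>\<^bsub>BijGroup S\<^esub> g \<in> Bij S \<inter> order_isos r S S"
      using fg by (auto simp: BijGroup_def order_isos_def Bij_def compose_def)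
  qed
  then show ?thesis
    unfolding order_aut_group_def by (intro subgroup.subgroup_is_group group_BijGroup)
qed

end


section \<open>Finitely generated discrete modules are Noetherian\<close>

context poly_action_module
begin

lemma submoduleI':
  assumes "H \<subseteq> carrier V" and "\<zero>\<^bsub>V\<^esub> \<in> H"
    and "\<And>v w. \<lbrakk>v \<in> H; w \<in> H\<rbrakk> \<Longrightarrow> v \<oplus>\<^bsub>V\<^esub> w \<in> H"
    and smult: "\<And>f v. \<lbrakk>f \<in> carrier KSG; v \<in> H\<rbrakk> \<Longrightarrow> f \<odot>\<^bsub>V\<^esub> v \<in> H"
  shows "submodule H KSG V"
proof (intro submodule.intro submodule_axioms.intro)
  show "subgroup H (add_monoid V)"
  proof (rule V.add.subgroupI)
    show "\<ominus>\<^bsub>V\<^esub> v \<in> H" if v: "v \<in> H" for v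
    proof -
      have vc: "v \<in> carrier V"
        using v assms(1) by blast
      have m: "\<ominus>\<^bsub>KSG\<^esub> \<one>\<^bsub>KSG\<^esub> \<in> carrier KSG"
        by simp
      have z: "\<zero>\<^bsub>KSG\<^esub> \<odot>\<^bsub>V\<^esub> v = \<zero>\<^bsub>V\<^esub>"
        by (metis KSGr.r_zero KSGr.zero_closed V.add.l_cancel_one V.smult_closed V.smult_l_distr vc)
      have "(\<ominus>\<^bsub>KSG\<^esub> \<one>\<^bsub>KSG\<^esub>) \<odot>\<^bsub>V\<^esub> v \<oplus>\<^bsub>V\<^esub> v = (\<ominus>\<^bsub>KSG\<^esub> \<one>\<^bsub>KSG\<^esub> \<oplus>\<^bsub>KSG\<^esub> \<one>\<^bsub>KSG\<^esub>) \<odot>\<^bsub>V\<^esub> v"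
        using V.smult_l_distr[OF m KSGr.one_closed vc] vc by simp
      also have "\<dots> = \<zero>\<^bsub>V\<^esub>"
        using z by (simp add: KSGr.l_neg)
      finally have "\<ominus>\<^bsub>V\<^esub> v = (\<ominus>\<^bsub>KSG\<^esub> \<one>\<^bsub>KSG\<^esub>) \<odot>\<^bsub>V\<^esub> v"
        using vc m by (intro V.minus_equality) auto
      then show ?thesis
        using smult[OF m v] by simp
    qed
  qed (use assms in auto)
qed (rule smult)

lemma submoduleD:
  assumes "submodule H KSG V"
  shows "H \<subseteq> carrier V" and "\<zero>\<^bsub>V\<^esub> \<in> H"
    and "\<lbrakk>v \<in> H; w \<in> H\<rbrakk> \<Longrightarrow> v \<oplus>\<^bsub>V\<^esub> w \<in> H"
    and "\<lbrakk>f \<in> carrier KSG; v \<in> H\<rbrakk> \<Longrightarrow> f \<odot>\<^bsub>V\<^esub> v \<in> H"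
proof -
  interpret H: submodule H KSG V by fact
  show "H \<subseteq> carrier V" "\<zero>\<^bsub>V\<^esub> \<in> H" "\<lbrakk>v \<in> H; w \<in> H\<rbrakk> \<Longrightarrow> v \<oplus>\<^bsub>V\<^esub> w \<in> H"
    "\<lbrakk>f \<in> carrier KSG; v \<in> H\<rbrakk> \<Longrightarrow> f \<odot>\<^bsub>V\<^esub> v \<in> H"
    using H.subset H.one_closed H.m_closed H.smult_closed by auto
qed

abbreviation gen where "gen \<equiv> generated_submodule KSG V"

lemma gen_minimal: "\<lbrakk>submodule H KSG V; B \<subseteq> H\<rbrakk> \<Longrightarrow> gen B \<subseteq> H"
  unfolding generated_submodule_def by blast

lemma gen_superset: "B \<subseteq> gen B"
  unfolding generated_submodule_def by blast

lemma submodule_gen: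
  assumes "B \<subseteq> carrier V"
  shows "submodule (gen B) KSG V"
proof (rule submoduleI')
  have "submodule (carrier V) KSG V"
    by (rule submoduleI') auto
  then show "gen B \<subseteq> carrier V"
    using assms by (rule gen_minimal)
  show "\<zero>\<^bsub>V\<^esub> \<in> gen B"
    unfolding generated_submodule_def by (auto dest: submoduleD(2))
  show "v \<oplus>\<^bsub>V\<^esub> w \<in> gen B" if "v \<in> gen B" "w \<in> gen B" for v w
    using that unfolding generated_submodule_def by (auto dest: submoduleD(3))
  show "f \<odot>\<^bsub>V\<^esub> v \<in> gen B" if "f \<in> carrier KSG" "v \<in> gen B" for f v
    using that unfolding generated_submodule_def by (auto dest: submoduleD(4))
qed

lemma submodule_mv:
  assumes "submodule H KSG V" "g \<in> carrier G" "v \<in> H"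
  shows "mv g v \<in> H"
  using submoduleD(4)[OF assms(1) _ assms(3)] assms(2) by (simp add: mv_eq KSG.single_closed)

lemma submodule_sc:
  assumes "submodule H KSG V" "a \<in> carrier KS" "v \<in> H"
  shows "sc a v \<in> H"
  using submoduleD(4)[OF assms(1) _ assms(3)] assms(2) by (simp add: poly_scale_def KSG.single_closed)

lemma mv_zero: "g \<in> carrier G \<Longrightarrow> mv g \<zero>\<^bsub>V\<^esub> = \<zero>\<^bsub>V\<^esub>"
  by (metis V.add.l_cancel_one V.r_zero V.zero_closed mv_add mv_closed)

lemma sc_zero_right: "a \<in> carrier KS \<Longrightarrow> sc a \<zero>\<^bsub>V\<^esub> = \<zero>\<^bsub>V\<^esub>"
  by (metis V.add.l_cancel_one V.r_zero V.zero_closed sc_add_right sc_closed)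

abbreviation mono :: "'s multiset \<Rightarrow> 's multiset \<Rightarrow> 'a" where
  "mono m \<equiv> single k \<one>\<^bsub>k\<^esub> m"

abbreviation cs :: "'a \<Rightarrow> 'v \<Rightarrow> 'v" where
  "cs c v \<equiv> sc (single k c {#}) v"

lemma monomials_simps:
  "m \<in> carrier (monomials S) \<longleftrightarrow> set_mset m \<subseteq> S"
  "m \<otimes>\<^bsub>monomials S\<^esub> m' = m + m'"
  "\<one>\<^bsub>monomials S\<^esub> = {#}"
  by (simp_all add: monomials_def)

lemma mono_closed [simp]: "\<lbrakk>c \<in> carrier k; set_mset m \<subseteq> S\<rbrakk> \<Longrightarrow> single k c m \<in> carrier KS"
  by (simp add: KS.single_closed monomials_simps)

lemma sc_split:
  assumes "c \<in> carrier k" "set_mset m \<subseteq> S" "v \<in> carrier V"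
  shows "sc (single k c m) v = cs c (sc (mono m) v)"
    and "sc (single k c m) v = sc (mono m) (cs c v)"
  using assms
  by (simp_all add: sc_mult[symmetric] KS.mult_single monomials_simps)

lemma sc_mono_mono:
  assumes "set_mset m \<subseteq> S" "set_mset m' \<subseteq> S" "v \<in> carrier V"
  shows "sc (mono m) (sc (mono m') v) = sc (mono (m + m')) v"
  using assms by (simp add: sc_mult[symmetric] KS.mult_single monomials_simps)

lemma cs_mono_swap:
  assumes "c \<in> carrier k" "set_mset m \<subseteq> S" "v \<in> carrier V"
  shows "sc (mono m) (cs c v) = cs c (sc (mono m) v)"
  using sc_split[OF assms] by simp

lemma mv_sc_single:
  assumes "g \<in> carrier G" "c \<in> carrier k" "set_mset m \<subseteq> S" "v \<in> carrier V"
  shows "mv g (sc (single k c m) v) = sc (single k c (image_mset (\<rho> g) m)) (mv g v)"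
  using assms by (simp add: mv_sc poly_act_single rho_Bij monomials_simps)

end

text \<open>
  The generators \<open>v\<^sub>i\<close>, their supports, and an increasing sequence of positions. If \<open>S\<close> is
  empty there are no positions, and \<open>D\<close> is empty.
\<close>
locale generated_module = discrete_poly_module k S G \<rho> V + noetherian: noetherian_ring k
    + homogeneous_action S r G \<rho>
  for k :: "('a, 'b) ring_scheme" (structure) and S :: "'s set"
    and G :: "('g, 'c) monoid_scheme" and \<rho> :: "'g \<Rightarrow> 's \<Rightarrow> 's"
    and V :: "('g \<Rightarrow> 's multiset \<Rightarrow> 'a, 'v) module" and r :: "'s rel" +
  fixes n :: nat and v :: "nat \<Rightarrow> 'v" and Ts :: "nat \<Rightarrow> 's set" and \<iota> :: "nat \<Rightarrow> 's" and D :: "nat set"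
  assumes v_closed: "i < n \<Longrightarrow> v i \<in> carrier V"
    and v_supp: "i < n \<Longrightarrow> supp (Ts i) (v i)"
    and generating: "gen (v ` {..<n}) = carrier V"
    and positions: "D = {} \<and> S = {} \<or> D = UNIV"
    and iota_closed: "p \<in> D \<Longrightarrow> \<iota> p \<in> S"
    and iota_increasing: "\<lbrakk>p \<in> D; q \<in> D; p < q\<rbrakk> \<Longrightarrow> (\<iota> p, \<iota> q) \<in> r - Id"
begin

lemma iota_inj: "inj_on \<iota> D"
proof (rule inj_onI, rule ccontr)
  fix p q assume "p \<in> D" "q \<in> D" "\<iota> p = \<iota> q" "p \<noteq> q"
  then show False
    using iota_increasing[of p q] iota_increasing[of q p] by (cases "p < q") auto
qed

lemma positions_closed: "p \<in> D \<Longrightarrow> q \<in> D"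
  using positions by auto

lemma subset_positions: "set_mset a \<subseteq> D \<Longrightarrow> set_mset (image_mset \<phi> a) \<subseteq> D"
  using positions by auto

lemma iota_mset: "set_mset a \<subseteq> D \<Longrightarrow> set_mset (image_mset \<iota> a) \<subseteq> S"
  using iota_closed by auto

text \<open>
  Strictly increasing maps of the positions need not be permutations, but on finitely many positions
  they are induced by group elements.
\<close>
lemma shift_positions:
  assumes \<phi>: "strict_mono \<phi>" and U: "finite U" "U \<subseteq> D"
  shows "\<exists>h\<in>carrier G. \<forall>p\<in>U. \<rho> h (\<iota> p) = \<iota> (\<phi> p)"
proof -
  let ?f = "\<lambda>x. \<iota> (\<phi> (inv_into D \<iota> x))"
  have f: "?f (\<iota> p) = \<iota> (\<phi> p)" if "p \<in> U" for p
    using that U iota_inj by (simp add: inv_into_f_f subset_iff)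
  have "\<exists>h\<in>carrier G. \<forall>x\<in>\<iota> ` U. \<rho> h x = ?f x"
  proof (rule extend_increasing)
    show "finite (\<iota> ` U)" "\<iota> ` U \<subseteq> S"
      using U iota_closed by auto
    show "?f ` \<iota> ` U \<subseteq> S"
      using f U positions_closed iota_closed by auto
    fix x y assume "x \<in> \<iota> ` U" "y \<in> \<iota> ` U" and xy: "(x, y) \<in> r - Id"
    then obtain p q where pq: "p \<in> U" "q \<in> U" "x = \<iota> p" "y = \<iota> q"
      by blast
    have "\<not> q \<le> p"
    proof
      assume "q \<le> p"
      then have "(y, x) \<in> r"
        using iota_increasing[of q p] pq U xy by (cases "q = p") auto
      then show False
        using xy linear by (auto simp: linear_order_on_def partial_order_on_def antisym_def)
    qed
    then have "\<phi> p < \<phi> q"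
      using \<phi> by (simp add: strict_mono_def)
    then show "(?f x, ?f y) \<in> r - Id"
      using iota_increasing[of "\<phi> p" "\<phi> q"] pq f positions_closed U by auto
  qed
  then show ?thesis
    using f by auto
qed

lemma move_into_positions:
  assumes U: "finite U" "U \<subseteq> S"
  shows "\<exists>h\<in>carrier G. \<rho> h ` U \<subseteq> \<iota> ` D"
proof (cases "D = {}")
  case True
  then have "U = {}"
    using U positions by auto
  then show ?thesis
    using G.one_closed by blast
next
  case False
  then have D: "D = UNIV"
    using positions by auto
  then have "card (\<iota> ` {..<card U}) = card U"
    using iota_inj by (subst card_image) (auto intro: inj_on_subset)
  then have "\<iota> ` {..<card U} \<in> nsets S (card U)" "U \<in> nsets S (card U)"
    using U D iota_closed by (auto simp: nsets_def)
  then obtain h where "h \<in> carrier G" "\<rho> h ` U = \<iota> ` {..<card U}"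
    using hom_sets unfolding highly_homogeneous_def by blast
  then show ?thesis
    unfolding D by (metis image_mono top_greatest)
qed

definition valid :: "mono_term set" where
  "valid = {(i, a, A). i < n \<and> size A = card (Ts i) \<and> set_mset a \<subseteq> D \<and> set_mset A \<subseteq> D
              \<and> mset_set (set_mset A) = A}"

text \<open>
  The element \<open>x\<^sup>a g v\<^sub>i\<close>, where \<open>g\<close> moves the support of \<open>v\<^sub>i\<close> onto the positions in \<open>A\<close>.
\<close>
fun el :: "mono_term \<Rightarrow> 'v" where
  "el (i, a, A) = sc (mono (image_mset \<iota> a))
     (mv (SOME g. g \<in> carrier G \<and> \<rho> g ` Ts i = \<iota> ` set_mset A) (v i))"

text \<open>
  Since \<open>\<rho> g\<close> is increasing, its values on the support are determined by the image of the support,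
  and they determine \<open>g v\<^sub>i\<close>.
\<close>
lemma el_eq:
  assumes i: "i < n" and g: "g \<in> carrier G" "\<rho> g ` Ts i = \<iota> ` set_mset A"
  shows "el (i, a, A) = sc (mono (image_mset \<iota> a)) (mv g (v i))"
proof -
  define g' where "g' = (SOME g. g \<in> carrier G \<and> \<rho> g ` Ts i = \<iota> ` set_mset A)"
  have g': "g' \<in> carrier G \<and> \<rho> g' ` Ts i = \<iota> ` set_mset A"
    unfolding g'_def by (rule someI[of _ g]) (use g in simp)
  have "finite (Ts i)" "Ts i \<subseteq> S"
    using v_supp[OF i] by (auto simp: supports_def)
  then have "mv g' (v i) = mv g (v i)"
    using g g' rho_rigid[of "Ts i" g' g] by (intro supp_agree[OF v_supp[OF i] v_closed[OF i]]) auto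
  then show ?thesis
    by (simp add: g'_def[symmetric])
qed

lemma obtain_mover:
  assumes "(i, a, A) \<in> valid"
  obtains g where "g \<in> carrier G" "\<rho> g ` Ts i = \<iota> ` set_mset A"
proof -
  have i: "i < n" and A: "size A = card (Ts i)" "set_mset A \<subseteq> D" "mset_set (set_mset A) = A"
    using assms by (auto simp: valid_def)
  have "card (\<iota> ` set_mset A) = card (set_mset A)"
    using A iota_inj by (intro card_image) (auto intro: inj_on_subset)
  also have "\<dots> = card (Ts i)"
    using A by (metis size_mset_set)
  finally have "\<iota> ` set_mset A \<in> nsets S (card (Ts i))" "Ts i \<in> nsets S (card (Ts i))"
    using A iota_closed v_supp[OF i] by (auto simp: nsets_def supports_def)
  then show thesis
    using hom_sets that unfolding highly_homogeneous_def by blast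
qed

lemma el_closed: "t \<in> valid \<Longrightarrow> el t \<in> carrier V"
proof (cases t)
  case (fields i a A)
  assume t: "t \<in> valid"
  then obtain g where g: "g \<in> carrier G" "\<rho> g ` Ts i = \<iota> ` set_mset A"
    using obtain_mover[of i a A] fields by blast
  have "i < n" "set_mset (image_mset \<iota> a) \<subseteq> S"
    using t fields iota_mset by (auto simp: valid_def)
  then show ?thesis
    using fields g el_eq[of i g A a] v_closed by (simp del: el.simps set_image_mset)
qed

sublocale LT: leading_terms k V cs el valid
proof (intro leading_terms.intro leading_terms_axioms.intro)
  show "cs (c \<oplus> d) w = cs c w \<oplus>\<^bsub>V\<^esub> cs d w"
    if "c \<in> carrier k" "d \<in> carrier k" "w \<in> carrier V" for c d w
    using that by (simp add: KS.single_add sc_add_left)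
  show "cs (c \<otimes> d) w = cs c (cs d w)"
    if "c \<in> carrier k" "d \<in> carrier k" "w \<in> carrier V" for c d w
    using that by (simp add: sc_mult[symmetric] KS.mult_single monomials_simps)
  show "cs \<one> w = w" if "w \<in> carrier V" for w
    using that sc_one by (simp add: KS.one_eq monomials_simps)
qed (auto intro: el_closed simp: sc_add_right cring_axioms noetherian.noetherian_ring_axioms
    V.abelian_group_axioms)

lemma el_move:
  assumes t: "(i, a, A) \<in> valid" and m: "set_mset m \<subseteq> D" and \<phi>: "strict_mono \<phi>"
    and h: "h \<in> carrier G" and shift: "\<And>p. p \<in># a + A \<Longrightarrow> \<rho> h (\<iota> p) = \<iota> (\<phi> p)"
  shows "move m \<phi> (i, a, A) \<in> valid"
    and "sc (mono (image_mset \<iota> m)) (mv h (el (i, a, A))) = el (move m \<phi> (i, a, A))"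
proof -
  have i: "i < n" and a: "set_mset a \<subseteq> D" and A: "set_mset A \<subseteq> D" "mset_set (set_mset A) = A"
    "size A = card (Ts i)"
    using t by (auto simp: valid_def)
  have "inj_on \<phi> (set_mset A)"
    using \<phi> by (intro strict_mono_imp_inj_on[THEN inj_on_subset]) auto
  then have "mset_set (\<phi> ` set_mset A) = image_mset \<phi> A"
    using A(2) by (simp add: image_mset_mset_set[symmetric])
  then show "move m \<phi> (i, a, A) \<in> valid"
    using i a A m subset_positions[of a \<phi>] subset_positions[of A \<phi>] by (simp add: move_def valid_def)
  obtain g where g: "g \<in> carrier G" "\<rho> g ` Ts i = \<iota> ` set_mset A"
    using obtain_mover[OF t] .
  have Ts: "Ts i \<subseteq> S"
    using v_supp[OF i] by (simp add: supports_def)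
  have "\<rho> (h \<otimes>\<^bsub>G\<^esub> g) ` Ts i = (\<lambda>x. \<rho> h (\<rho> g x)) ` Ts i"
    using h g(1) Ts by (intro image_cong refl rho_mult_app) auto
  also have "\<dots> = \<rho> h ` \<rho> g ` Ts i"
    by (simp add: image_image)
  also have "\<dots> = \<iota> ` set_mset (image_mset \<phi> A)"
    using shift by (auto simp: g(2) image_image intro!: image_cong)
  finally have hg: "\<rho> (h \<otimes>\<^bsub>G\<^esub> g) ` Ts i = \<iota> ` set_mset (image_mset \<phi> A)" .
  have S: "set_mset (image_mset \<iota> a) \<subseteq> S" "set_mset (image_mset \<iota> m) \<subseteq> S"
    "set_mset (image_mset \<iota> (image_mset \<phi> a)) \<subseteq> S"
    by (rule iota_mset[OF a], rule iota_mset[OF m], rule iota_mset[OF subset_positions[OF a]])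
  have "image_mset (\<rho> h) (image_mset \<iota> a) = image_mset \<iota> (image_mset \<phi> a)"
    using shift by (auto simp: multiset.map_comp intro!: image_mset_cong)
  then have "mv h (el (i, a, A)) = sc (mono (image_mset \<iota> (image_mset \<phi> a))) (mv (h \<otimes>\<^bsub>G\<^esub> g) (v i))"
    unfolding el_eq[OF i g]
    using mv_sc_single[OF h one_closed S(1), of "mv g (v i)"] g h v_closed[OF i] by (simp add: mv_mult)
  then show "sc (mono (image_mset \<iota> m)) (mv h (el (i, a, A))) = el (move m \<phi> (i, a, A))"
    using sc_mono_mono[OF S(2,3)] el_eq[OF i _ hg] g h v_closed[OF i] by (simp add: move_def del: el.simps)
qed

text \<open>
  The group element realising \<open>\<phi>\<close> may be chosen only when the positions in a representation of \<open>u\<close>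
  are known; \<open>U\<close> collects them.
\<close>
lemma below_move:
  assumes "u \<in> LT.below t"
  shows "\<exists>U. finite U \<and> U \<subseteq> D \<and> (\<forall>m \<phi> h. set_mset m \<subseteq> D \<longrightarrow> strict_mono \<phi> \<longrightarrow> h \<in> carrier G \<longrightarrow>
           (\<forall>p\<in>U. \<rho> h (\<iota> p) = \<iota> (\<phi> p)) \<longrightarrow> sc (mono (image_mset \<iota> m)) (mv h u) \<in> LT.below (move m \<phi> t))"
  using assms
proof (induction rule: LT.below.induct)
  case below_zero
  show ?case
    by (intro exI[of _ "{}"])
      (simp add: mv_zero sc_zero_right iota_mset LT.below_zero del: set_image_mset)
next
  case (below_term t' c u)
  then obtain U where U: "finite U" "U \<subseteq> D" "\<And>m \<phi> h. \<lbrakk>set_mset m \<subseteq> D; strict_mono \<phi>; h \<in> carrier G;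
      \<forall>p\<in>U. \<rho> h (\<iota> p) = \<iota> (\<phi> p)\<rbrakk> \<Longrightarrow> sc (mono (image_mset \<iota> m)) (mv h u) \<in> LT.below (move m \<phi> t)"
    by blast
  obtain i a A where t': "t' = (i, a, A)"
    by (cases t')
  have aA: "set_mset (a + A) \<subseteq> D"
    using below_term(1) t' by (auto simp: valid_def)
  show ?case
  proof (intro exI[of _ "U \<union> set_mset (a + A)"] conjI allI impI)
    fix m \<phi> h
    assume m: "set_mset m \<subseteq> D" and \<phi>: "strict_mono \<phi>" and h: "h \<in> carrier G"
      and shift: "\<forall>p\<in>U \<union> set_mset (a + A). \<rho> h (\<iota> p) = \<iota> (\<phi> p)"
    have cl: "el t' \<in> carrier V" "u \<in> carrier V" "mono (image_mset \<iota> m) \<in> carrier KS"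
      using below_term el_closed LT.below_closed iota_mset[OF m] by auto
    have el: "move m \<phi> t' \<in> valid" "sc (mono (image_mset \<iota> m)) (mv h (el t')) = el (move m \<phi> t')"
      using el_move[of i a A m \<phi> h] below_term(1) m \<phi> h shift t' by auto
    have "sc (mono (image_mset \<iota> m)) (mv h (cs c (el t') \<oplus>\<^bsub>V\<^esub> u))
        = cs c (el (move m \<phi> t')) \<oplus>\<^bsub>V\<^esub> sc (mono (image_mset \<iota> m)) (mv h u)"
      using cl below_term(3) h el(2) iota_mset[OF m]
      by (simp add: mv_add mv_sc_single sc_add_right cs_mono_swap del: set_image_mset)
    moreover have "sc (mono (image_mset \<iota> m)) (mv h u) \<in> LT.below (move m \<phi> t)"
      using U(3)[OF m \<phi> h] shift by simp
    ultimately show "sc (mono (image_mset \<iota> m)) (mv h (cs c (el t') \<oplus>\<^bsub>V\<^esub> u)) \<in> LT.below (move m \<phi> t)"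
      using LT.below_term[OF el(1) move_strict_mono[OF \<phi> below_term(2)] below_term(3)] by simp
  qed (use U aA in auto)
qed

lemma transport_leading_term:
  assumes H: "submodule H KSG V" and w: "w \<in> H" and lead: "LT.has_lead w t c"
    and m: "set_mset m \<subseteq> D" and \<phi>: "strict_mono \<phi>"
  shows "\<exists>w'\<in>H. LT.has_lead w' (move m \<phi> t) c"
proof -
  obtain u where t: "t \<in> valid" "c \<in> carrier k" and u: "u \<in> LT.below t" "w = cs c (el t) \<oplus>\<^bsub>V\<^esub> u"
    using lead by (auto simp: LT.has_lead_def)
  obtain i a A where t': "t = (i, a, A)"
    by (cases t)
  have aA: "set_mset (a + A) \<subseteq> D"
    using t(1) t' by (auto simp: valid_def)
  obtain U where U: "finite U" "U \<subseteq> D" "\<And>m \<phi> h. \<lbrakk>set_mset m \<subseteq> D; strict_mono \<phi>; h \<in> carrier G;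
      \<forall>p\<in>U. \<rho> h (\<iota> p) = \<iota> (\<phi> p)\<rbrakk> \<Longrightarrow> sc (mono (image_mset \<iota> m)) (mv h u) \<in> LT.below (move m \<phi> t)"
    using below_move[OF u(1)] by blast
  have "finite (U \<union> set_mset (a + A))" "U \<union> set_mset (a + A) \<subseteq> D"
    using U aA by auto
  from shift_positions[OF \<phi> this] obtain h where h: "h \<in> carrier G"
    and shift: "\<forall>p\<in>U \<union> set_mset (a + A). \<rho> h (\<iota> p) = \<iota> (\<phi> p)"
    by blast
  have cl: "el t \<in> carrier V" "u \<in> carrier V" "mono (image_mset \<iota> m) \<in> carrier KS"
    using t u el_closed LT.below_closed iota_mset[OF m] by auto
  have el: "move m \<phi> t \<in> valid" "sc (mono (image_mset \<iota> m)) (mv h (el t)) = el (move m \<phi> t)"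
    using el_move[of i a A m \<phi> h] t(1) m \<phi> h shift t' by auto
  let ?w = "sc (mono (image_mset \<iota> m)) (mv h w)"
  have "?w = cs c (el (move m \<phi> t)) \<oplus>\<^bsub>V\<^esub> sc (mono (image_mset \<iota> m)) (mv h u)"
    unfolding u(2) using cl t(2) h el(2) iota_mset[OF m]
    by (simp add: mv_add mv_sc_single sc_add_right cs_mono_swap del: set_image_mset)
  moreover have "sc (mono (image_mset \<iota> m)) (mv h u) \<in> LT.below (move m \<phi> t)"
    using U(3)[OF m \<phi> h] shift by simp
  ultimately have "LT.has_lead ?w (move m \<phi> t) c"
    using el(1) t(2) unfolding LT.has_lead_def by blast
  moreover have "?w \<in> H"
    using H h w cl by (intro submodule_sc submodule_mv)
  ultimately show ?thesis
    by blast
qed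

text \<open>
  As there is no greatest term, this union is the span of all of them.
\<close>
definition spanned :: "'v set" where
  "spanned = (\<Union>t. LT.below t)"

lemma spanned_add: "\<lbrakk>u \<in> spanned; w \<in> spanned\<rbrakk> \<Longrightarrow> u \<oplus>\<^bsub>V\<^esub> w \<in> spanned"
proof -
  assume "u \<in> spanned" "w \<in> spanned"
  then obtain t t' where "u \<in> LT.below t" "w \<in> LT.below t'"
    by (auto simp: spanned_def)
  then have "u \<in> LT.below (max t t')" "w \<in> LT.below (max t t')"
    using LT.below_mono by auto
  then show ?thesis
    unfolding spanned_def using LT.below_add by blast
qed

lemma spanned_scale: "\<lbrakk>u \<in> spanned; c \<in> carrier k\<rbrakk> \<Longrightarrow> cs c u \<in> spanned"
  unfolding spanned_def using LT.below_scale by blast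

text \<open>
  Multiplication by a monomial is the operation \<open>move\<close> for the identity map of positions.
\<close>
lemma spanned_mono:
  assumes "u \<in> spanned" and m: "set_mset m \<subseteq> D"
  shows "sc (mono (image_mset \<iota> m)) u \<in> spanned"
proof -
  obtain t where t: "u \<in> LT.below t"
    using assms(1) by (auto simp: spanned_def)
  obtain U where U: "U \<subseteq> D" "\<And>m \<phi> h. \<lbrakk>set_mset m \<subseteq> D; strict_mono \<phi>; h \<in> carrier G;
      \<forall>p\<in>U. \<rho> h (\<iota> p) = \<iota> (\<phi> p)\<rbrakk> \<Longrightarrow> sc (mono (image_mset \<iota> m)) (mv h u) \<in> LT.below (move m \<phi> t)"
    using below_move[OF t] by blast
  have "\<forall>p\<in>U. \<rho> \<one>\<^bsub>G\<^esub> (\<iota> p) = \<iota> p"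
    using U(1) iota_closed by (auto simp: rho_one_app)
  then have "sc (mono (image_mset \<iota> m)) (mv \<one>\<^bsub>G\<^esub> u) \<in> LT.below (move m (\<lambda>p. p) t)"
    using m by (intro U(2)) (auto simp: strict_mono_def)
  then show ?thesis
    unfolding spanned_def using LT.below_closed[OF t] by (auto simp only: mv_one)
qed

lemma spanned_el:
  assumes "t \<in> valid"
  shows "el t \<in> spanned"
proof -
  obtain i a A where t: "t = (i, a, A)"
    by (cases t)
  \<comment> \<open>any term greater than \<open>t\<close> would do\<close>
  have "cs \<one> (el t) \<in> LT.below (Suc i, a, A)"
    using assms by (intro LT.single_term_below) (auto simp: t less_prod_def)
  then show ?thesis
    using el_closed[OF assms] by (auto simp: spanned_def LT.sc_one)
qed

text \<open>
  The elements that get into the span of the terms once finitely many points of \<open>S\<close> have been moved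
  into the sequence. They form a submodule, which is how all of \<open>V\<close> is seen to be of this kind.
\<close>
definition eventually_spanned :: "'v set" where
  "eventually_spanned = {w \<in> carrier V. \<exists>U. finite U \<and> U \<subseteq> S \<and>
     (\<forall>h\<in>carrier G. \<rho> h ` U \<subseteq> \<iota> ` D \<longrightarrow> mv h w \<in> spanned)}"

lemma eventually_spannedI:
  assumes "w \<in> carrier V" "finite U" "U \<subseteq> S"
    and "\<And>h. \<lbrakk>h \<in> carrier G; \<rho> h ` U \<subseteq> \<iota> ` D\<rbrakk> \<Longrightarrow> mv h w \<in> spanned"
  shows "w \<in> eventually_spanned"
  using assms unfolding eventually_spanned_def by blast

lemma eventually_spannedE:
  assumes "w \<in> eventually_spanned"
  obtains U where "w \<in> carrier V" "finite U" "U \<subseteq> S"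
    "\<And>h. \<lbrakk>h \<in> carrier G; \<rho> h ` U \<subseteq> \<iota> ` D\<rbrakk> \<Longrightarrow> mv h w \<in> spanned"
  using assms unfolding eventually_spanned_def by blast

lemma eventually_spanned_add:
  assumes "u \<in> eventually_spanned" and "w \<in> eventually_spanned"
  shows "u \<oplus>\<^bsub>V\<^esub> w \<in> eventually_spanned"
proof -
  obtain U where U: "u \<in> carrier V" "finite U" "U \<subseteq> S"
    "\<And>h. \<lbrakk>h \<in> carrier G; \<rho> h ` U \<subseteq> \<iota> ` D\<rbrakk> \<Longrightarrow> mv h u \<in> spanned"
    using eventually_spannedE[OF assms(1)] by blast
  obtain W where W: "w \<in> carrier V" "finite W" "W \<subseteq> S"
    "\<And>h. \<lbrakk>h \<in> carrier G; \<rho> h ` W \<subseteq> \<iota> ` D\<rbrakk> \<Longrightarrow> mv h w \<in> spanned"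
    using eventually_spannedE[OF assms(2)] by blast
  show ?thesis
    by (rule eventually_spannedI[of _ "U \<union> W"])
      (use U W in \<open>auto simp: mv_add image_Un intro!: spanned_add\<close>)
qed

lemma eventually_spanned_mv:
  assumes "w \<in> eventually_spanned" and g: "g \<in> carrier G"
  shows "mv g w \<in> eventually_spanned"
proof -
  obtain U where U: "w \<in> carrier V" "finite U" "U \<subseteq> S"
    "\<And>h. \<lbrakk>h \<in> carrier G; \<rho> h ` U \<subseteq> \<iota> ` D\<rbrakk> \<Longrightarrow> mv h w \<in> spanned"
    using eventually_spannedE[OF assms(1)] by blast
  show ?thesis
  proof (rule eventually_spannedI[of _ "\<rho> g ` U"])
    show "\<rho> g ` U \<subseteq> S"
      using U g rho_closed by auto
    fix h assume h: "h \<in> carrier G" "\<rho> h ` \<rho> g ` U \<subseteq> \<iota> ` D"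
    have "\<rho> (h \<otimes>\<^bsub>G\<^esub> g) u = \<rho> h (\<rho> g u)" if "u \<in> U" for u
      using that g h U by (intro rho_mult_app) auto
    then have "\<rho> (h \<otimes>\<^bsub>G\<^esub> g) ` U \<subseteq> \<iota> ` D"
      using h(2) by auto
    then show "mv h (mv g w) \<in> spanned"
      using U(4)[of "h \<otimes>\<^bsub>G\<^esub> g"] U(1) g h by (simp add: mv_mult)
  qed (use U g in auto)
qed

lemma eventually_spanned_sc:
  assumes w: "w \<in> eventually_spanned" and p: "p \<in> carrier KS"
  shows "sc p w \<in> eventually_spanned"
  using p
proof (induction p rule: KS.single_induct)
  case (single c m)
  then have m: "set_mset m \<subseteq> S" and c: "c \<in> carrier k"
    by (simp_all add: monomials_simps)
  obtain U where U: "w \<in> carrier V" "finite U" "U \<subseteq> S"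
    "\<And>h. \<lbrakk>h \<in> carrier G; \<rho> h ` U \<subseteq> \<iota> ` D\<rbrakk> \<Longrightarrow> mv h w \<in> spanned"
    using eventually_spannedE[OF w] by blast
  show ?case
  proof (rule eventually_spannedI[of _ "U \<union> set_mset m"])
    fix h assume h: "h \<in> carrier G" "\<rho> h ` (U \<union> set_mset m) \<subseteq> \<iota> ` D"
    define m' where "m' = image_mset (inv_into D \<iota>) (image_mset (\<rho> h) m)"
    have hm: "\<rho> h x \<in> \<iota> ` D" if "x \<in># m" for x
      using h(2) that by auto
    have m': "set_mset m' \<subseteq> D"
      using hm by (auto simp: m'_def intro!: inv_into_into)
    have "image_mset \<iota> m' = image_mset (\<rho> h) m"
      using hm by (auto simp: m'_def multiset.map_comp f_inv_into_f intro!: image_mset_cong)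
    then have "mv h (sc (single k c m) w) = cs c (sc (mono (image_mset \<iota> m')) (mv h w))"
      using h(1) c m U(1) iota_mset[OF m'] sc_split(1)[OF c iota_mset[OF m'], of "mv h w"]
      by (simp add: mv_sc_single)
    moreover have "mv h w \<in> spanned"
      using h by (intro U(4)) auto
    ultimately show "mv h (sc (single k c m) w) \<in> spanned"
      using spanned_scale[OF spanned_mono[OF _ m'] c] by simp
  qed (use U c m in auto)
next
  case (add p q)
  then show ?case
    using eventually_spanned_add eventually_spannedE[OF w] by (metis sc_add_left)
qed

lemma eventually_spanned_generator:
  assumes i: "i < n"
  shows "v i \<in> eventually_spanned"
proof (rule eventually_spannedI[of _ "Ts i"])
  show "v i \<in> carrier V" "finite (Ts i)" "Ts i \<subseteq> S"
    using v_closed[OF i] v_supp[OF i] by (auto simp: supports_def)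
  fix h assume h: "h \<in> carrier G" "\<rho> h ` Ts i \<subseteq> \<iota> ` D"
  obtain A where A: "A \<subseteq> D" "\<rho> h ` Ts i = \<iota> ` A"
    using h(2) by (meson subset_imageE)
  have inj: "inj_on \<iota> A"
    using A(1) iota_inj by (rule inj_on_subset[rotated])
  have "finite (\<iota> ` A)"
    using A(2) \<open>finite (Ts i)\<close> by (metis finite_imageI)
  then have fin: "finite A"
    using inj by (simp add: finite_image_iff)
  have "inj_on (\<rho> h) (Ts i)"
    using rho_Bij[OF h(1)] \<open>Ts i \<subseteq> S\<close> by (auto simp: Bij_def bij_betw_def intro: inj_on_subset)
  then have "card A = card (Ts i)"
    using A(2) inj by (metis card_image)
  then have "(i, {#}, mset_set A) \<in> valid"
    using i A fin by (simp add: valid_def)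
  moreover have "el (i, {#}, mset_set A) = mv h (v i)"
    using el_eq[OF i h(1), of "mset_set A" "{#}"] A fin h(1) v_closed[OF i] LT.sc_one by simp
  ultimately show "mv h (v i) \<in> spanned"
    using spanned_el by metis
qed

lemma all_eventually_spanned: "carrier V \<subseteq> eventually_spanned"
proof -
  have "submodule eventually_spanned KSG V"
  proof (rule submoduleI')
    show "eventually_spanned \<subseteq> carrier V"
      by (auto simp: eventually_spanned_def)
    show "\<zero>\<^bsub>V\<^esub> \<in> eventually_spanned"
      by (rule eventually_spannedI[of _ "{}"]) (auto simp: mv_zero spanned_def LT.below_zero)
    show "u \<oplus>\<^bsub>V\<^esub> w \<in> eventually_spanned" if "u \<in> eventually_spanned" "w \<in> eventually_spanned" for u w
      using that by (rule eventually_spanned_add)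
    show "f \<odot>\<^bsub>V\<^esub> w \<in> eventually_spanned" if f: "f \<in> carrier KSG" and w: "w \<in> eventually_spanned" for f w
      using f
    proof (induction f rule: KSG.single_induct)
      case (single p g)
      then show ?case
        using eventually_spannedE[OF w]
        by (metis smult_single eventually_spanned_sc eventually_spanned_mv w)
    next
      case (add f h)
      then show ?case
        using eventually_spannedE[OF w] by (metis V.smult_l_distr eventually_spanned_add)
    qed
  qed
  then show ?thesis
    using gen_minimal[of eventually_spanned "v ` {..<n}"] eventually_spanned_generator generating by auto
qed

text \<open>
  An element of \<open>H\<close> is moved into the span of the terms, where it is generated by the finite set
  \<open>B\<close>, and moved back.
\<close>
theorem noetherian: "noetherian_module KSG V"
proof (intro noetherian_module.intro noetherian_module_axioms.intro V.left_module_axioms)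
  fix H assume H: "submodule H KSG V"
  note HV = submoduleD[OF H]
  have subspace: "LT.subspace H'" if "submodule H' KSG V" for H'
    using submoduleD[OF that] submodule_sc[OF that] unfolding LT.subspace_def by simp
  have rel: "almost_full_on
     (\<lambda>t t'. \<exists>m \<phi>. strict_mono \<phi> \<and> set_mset m \<subseteq> set_mset (fst (snd t')) \<and> move m \<phi> t = t') valid"
    by (rule almost_full_on_image[OF mono_term_almost_full[of n "\<lambda>i. card (Ts i)"], of _ "\<lambda>t. t"])
      (auto simp: valid_def)
  have "\<exists>B\<subseteq>H. finite B \<and> (\<forall>w\<in>H. \<forall>t c. LT.has_lead w t c \<longrightarrow> w \<in> gen B)"
  proof (rule LT.finitely_many_generate[OF rel subspace[OF H]])
    fix B assume "B \<subseteq> H"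
    then show "LT.subspace (gen B) \<and> B \<subseteq> gen B \<and> gen B \<subseteq> H"
      using HV(1) by (intro conjI subspace submodule_gen gen_superset gen_minimal[OF H]) auto
  next
    fix B w t t' c
    assume B: "B \<subseteq> H" and w: "w \<in> gen B" "LT.has_lead w t c" and t': "t' \<in> valid"
      and "\<exists>m \<phi>. strict_mono \<phi> \<and> set_mset m \<subseteq> set_mset (fst (snd t')) \<and> move m \<phi> t = t'"
    then obtain m \<phi> where m: "strict_mono \<phi>" "set_mset m \<subseteq> set_mset (fst (snd t'))" "move m \<phi> t = t'"
      by blast
    have "set_mset m \<subseteq> D"
      using m(2) t' unfolding valid_def by fastforce
    moreover have "submodule (gen B) KSG V"
      using B HV(1) by (intro submodule_gen) auto
    ultimately show "\<exists>w'\<in>gen B. LT.has_lead w' t' c"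
      using transport_leading_term[OF _ w, of m \<phi>] m by auto
  qed
  then obtain B where B: "B \<subseteq> H" "finite B" and lead: "\<And>w t c. \<lbrakk>w \<in> H; LT.has_lead w t c\<rbrakk> \<Longrightarrow> w \<in> gen B"
    by blast
  have BV: "B \<subseteq> carrier V"
    using B HV(1) by blast
  note gen = submodule_gen[OF BV]
  have "w \<in> gen B" if w: "w \<in> H" for w
  proof -
    have wV: "w \<in> carrier V"
      using w HV(1) by blast
    then obtain U where U: "finite U" "U \<subseteq> S"
      "\<And>h. \<lbrakk>h \<in> carrier G; \<rho> h ` U \<subseteq> \<iota> ` D\<rbrakk> \<Longrightarrow> mv h w \<in> spanned"
      using all_eventually_spanned eventually_spannedE[of w] by (metis subsetD)
    obtain h where h: "h \<in> carrier G" "\<rho> h ` U \<subseteq> \<iota> ` D"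
      using move_into_positions[OF U(1,2)] by blast
    then obtain t where "mv h w \<in> LT.below t"
      using U(3)[OF h] unfolding spanned_def by blast
    moreover have "mv h w \<in> H"
      using H h w by (intro submodule_mv)
    ultimately have "mv h w \<in> gen B"
      using LT.below_has_lead lead submoduleD(2)[OF gen] by metis
    from submodule_mv[OF gen G.inv_closed[OF h(1)] this] show ?thesis
      unfolding mv_inv[OF h(1) wV] .
  qed
  then have "H = gen B"
    using gen_minimal[OF H B(1)] by blast
  then show "\<exists>A\<subseteq>carrier V. finite A \<and> H = generated_submodule KSG V A"
    using B BV by blast
qed

end

theorem (in poly_action) noetherian_if_finitely_generated:
  fixes V :: "('g \<Rightarrow> 's multiset \<Rightarrow> 'a, 'v) module"
  assumes "noetherian_ring k" and hom: "homogeneous_action S r G \<rho>"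
    and V: "discrete_poly_module k S G \<rho> V" and "finitely_generated KSG V"
  shows "noetherian_module KSG V"
proof -
  interpret V: discrete_poly_module k S G \<rho> V
    by (rule V)
  obtain B where B: "B \<subseteq> carrier V" "finite B" "V.gen B = carrier V"
    using assms(4) unfolding finitely_generated_def by blast
  obtain v and n :: nat where v: "B = v ` {i. i < n}"
    using finite_imp_nat_seg_image_inj_on[OF B(2)] by blast
  have vV: "v i \<in> carrier V" if "i < n" for i
    using that B(1) v by auto
  then have "\<forall>i. \<exists>T. i < n \<longrightarrow> V.supp T (v i)"
    using V.finite_support by blast
  then obtain Ts where Ts: "\<And>i. i < n \<Longrightarrow> V.supp (Ts i) (v i)"
    by metis
  have "\<exists>\<iota> D. (D = {} \<and> S = {} \<or> D = (UNIV :: nat set)) \<and> (\<forall>p\<in>D. \<iota> p \<in> S) \<and>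
      (\<forall>p\<in>D. \<forall>q\<in>D. p < q \<longrightarrow> (\<iota> p, \<iota> q) \<in> r - Id)"
  proof (cases "S = {}")
    case False
    obtain \<iota> :: "nat \<Rightarrow> 's" where "range \<iota> \<subseteq> S" "\<forall>p q. p < q \<longrightarrow> (\<iota> p, \<iota> q) \<in> r - Id"
      using homogeneous_action.increasing_sequence[OF hom False] by blast
    then show ?thesis
      by (intro exI[of _ \<iota>] exI[of _ UNIV]) auto
  qed auto
  then obtain \<iota> and D :: "nat set" where D: "D = {} \<and> S = {} \<or> D = UNIV" "\<And>p. p \<in> D \<Longrightarrow> \<iota> p \<in> S"
    "\<And>p q. \<lbrakk>p \<in> D; q \<in> D; p < q\<rbrakk> \<Longrightarrow> (\<iota> p, \<iota> q) \<in> r - Id"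
    by blast
  have "generated_module k S G \<rho> V r n v Ts \<iota> D"
    using assms(1) hom vV Ts D B(3) v
    by (intro generated_module.intro generated_module_axioms.intro V)
      (auto simp: lessThan_def)
  then show ?thesis
    by (rule generated_module.noetherian)
qed

context poly_action
begin

lemma poly_module_smult_single:
  "\<lbrakk>a \<in> carrier KS; g \<in> carrier G; p \<in> carrier KS\<rbrakk> \<Longrightarrow>
     single KS a g \<odot>\<^bsub>poly_module k S \<rho>\<^esub> p = a \<otimes>\<^bsub>KS\<^esub> act g p"
  by (rule semilinear_module.smult_single[OF semilinear_poly_module]) (simp_all add: poly_module_simps(1))

lemma discrete_poly_ring: "discrete_poly_module k S G \<rho> (poly_module k S \<rho>)"
proof (intro discrete_poly_module.intro discrete_poly_module_axioms.intro poly_action_module.intro)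
  show "left_module KSG (poly_module k S \<rho>)"
    by (rule semilinear_module.left_module_semilinear[OF semilinear_poly_module])
  fix p assume "p \<in> carrier (poly_module k S \<rho>)"
  then have p: "p \<in> carrier KS"
    by (simp add: poly_module_simps(1))
  obtain U where U: "finite U" "U \<subseteq> S" and eq: "\<And>\<pi> \<tau>. \<lbrakk>\<pi> \<in> Bij S; \<tau> \<in> Bij S; \<forall>u\<in>U. \<pi> u = \<tau> u\<rbrakk> \<Longrightarrow>
      poly_act k S \<pi> p = poly_act k S \<tau> p"
    using poly_act_finite_support[OF p] by blast
  have "group_move k S (poly_module k S \<rho>) g p = p" if g: "g \<in> carrier G" "\<forall>u\<in>U. \<rho> g u = u" for g
  proof -
    have "\<forall>u\<in>U. \<rho> g u = \<rho> \<one>\<^bsub>G\<^esub> u"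
      using g U by (auto simp: rho_one_app subset_iff)
    then have "act g p = p"
      using eq[of "\<rho> g" "\<rho> \<one>\<^bsub>G\<^esub>"] g p by (simp add: rho_Bij act_one')
    then show ?thesis
      using g p by (simp add: group_move_def skew_elem_eq poly_module_smult_single)
  qed
  with U show "\<exists>T. supports k S G \<rho> (poly_module k S \<rho>) T p"
    unfolding supports_def by blast
qed (rule poly_action_axioms)

lemma finitely_generated_poly_ring: "finitely_generated KSG (poly_module k S \<rho>)"
proof -
  interpret P: discrete_poly_module k S G \<rho> "poly_module k S \<rho>"
    by (rule discrete_poly_ring)
  have one: "{\<one>\<^bsub>KS\<^esub>} \<subseteq> carrier (poly_module k S \<rho>)"
    by (simp add: poly_module_simps(1))
  note gen = P.submodule_gen[OF one]
  have "p \<in> P.gen {\<one>\<^bsub>KS\<^esub>}" if "p \<in> carrier (poly_module k S \<rho>)" for p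
  proof -
    have p: "p \<in> carrier KS"
      using that by (simp add: poly_module_simps(1))
    have "\<one>\<^bsub>KS\<^esub> \<in> P.gen {\<one>\<^bsub>KS\<^esub>}"
      using P.gen_superset by blast
    then have "single KS p \<one>\<^bsub>G\<^esub> \<odot>\<^bsub>poly_module k S \<rho>\<^esub> \<one>\<^bsub>KS\<^esub> \<in> P.gen {\<one>\<^bsub>KS\<^esub>}"
      using p by (intro P.submoduleD(4)[OF gen] KSG.single_closed) auto
    then show ?thesis
      using p by (simp add: poly_module_smult_single act_one')
  qed
  then have "P.gen {\<one>\<^bsub>KS\<^esub>} = carrier (poly_module k S \<rho>)"
    using P.submoduleD(1)[OF gen] by blast
  then show ?thesis
    unfolding finitely_generated_def using one by blast
qed

end

theorem theorem1p3:
  fixes k :: "('a, 'b) ring_scheme"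
    and S :: "'s set"
    and r :: "'s rel"
    and G :: "('g, 'c) monoid_scheme"
    and \<rho> :: "'g \<Rightarrow> 's \<Rightarrow> 's"
  assumes "cring k" and "noetherian_ring k"
    and "homogeneous_linear_order S r"
    and "group G" and "\<rho> \<in> hom G (order_aut_group S r)"
    and "highly_homogeneous G S \<rho>"
  shows
    "equivalent_categories
       (discrete_module_category k S G \<rho>
          :: (('g \<Rightarrow> 's multiset \<Rightarrow> 'a, 'm) module, 'm \<Rightarrow> 'm) category)
       (discrete_module_category k S (order_aut_group S r) (\<lambda>\<sigma>. \<sigma>)
          :: ((('s \<Rightarrow> 's) \<Rightarrow> 's multiset \<Rightarrow> 'a, 'm) module, 'm \<Rightarrow> 'm) category)
     \<and> (\<forall>V :: ('g \<Rightarrow> 's multiset \<Rightarrow> 'a, 'm) module.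
          discrete_module k S G \<rho> V \<and> finitely_generated (skew_group_ring k S G \<rho>) V
            \<longrightarrow> noetherian_module (skew_group_ring k S G \<rho>) V)
     \<and> noetherian_module (skew_group_ring k S G \<rho>) (poly_module k S \<rho>)"
  proof -
  interpret k: cring k by fact
  have hom: "homogeneous_action S r G \<rho>"
    using assms(3,5,6) by (auto simp: homogeneous_action_def homogeneous_linear_order_def)
  interpret homogeneous_action S r G \<rho>
    by (rule hom)
  let ?A = "order_aut_group S r"
  have id: "(\<lambda>f. f) \<in> hom ?A (BijGroup S)"
    by (auto simp: hom_def order_aut_group_def BijGroup_def)
  interpret A: poly_action k S G \<rho>
    by (intro poly_action.intro polynomials.intro poly_action_axioms.intro assms action_BijGroup)
  interpret B: poly_action k S ?A "\<lambda>f. f"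
    by (intro poly_action.intro polynomials.intro poly_action_axioms.intro assms group_order_aut id)
  interpret mutually_dense_actions k S G \<rho> ?A "\<lambda>f. f"
  proof (intro mutually_dense_actions.intro dense_actions.intro dense_actions_axioms.intro
      A.poly_action_axioms B.poly_action_axioms)
    show "\<exists>g\<in>carrier G. \<forall>t\<in>T. \<rho> g t = f t" if "f \<in> carrier ?A" "finite T" "T \<subseteq> S" for f T
      using that by (rule dense_in_aut)
    show "\<exists>f\<in>carrier ?A. \<forall>t\<in>T. f t = \<rho> g t" if "g \<in> carrier G" "finite T" "T \<subseteq> S" for g T
      using rho_aut[OF that(1)] by blast
  qed
  show ?thesis
  proof (intro conjI allI impI)
    show "equivalent_categories
       (discrete_module_category k S G \<rho>
          :: (('g \<Rightarrow> 's multiset \<Rightarrow> 'a, 'm) module, 'm \<Rightarrow> 'm) category)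
       (discrete_module_category k S ?A (\<lambda>\<sigma>. \<sigma>)
          :: ((('s \<Rightarrow> 's) \<Rightarrow> 's multiset \<Rightarrow> 'a, 'm) module, 'm \<Rightarrow> 'm) category)"
      by (rule equivalent_discrete_module_categories)
    show "noetherian_module (skew_group_ring k S G \<rho>) V"
      if "discrete_module k S G \<rho> V \<and> finitely_generated (skew_group_ring k S G \<rho>) V"
      for V :: "('g \<Rightarrow> 's multiset \<Rightarrow> 'a, 'm) module"
      using that A.noetherian_if_finitely_generated[OF assms(2) hom] A.discrete_module_iff by blast
    show "noetherian_module (skew_group_ring k S G \<rho>) (poly_module k S \<rho>)"
      by (rule A.noetherian_if_finitely_generated[OF assms(2) hom A.discrete_poly_ring
            A.finitely_generated_poly_ring])
  qed
qed

end
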